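(* Let $\tau:E\to\mathbb{R}$ be a bundle with $\dim E=n+1$, and let $R$ be a type $(1,1)$ tensor on $E$ with $R(dt)=0$ which is algebraically diagonalizable with distinct eigenvalues and has vanishing Nijenhuis torsion. Let $\widetilde{R}_{T^*}$ be the complete lift of $R$ to $T^*E$. Suppose $F$ is a function on $T^*E$ for which the 1-forms $dF,\widetilde{R}_{T^*}(dF),\ldots,\widetilde{R}_{T^*}^n(dF)$ are linearly independent, and let $\mathcal{D}_F=\mathrm{sp}\{dF,\widetilde{R}_{T^*}(dF),\ldots,\widetilde{R}_{T^*}^n(dF)\}^\circ$ be the distribution of vector fields annihilating these 1-forms. Then $\mathcal{D}_F$ is (Frobenius) integrable if and only if $$d\,d_{\widetilde{R}_{T^*}}F\big|_{\mathcal{D}_F}=0,$$ i.e. $\big(d(\widetilde{R}_{T^*}(dF))\big)(X,Y)=0$ for all $X,Y\in\mathcal{D}_F$.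
   Context: All objects are smooth. $E$ has bundle coordinates $(t,q^i)$, $i=1,\ldots,n$, where $t$ is the (pulled-back) coordinate of $\mathbb{R}$. $T^*E$ has natural coordinates $(t,q^i,p_0,p_i)$ and canonical 1-form $\theta_E=p_0dt+p_idq^i$. A $(1,1)$ tensor $L$ acts on vector fields and on 1-forms, with $\langle X,L(\alpha)\rangle=\langle L(X),\alpha\rangle$. If $R(dt)=0$, then $R=R^i_j(t,q)\frac{\partial}{\partial q^i}\otimes dq^j+R^i_0(t,q)\frac{\partial}{\partial q^i}\otimes dt$. "Algebraically diagonalizable with distinct eigenvalues" means that at each $e\in E$ the endomorphism $R_e$ of $T_eE$ is diagonalizable with $n+1$ distinct eigenvalues (one of which is $0$). $N_R(X,Y)=[RX,RY]+R^2[X,Y]-R[RX,Y]-R[X,RY]$ is the Nijenhuis torsion. $\tau_R:T^*E\to T^*E$ is the fibre linear map $(t,q^i,p_0,p_i)\mapsto(t,q^i,R^i_0p_i,R^i_jp_i)$. The complete lift $\widetilde{R}_{T^*}$ of $R$ to $T^*E$ is the $(1,1)$ tensor defined by $i_{\widetilde{R}_{T^*}(Z)}d\theta_E=i_Z(\tau_R^*d\theta_E)$ for all vector fields $Z$ on $T^*E$. For a $(1,1)$ tensor $L$ and a function $F$, $d_LF=L(dF)$. *)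

theory Defs
  imports "HOL-Analysis.Analysis"
begin

section \<open>Smooth maps between Euclidean spaces\<close>

text \<open>All iterated directional derivatives up to order \<open>k\<close> exist and the last ones are continuous.
  The definition is used for open sets only.\<close>

fun C_k_on :: "nat \<Rightarrow> 'v::euclidean_space set \<Rightarrow> ('v \<Rightarrow> 'u::real_normed_vector) \<Rightarrow> bool" where
  "C_k_on 0 S f \<longleftrightarrow> continuous_on S f"
| "C_k_on (Suc k) S f \<longleftrightarrow>
     (\<forall>x\<in>S. f differentiable (at x)) \<and> (\<forall>v. C_k_on k S (\<lambda>x. frechet_derivative f (at x) v))"

definition smooth_on :: "'v::euclidean_space set \<Rightarrow> ('v \<Rightarrow> 'u::real_normed_vector) \<Rightarrow> bool" where
  "smooth_on S f \<longleftrightarrow> (\<forall>k. C_k_on k S f)"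

section \<open>Smooth manifolds\<close>

text \<open>A manifold modelled on \<open>'v\<close> is a point set with an indexed atlas; the chart
  \<open>coord M i : chart_dom M i \<rightarrow> 'v\<close> is meaningful for \<open>i \<in> charts M\<close>.
  The topology is the one induced by the atlas.\<close>

record ('i, 'a, 'v) manifold =
  points :: "'a set"
  charts :: "'i set"
  chart_dom :: "'i \<Rightarrow> 'a set"
  coord :: "'i \<Rightarrow> 'a \<Rightarrow> 'v"

definition chart_img :: "('i, 'a, 'v) manifold \<Rightarrow> 'i \<Rightarrow> 'v set" where
  "chart_img M i = coord M i ` chart_dom M i"

definition param :: "('i, 'a, 'v) manifold \<Rightarrow> 'i \<Rightarrow> 'v \<Rightarrow> 'a" where
  "param M i = inv_into (chart_dom M i) (coord M i)"

definition overlap :: "('i, 'a, 'v) manifold \<Rightarrow> 'i \<Rightarrow> 'i \<Rightarrow> 'v set" where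
  "overlap M i j = coord M i ` (chart_dom M i \<inter> chart_dom M j)"

definition transition :: "('i, 'a, 'v) manifold \<Rightarrow> 'i \<Rightarrow> 'i \<Rightarrow> 'v \<Rightarrow> 'v" where
  "transition M i j = coord M j \<circ> param M i"

definition manifold_topology :: "('i, 'a, 'v::euclidean_space) manifold \<Rightarrow> 'a topology" where
  "manifold_topology M = topology (\<lambda>V. V \<subseteq> points M \<and>
     (\<forall>i\<in>charts M. open (coord M i ` (V \<inter> chart_dom M i))))"

definition smooth_manifold :: "('i, 'a, 'v::euclidean_space) manifold \<Rightarrow> bool" where
  "smooth_manifold M \<longleftrightarrow>
     points M = (\<Union>i\<in>charts M. chart_dom M i) \<and>
     (\<forall>i\<in>charts M. inj_on (coord M i) (chart_dom M i) \<and> open (chart_img M i)) \<and>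
     (\<forall>i\<in>charts M. \<forall>j\<in>charts M.
        open (overlap M i j) \<and> smooth_on (overlap M i j) (transition M i j)) \<and>
     Hausdorff_space (manifold_topology M) \<and> second_countable (manifold_topology M)"

definition smooth_function :: "('i, 'a, 'v::euclidean_space) manifold \<Rightarrow> ('a \<Rightarrow> real) \<Rightarrow> bool" where
  "smooth_function M f \<longleftrightarrow> (\<forall>i\<in>charts M. smooth_on (chart_img M i) (f \<circ> param M i))"

definition smooth_map ::
  "('i, 'a, 'v::euclidean_space) manifold \<Rightarrow> ('j, 'b, 'w::euclidean_space) manifold \<Rightarrow> ('a \<Rightarrow> 'b) \<Rightarrow> bool"
  where
  "smooth_map M N f \<longleftrightarrow> f ` points M \<subseteq> points N \<and>
     (\<forall>i\<in>charts M. \<forall>j\<in>charts N.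
        open (coord M i ` (chart_dom M i \<inter> f -` chart_dom N j)) \<and>
        smooth_on (coord M i ` (chart_dom M i \<inter> f -` chart_dom N j)) (coord N j \<circ> f \<circ> param M i))"

definition diffeomorphism ::
  "('i, 'a, 'v::euclidean_space) manifold \<Rightarrow> ('j, 'b, 'w::euclidean_space) manifold \<Rightarrow> ('a \<Rightarrow> 'b) \<Rightarrow> bool"
  where
  "diffeomorphism M N f \<longleftrightarrow> bij_betw f (points M) (points N) \<and>
     smooth_map M N f \<and> smooth_map N M (inv_into (points M) f)"

definition open_submanifold :: "('i, 'a, 'v) manifold \<Rightarrow> 'a set \<Rightarrow> ('i, 'a, 'v) manifold" where
  "open_submanifold M W = \<lparr>points = points M \<inter> W, charts = charts M,
     chart_dom = (\<lambda>i. chart_dom M i \<inter> W), coord = coord M\<rparr>"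

definition prod_manifold ::
  "('i, 'a, 'v) manifold \<Rightarrow> ('j, 'b, 'w) manifold \<Rightarrow> ('i \<times> 'j, 'a \<times> 'b, 'v \<times> 'w) manifold" where
  "prod_manifold M N = \<lparr>points = points M \<times> points N, charts = charts M \<times> charts N,
     chart_dom = (\<lambda>(i, j). chart_dom M i \<times> chart_dom N j),
     coord = (\<lambda>(i, j) (x, y). (coord M i x, coord N j y))\<rparr>"

definition real_line :: "(unit, real, real) manifold" where
  "real_line = \<lparr>points = UNIV, charts = {()}, chart_dom = (\<lambda>_. UNIV), coord = (\<lambda>_ t. t)\<rparr>"

text \<open>A smooth, locally trivial fibre bundle \<open>\<tau> : E \<rightarrow> B\<close> with typical fibre \<open>Q\<close>.\<close>

definition fibre_bundle ::
  "('i, 'a, 'v::euclidean_space) manifold \<Rightarrow> ('k, 'c, 'u::euclidean_space) manifold \<Rightarrow>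
   ('j, 'b, 'w::euclidean_space) manifold \<Rightarrow> ('a \<Rightarrow> 'c) \<Rightarrow> bool" where
  "fibre_bundle E B Q \<tau> \<longleftrightarrow>
     smooth_manifold E \<and> smooth_manifold B \<and> smooth_manifold Q \<and>
     smooth_map E B \<tau> \<and> \<tau> ` points E = points B \<and>
     (\<forall>b\<in>points B. \<exists>W \<Phi>. b \<in> W \<and> openin (manifold_topology B) W \<and>
        diffeomorphism (open_submanifold E (\<tau> -` W)) (prod_manifold (open_submanifold B W) Q) \<Phi> \<and>
        (\<forall>e\<in>points E. \<tau> e \<in> W \<longrightarrow> fst (\<Phi> e) = \<tau> e))"

section \<open>Forms and tensor fields in components\<close>

text \<open>Fields are given by their components: one function of the coordinates for each chart,
  with values in the vectors of, respectively the (bi)linear forms on, the model space \<open>'v\<close>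
  (which is the tangent space as seen in the chart).\<close>

type_synonym ('i, 'v) form1 = "'i \<Rightarrow> 'v \<Rightarrow> 'v \<Rightarrow> real"
type_synonym ('i, 'v) form2 = "'i \<Rightarrow> 'v \<Rightarrow> 'v \<Rightarrow> 'v \<Rightarrow> real"
type_synonym ('i, 'v) tensor11 = "'i \<Rightarrow> 'v \<Rightarrow> 'v \<Rightarrow> 'v"

definition tensor_field11 ::
  "('i, 'a, 'v::euclidean_space) manifold \<Rightarrow> ('i, 'v) tensor11 \<Rightarrow> bool" where
  "tensor_field11 M R \<longleftrightarrow>
     (\<forall>i\<in>charts M. (\<forall>x\<in>chart_img M i. linear (R i x)) \<and>
        (\<forall>v. smooth_on (chart_img M i) (\<lambda>x. R i x v))) \<and>
     (\<forall>i\<in>charts M. \<forall>j\<in>charts M. \<forall>x\<in>overlap M i j. \<forall>v.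
        frechet_derivative (transition M i j) (at x) (R i x v) =
        R j (transition M i j x) (frechet_derivative (transition M i j) (at x) v))"

definition tensor_on_form :: "('i, 'v) tensor11 \<Rightarrow> ('i, 'v) form1 \<Rightarrow> ('i, 'v) form1" where
  "tensor_on_form R \<alpha> = (\<lambda>i x v. \<alpha> i x (R i x v))"

definition differential ::
  "('i, 'a, 'v::euclidean_space) manifold \<Rightarrow> ('a \<Rightarrow> real) \<Rightarrow> ('i, 'v) form1" where
  "differential M f = (\<lambda>i x. frechet_derivative (f \<circ> param M i) (at x))"

text \<open>\<open>d\<alpha>(u,v) = u(\<alpha>(v)) - v(\<alpha>(u))\<close> for \<open>u\<close>, \<open>v\<close> constant in the chart.\<close>

definition ext_deriv :: "('i, 'v::real_normed_vector) form1 \<Rightarrow> ('i, 'v) form2" where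
  "ext_deriv \<alpha> = (\<lambda>i x u v.
     frechet_derivative (\<lambda>y. \<alpha> i y v) (at x) u - frechet_derivative (\<lambda>y. \<alpha> i y u) (at x) v)"

definition lie_bracket :: "('v::real_normed_vector \<Rightarrow> 'v) \<Rightarrow> ('v \<Rightarrow> 'v) \<Rightarrow> 'v \<Rightarrow> 'v" where
  "lie_bracket X Y = (\<lambda>x. frechet_derivative Y (at x) (X x) - frechet_derivative X (at x) (Y x))"

definition nijenhuis :: "('v::real_normed_vector \<Rightarrow> 'v \<Rightarrow> 'v) \<Rightarrow> ('v \<Rightarrow> 'v) \<Rightarrow> ('v \<Rightarrow> 'v) \<Rightarrow> 'v \<Rightarrow> 'v" where
  "nijenhuis R X Y = (\<lambda>x.
     lie_bracket (\<lambda>y. R y (X y)) (\<lambda>y. R y (Y y)) x + R x (R x (lie_bracket X Y x))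
     - R x (lie_bracket (\<lambda>y. R y (X y)) Y x) - R x (lie_bracket X (\<lambda>y. R y (Y y)) x))"

definition vanishing_torsion ::
  "('i, 'a, 'v::euclidean_space) manifold \<Rightarrow> ('i, 'v) tensor11 \<Rightarrow> bool" where
  "vanishing_torsion M R \<longleftrightarrow>
     (\<forall>i\<in>charts M. \<forall>X Y. smooth_on (chart_img M i) X \<longrightarrow> smooth_on (chart_img M i) Y \<longrightarrow>
        (\<forall>x\<in>chart_img M i. nijenhuis (R i) X Y x = 0))"

definition diagonalizable_distinct ::
  "('i, 'a, 'v::euclidean_space) manifold \<Rightarrow> ('i, 'v) tensor11 \<Rightarrow> bool" where
  "diagonalizable_distinct M R \<longleftrightarrow>
     (\<forall>i\<in>charts M. \<forall>x\<in>chart_img M i.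
        (\<exists>B. independent B \<and> span B = UNIV \<and> (\<forall>b\<in>B. \<exists>c. R i x b = c *\<^sub>R b)) \<and>
        card {c. \<exists>v. v \<noteq> 0 \<and> R i x v = c *\<^sub>R v} = DIM('v))"

definition independent_forms ::
  "('i, 'a, 'v::euclidean_space) manifold \<Rightarrow> nat \<Rightarrow> (nat \<Rightarrow> ('i, 'v) form1) \<Rightarrow> bool" where
  "independent_forms M n \<alpha> \<longleftrightarrow>
     (\<forall>i\<in>charts M. \<forall>x\<in>chart_img M i. \<forall>c :: nat \<Rightarrow> real.
        (\<forall>v. (\<Sum>k\<le>n. c k * \<alpha> k i x v) = 0) \<longrightarrow> (\<forall>k\<le>n. c k = 0))"

section \<open>Distributions\<close>

text \<open>A distribution is given by its subspace of the model space at each point of each chart.\<close>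

type_synonym ('i, 'v) distribution = "'i \<Rightarrow> 'v \<Rightarrow> 'v set"

definition annihilator :: "nat \<Rightarrow> (nat \<Rightarrow> ('i, 'v) form1) \<Rightarrow> ('i, 'v) distribution" where
  "annihilator n \<alpha> = (\<lambda>i x. {v. \<forall>k\<le>n. \<alpha> k i x v = 0})"

text \<open>The vector fields belonging to a distribution, over an open part \<open>W\<close> of a chart.\<close>

definition section_on ::
  "('i, 'a, 'v::euclidean_space) manifold \<Rightarrow> ('i, 'v) distribution \<Rightarrow> 'i \<Rightarrow> 'v set \<Rightarrow> ('v \<Rightarrow> 'v) \<Rightarrow> bool"
  where
  "section_on M D i W X \<longleftrightarrow> open W \<and> W \<subseteq> chart_img M i \<and> smooth_on W X \<and> (\<forall>x\<in>W. X x \<in> D i x)"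

definition vanishes_on ::
  "('i, 'a, 'v::euclidean_space) manifold \<Rightarrow> ('i, 'v) distribution \<Rightarrow> ('i, 'v) form2 \<Rightarrow> bool" where
  "vanishes_on M D \<omega> \<longleftrightarrow>
     (\<forall>i\<in>charts M. \<forall>W X Y. section_on M D i W X \<longrightarrow> section_on M D i W Y \<longrightarrow>
        (\<forall>x\<in>W. \<omega> i x (X x) (Y x) = 0))"

text \<open>\<open>\<sigma>\<close> is an injective immersion of the open set \<open>B\<close> of \<open>'k\<close> whose image has the spaces of \<open>D\<close>
  as its tangent spaces.\<close>

definition integral_manifold ::
  "('i, 'a, 'v::euclidean_space) manifold \<Rightarrow> ('i, 'v) distribution \<Rightarrow>
   'k::euclidean_space set \<Rightarrow> ('k \<Rightarrow> 'a) \<Rightarrow> bool" where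
  "integral_manifold M D B \<sigma> \<longleftrightarrow>
     open B \<and> inj_on \<sigma> B \<and> \<sigma> ` B \<subseteq> points M \<and>
     (\<forall>i\<in>charts M. open (B \<inter> \<sigma> -` chart_dom M i) \<and>
        smooth_on (B \<inter> \<sigma> -` chart_dom M i) (coord M i \<circ> \<sigma>) \<and>
        (\<forall>b \<in> B \<inter> \<sigma> -` chart_dom M i.
           inj (frechet_derivative (coord M i \<circ> \<sigma>) (at b)) \<and>
           range (frechet_derivative (coord M i \<circ> \<sigma>) (at b)) = D i (coord M i (\<sigma> b))))"

text \<open>Integrability: every point lies on an integral manifold.  The type argument is the model space
  of the integral manifolds, so its dimension has to be the rank of the distribution.\<close>

definition frobenius_integrable ::
  "'k::euclidean_space itself \<Rightarrow> ('i, 'a, 'v::euclidean_space) manifold \<Rightarrow> ('i, 'v) distribution \<Rightarrow> bool"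
  where
  "frobenius_integrable _ M D \<longleftrightarrow>
     (\<forall>x\<in>points M. \<exists>(B :: 'k set) \<sigma>. x \<in> \<sigma> ` B \<and> integral_manifold M D B \<sigma>)"

section \<open>The cotangent bundle\<close>

text \<open>A covector at \<open>e\<close> is the family of its components \<open>p\<^sub>a\<close> in all charts around \<open>e\<close>, subject to the
  transformation law and normalized to \<open>0\<close> at the other indices.  The components are collected
  in an element \<open>p\<close> of \<open>'v\<close>, the covector being \<open>v \<mapsto> p \<bullet> v\<close> in the chart.\<close>

definition covectors :: "('i, 'a, 'v::euclidean_space) manifold \<Rightarrow> 'a \<Rightarrow> ('i \<Rightarrow> 'v) set" where
  "covectors M e = {p.
     (\<forall>i\<in>charts M. \<forall>j\<in>charts M. e \<in> chart_dom M i \<inter> chart_dom M j \<longrightarrow>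
        (\<forall>v. p i \<bullet> v = p j \<bullet> frechet_derivative (transition M i j) (at (coord M i e)) v)) \<and>
     (\<forall>i. \<not> (i \<in> charts M \<and> e \<in> chart_dom M i) \<longrightarrow> p i = 0)}"

definition cotangent_bundle ::
  "('i, 'a, 'v::euclidean_space) manifold \<Rightarrow> ('i, 'a \<times> ('i \<Rightarrow> 'v), 'v \<times> 'v) manifold" where
  "cotangent_bundle M = \<lparr>
     points = {(e, p). e \<in> points M \<and> p \<in> covectors M e},
     charts = charts M,
     chart_dom = (\<lambda>i. {(e, p). e \<in> chart_dom M i \<and> p \<in> covectors M e}),
     coord = (\<lambda>i (e, p). (coord M i e, p i))\<rparr>"

text \<open>\<open>\<theta> = p\<^sub>a dx\<^sup>a\<close> in natural coordinates.\<close>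

definition canonical_form :: "('i, 'v::euclidean_space \<times> 'v) form1" where
  "canonical_form = (\<lambda>i (x, p) (u, w). p \<bullet> u)"

text \<open>The fibre linear map \<open>\<tau>\<^sub>R : (x\<^sup>a, p\<^sub>a) \<mapsto> (x\<^sup>a, R\<^sup>b\<^sub>a p\<^sub>b)\<close>; in bundle coordinates
  \<open>R\<^sup>0\<^sub>a = 0\<close> if \<open>R(dt) = 0\<close>.  It preserves the domains of the natural charts.\<close>

definition fibre_map :: "('i, 'v::euclidean_space) tensor11 \<Rightarrow> 'i \<Rightarrow> 'v \<times> 'v \<Rightarrow> 'v \<times> 'v" where
  "fibre_map R i = (\<lambda>(x, p). (x, adjoint (R i x) p))"

definition pullback2 :: "('i \<Rightarrow> 'v::real_normed_vector \<Rightarrow> 'v) \<Rightarrow> ('i, 'v) form2 \<Rightarrow> ('i, 'v) form2" where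
  "pullback2 f \<omega> = (\<lambda>i z u v. \<omega> i (f i z)
     (frechet_derivative (f i) (at z) u) (frechet_derivative (f i) (at z) v))"

text \<open>The complete lift, defined by \<open>i\<^bsub>L(Z)\<^esub> d\<theta> = i\<^bsub>Z\<^esub> (\<tau>\<^sub>R\<^sup>* d\<theta>)\<close>; \<open>d\<theta>\<close> being
  nondegenerate, \<open>L(Z)\<close> is unique.\<close>

definition complete_lift ::
  "('i, 'v::euclidean_space) tensor11 \<Rightarrow> ('i, 'v \<times> 'v) tensor11" where
  "complete_lift R = (\<lambda>i z Z. THE Y. \<forall>V.
     ext_deriv canonical_form i z Y V = pullback2 (fibre_map R) (ext_deriv canonical_form) i z Z V)"

definition iterated_forms ::
  "('i, 'a, 'v::euclidean_space) manifold \<Rightarrow> ('i, 'v) tensor11 \<Rightarrow> ('a \<Rightarrow> real) \<Rightarrow> nat \<Rightarrow> ('i, 'v) form1"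
  where
  "iterated_forms M L F k = (tensor_on_form L ^^ k) (differential M F)"

end

theory Submission
  imports Defs
begin

text \<open>
  Let \<open>\<omega> = d\<theta>\<close>, let \<open>L\<close> be the complete lift and \<open>\<alpha>\<^sub>k = L\<^sup>k(dF)\<close>.  The lift is \<open>\<omega>\<close>-symmetric, so the vectors
  \<open>L\<^sup>k X\<^sub>F\<close> are pairwise \<open>\<omega>\<close>-orthogonal; hence the distribution is Lagrangian, spanned by them, and \<open>L\<close>-invariant,
  and all \<open>\<alpha>\<^sub>k\<close> vanish on it.  The torsion of \<open>L\<close> vanishes with that of \<open>R\<close>, whence
  \<open>d\<alpha>\<^sub>k\<^sub>+\<^sub>2(X,Y) = d\<alpha>\<^sub>k\<^sub>+\<^sub>1(LX,Y) + d\<alpha>\<^sub>k\<^sub>+\<^sub>1(X,LY) - d\<alpha>\<^sub>k(LX,LY)\<close>.  As \<open>d\<alpha>\<^sub>0 = 0\<close>, the vanishing of \<open>d\<alpha>\<^sub>1\<close> on the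
  distribution propagates to all \<open>d\<alpha>\<^sub>k\<close>, so the distribution is involutive and Frobenius' theorem applies.
  Conversely, the \<open>\<alpha>\<^sub>k\<close>, and with them the \<open>d\<alpha>\<^sub>k\<close>, pull back to zero on integral manifolds.
\<close>

section \<open>Smooth maps and second derivatives\<close>

text \<open>The 1-forms S^b_a p_b dx^a (\<open>fibre_form S\<close>) carry the argument on torsion.
  Their differentials for S = id, R, R^2 are \<omega>, \<omega>(L.,.) and, thanks to the vanishing
  torsion of R, \<omega>(L^2.,.). An \<omega>-symmetric tensor for which the last two 2-forms are
  closed has vanishing torsion. The symmetry of L is the antisymmetry of the second form. The
  Lagrangian property is a count: n+1 independent forms in dimension 2(n+1) have a kernel of
  dimension n+1, as many as there are independent vectors L^k X_F in it. What it buys is that the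
  forms of index above n vanish on the kernel as well; without index n+1 the kernel could not be
  seen to be L-invariant. Integrability means existence of integral manifolds, so they have to be
  constructed: near a point the kernel is a graph over a fixed splitting, which turns the problem
  into Du = A(x,u). This is solved by a contraction along rays, and only afterwards is the solution
  shown to be differentiable.\<close>

abbreviation fd :: "('v::real_normed_vector \<Rightarrow> 'u::real_normed_vector) \<Rightarrow> 'v \<Rightarrow> 'v \<Rightarrow> 'u" where
  "fd f x \<equiv> frechet_derivative f (at x)"

lemma fd_eqI: "(f has_derivative f') (at x) \<Longrightarrow> fd f x = f'"
  using frechet_derivative_at by metis

lemma fd_works: "f differentiable (at x) \<Longrightarrow> (f has_derivative fd f x) (at x)"
  using frechet_derivative_works by blast

lemma fd_linear: "f differentiable (at x) \<Longrightarrow> linear (fd f x)"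
  by (simp add: linear_frechet_derivative)

lemma has_derivative_cong_open:
  assumes "open S" "x \<in> S" "\<And>y. y \<in> S \<Longrightarrow> f y = g y"
  shows "(f has_derivative f') (at x) \<longleftrightarrow> (g has_derivative f') (at x)"
  using assms by (metis has_derivative_transform_within_open)

lemma fd_cong_open:
  assumes "open S" "x \<in> S" "\<And>y. y \<in> S \<Longrightarrow> f y = g y"
  shows "fd f x = fd g x"
  unfolding frechet_derivative_def using has_derivative_cong_open[OF assms] by simp

lemma differentiable_cong_open:
  assumes "open S" "x \<in> S" "\<And>y. y \<in> S \<Longrightarrow> f y = g y"
  shows "f differentiable (at x) \<longleftrightarrow> g differentiable (at x)"
  unfolding differentiable_def using has_derivative_cong_open[OF assms] by simp

text \<open>Reduces a family of linear maps to finitely many functions with fixed argument, the only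
  ones that \<open>C_k_on\<close> and \<open>tensor_field11\<close> speak of.\<close>

lemma linear_basis_expand:
  fixes f :: "'v::euclidean_space \<Rightarrow> 'u::real_vector"
  assumes "linear f"
  shows "f v = (\<Sum>b\<in>Basis. (v \<bullet> b) *\<^sub>R f b)"
proof -
  have "f v = f (\<Sum>b\<in>Basis. (v \<bullet> b) *\<^sub>R b)" by (simp add: euclidean_representation)
  also have "\<dots> = (\<Sum>b\<in>Basis. (v \<bullet> b) *\<^sub>R f b)"
    by (simp only: linear_sum[OF assms] linear_scale[OF assms])
  finally show ?thesis .
qed

section \<open>Calculus of C^k and smooth maps\<close>

lemma C_k_on_cong:
  "open S \<Longrightarrow> (\<And>x. x \<in> S \<Longrightarrow> f x = g x) \<Longrightarrow> C_k_on k S f \<longleftrightarrow> C_k_on k S g"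
proof (induction k arbitrary: f g)
  case 0
  then show ?case by simp
next
  case (Suc k)
  have "C_k_on k S (\<lambda>x. fd f x v) \<longleftrightarrow> C_k_on k S (\<lambda>x. fd g x v)" for v
    by (rule Suc.IH[OF Suc.prems(1)]) (use fd_cong_open[OF Suc.prems(1) _ Suc.prems(2)] in auto)
  moreover have "f differentiable (at x) \<longleftrightarrow> g differentiable (at x)" if "x \<in> S" for x
    by (rule differentiable_cong_open[OF Suc.prems(1) that Suc.prems(2)])
  ultimately show ?case by simp
qed

lemma C_k_on_subset: "C_k_on k S f \<Longrightarrow> T \<subseteq> S \<Longrightarrow> C_k_on k T f"
  by (induction k arbitrary: f) (auto intro: continuous_on_subset)

lemma C_k_on_SucD: "C_k_on (Suc k) S f \<Longrightarrow> C_k_on k S f"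
proof (induction k arbitrary: f)
  case 0
  then show ?case
    by (auto intro!: continuous_at_imp_continuous_on differentiable_imp_continuous_within)
next
  case (Suc k)
  then show ?case by (metis C_k_on.simps(2))
qed

lemma C_k_on_le: "C_k_on k S f \<Longrightarrow> j \<le> k \<Longrightarrow> C_k_on j S f"
proof (induction k)
  case (Suc k) then show ?case using C_k_on_SucD le_Suc_eq by blast
qed simp

text \<open>Admits any explicit formula for the derivative in place of
  \<open>frechet_derivative\<close>, so that the rules of differentiation can be used
  directly.\<close>

lemma C_k_on_SucI:
  assumes "open S" "\<And>x. x \<in> S \<Longrightarrow> (f has_derivative f' x) (at x)"
    "\<And>v. C_k_on k S (\<lambda>x. f' x v)"
  shows "C_k_on (Suc k) S f"
proof -
  have "C_k_on k S (\<lambda>x. fd f x v)" for v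
    using C_k_on_cong[OF assms(1), of "\<lambda>x. fd f x v" "\<lambda>x. f' x v" k] fd_eqI[OF assms(2)] assms(3) by simp
  then show ?thesis using assms(2) by (auto simp: differentiable_def)
qed

lemma C_k_on_imp_continuous_on: "C_k_on k S f \<Longrightarrow> continuous_on S f"
  using C_k_on_le[of k S f 0] by simp

lemma C_k_on_const: "C_k_on k S (\<lambda>x. c)"
  by (induction k arbitrary: c) auto

lemma C_k_on_bounded_linear_comp:
  "open S \<Longrightarrow> bounded_linear l \<Longrightarrow> C_k_on k S f \<Longrightarrow> C_k_on k S (\<lambda>x. l (f x))"
proof (induction k arbitrary: f)
  case 0
  then show ?case by (auto intro: bounded_linear.continuous_on)
next
  case (Suc k)
  show ?case
  proof (rule C_k_on_SucI[OF Suc.prems(1), where f' = "\<lambda>x v. l (fd f x v)"])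
    fix x assume "x \<in> S"
    then show "((\<lambda>x. l (f x)) has_derivative (\<lambda>v. l (fd f x v))) (at x)"
      using Suc.prems bounded_linear.has_derivative fd_works by fastforce
  qed (use Suc in auto)
qed

lemma C_k_on_bounded_linear: "open S \<Longrightarrow> bounded_linear l \<Longrightarrow> C_k_on k S l"
proof (cases k)
  case 0 then show "bounded_linear l \<Longrightarrow> ?thesis" by (simp add: linear_continuous_on)
next
  case (Suc j)
  assume "open S" "bounded_linear l"
  then show ?thesis unfolding Suc
    by (intro C_k_on_SucI[where f' = "\<lambda>x. l"] C_k_on_const)
      (auto simp: bounded_linear_imp_has_derivative)
qed

lemma C_k_on_add:
  "open S \<Longrightarrow> C_k_on k S f \<Longrightarrow> C_k_on k S g \<Longrightarrow> C_k_on k S (\<lambda>x. f x + g x)"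
proof (induction k arbitrary: f g)
  case 0 then show ?case by (auto intro: continuous_on_add)
next
  case (Suc k)
  show ?case
  proof (rule C_k_on_SucI[OF Suc.prems(1), where f' = "\<lambda>x v. fd f x v + fd g x v"])
    fix x assume "x \<in> S"
    then show "((\<lambda>x. f x + g x) has_derivative (\<lambda>v. fd f x v + fd g x v)) (at x)"
      using Suc.prems by (auto intro!: has_derivative_add fd_works)
  qed (use Suc in auto)
qed

text \<open>The product rule again gives a sum of bilinear expressions in C^k factors, so the
  induction closes. Scalar multiplication, inner product and composition of operators are all
  instances.\<close>

lemma C_k_on_bilinear:
  assumes "bounded_bilinear p" "open S"
  shows "C_k_on k S f \<Longrightarrow> C_k_on k S g \<Longrightarrow> C_k_on k S (\<lambda>x. p (f x) (g x))"
proof (induction k arbitrary: f g)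
  case 0 then show ?case using bounded_bilinear.continuous_on[OF assms(1)] by auto
next
  case (Suc k)
  show ?case
  proof (rule C_k_on_SucI[OF assms(2), where f' = "\<lambda>x v. p (f x) (fd g x v) + p (fd f x v) (g x)"])
    fix x assume "x \<in> S"
    then show "((\<lambda>x. p (f x) (g x)) has_derivative (\<lambda>v. p (f x) (fd g x v) + p (fd f x v) (g x))) (at x)"
      using Suc.prems by (auto intro!: bounded_bilinear.FDERIV[OF assms(1)] fd_works)
  next
    fix v
    show "C_k_on k S (\<lambda>x. p (f x) (fd g x v) + p (fd f x v) (g x))"
      using Suc.prems Suc.prems[THEN C_k_on_SucD]
      by (intro C_k_on_add assms Suc.IH) (simp_all only: C_k_on.simps)
  qed
qed

lemma C_k_on_sum:
  "open S \<Longrightarrow> (\<And>i. i \<in> I \<Longrightarrow> C_k_on k S (f i)) \<Longrightarrow> C_k_on k S (\<lambda>x. \<Sum>i\<in>I. f i x)"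
  by (induction I rule: infinite_finite_induct) (auto intro: C_k_on_add C_k_on_const)

lemma C_k_on_compose:
  fixes f :: "'w::euclidean_space \<Rightarrow> 'u::real_normed_vector" and g :: "'v::euclidean_space \<Rightarrow> 'w"
  assumes "open S" "open T" "g ` S \<subseteq> T"
  shows "C_k_on k S g \<Longrightarrow> C_k_on k T f \<Longrightarrow> C_k_on k S (\<lambda>x. f (g x))"
proof (induction k arbitrary: f)
  case 0 then show ?case using assms continuous_on_compose2 by (metis C_k_on.simps(1))
next
  case (Suc k)
  have df: "f differentiable (at (g x))" if "x \<in> S" for x using that Suc.prems assms by auto
  have dg: "g differentiable (at x)" if "x \<in> S" for x using that Suc.prems assms by auto
  \<comment> \<open>The chain rule is written out in partial derivatives of \<open>f\<close>,
    because \<open>C_k_on\<close> controls derivatives in fixed directions only.\<close>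
  show ?case
  proof (rule C_k_on_SucI[OF assms(1), where f' = "\<lambda>x v. \<Sum>b\<in>Basis. (fd g x v \<bullet> b) *\<^sub>R fd f (g x) b"])
    fix x assume x: "x \<in> S"
    have "((\<lambda>x. f (g x)) has_derivative (\<lambda>v. fd f (g x) (fd g x v))) (at x)"
      by (rule has_derivative_compose[OF fd_works[OF dg[OF x]] fd_works[OF df[OF x]]])
    then show "((\<lambda>x. f (g x)) has_derivative (\<lambda>v. \<Sum>b\<in>Basis. (fd g x v \<bullet> b) *\<^sub>R fd f (g x) b)) (at x)"
      by (simp only: linear_basis_expand[OF fd_linear[OF df[OF x]], symmetric])
  next
    fix v
    have "C_k_on k S (\<lambda>x. fd g x v \<bullet> b)" for b
      using Suc.prems by (intro C_k_on_bounded_linear_comp[OF assms(1) bounded_linear_inner_left]) auto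
    moreover have "C_k_on k S (\<lambda>x. fd f (g x) b)" for b
      using Suc.prems C_k_on_SucD by (intro Suc.IH) auto
    ultimately show "C_k_on k S (\<lambda>x. \<Sum>b\<in>Basis. (fd g x v \<bullet> b) *\<^sub>R fd f (g x) b)"
      by (intro C_k_on_sum assms C_k_on_bilinear[OF bounded_bilinear_scaleR])
  qed
qed

lemma smooth_on_cong:
  "open S \<Longrightarrow> (\<And>x. x \<in> S \<Longrightarrow> f x = g x) \<Longrightarrow> smooth_on S f \<longleftrightarrow> smooth_on S g"
  unfolding smooth_on_def using C_k_on_cong by metis

lemma smooth_on_subset: "smooth_on S f \<Longrightarrow> T \<subseteq> S \<Longrightarrow> smooth_on T f"
  unfolding smooth_on_def using C_k_on_subset by blast

lemma smooth_on_differentiable: "smooth_on S f \<Longrightarrow> x \<in> S \<Longrightarrow> f differentiable (at x)"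
  unfolding smooth_on_def using C_k_on.simps(2) by blast

lemma smooth_on_continuous_on: "smooth_on S f \<Longrightarrow> continuous_on S f"
  unfolding smooth_on_def using C_k_on_imp_continuous_on by blast

lemma smooth_on_fd: "smooth_on S f \<Longrightarrow> smooth_on S (\<lambda>x. fd f x v)"
  unfolding smooth_on_def using C_k_on.simps(2) by blast

lemma smooth_on_const: "smooth_on S (\<lambda>x. c)"
  unfolding smooth_on_def by (simp add: C_k_on_const)

lemma smooth_on_bounded_linear: "open S \<Longrightarrow> bounded_linear l \<Longrightarrow> smooth_on S l"
  unfolding smooth_on_def by (simp add: C_k_on_bounded_linear)

lemma smooth_on_bounded_linear_comp:
  "open S \<Longrightarrow> bounded_linear l \<Longrightarrow> smooth_on S f \<Longrightarrow> smooth_on S (\<lambda>x. l (f x))"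
  unfolding smooth_on_def by (simp add: C_k_on_bounded_linear_comp)

lemma smooth_on_add: "open S \<Longrightarrow> smooth_on S f \<Longrightarrow> smooth_on S g \<Longrightarrow> smooth_on S (\<lambda>x. f x + g x)"
  unfolding smooth_on_def by (simp add: C_k_on_add)

lemma smooth_on_diff: "open S \<Longrightarrow> smooth_on S f \<Longrightarrow> smooth_on S g \<Longrightarrow> smooth_on S (\<lambda>x. f x - g x)"
  using smooth_on_add[of S f "\<lambda>x. - g x"]
    smooth_on_bounded_linear_comp[OF _ bounded_linear_minus[OF bounded_linear_ident], of S g] by simp

lemma smooth_on_bilinear:
  "bounded_bilinear p \<Longrightarrow> open S \<Longrightarrow> smooth_on S f \<Longrightarrow> smooth_on S g \<Longrightarrow> smooth_on S (\<lambda>x. p (f x) (g x))"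
  unfolding smooth_on_def by (simp add: C_k_on_bilinear)

lemmas smooth_on_scaleR = smooth_on_bilinear[OF bounded_bilinear_scaleR]
lemmas smooth_on_inner = smooth_on_bilinear[OF bounded_bilinear_inner]

lemma smooth_on_sum:
  "open S \<Longrightarrow> (\<And>i. i \<in> I \<Longrightarrow> smooth_on S (f i)) \<Longrightarrow> smooth_on S (\<lambda>x. \<Sum>i\<in>I. f i x)"
  unfolding smooth_on_def by (simp add: C_k_on_sum)

lemma smooth_on_compose:
  fixes f :: "'w::euclidean_space \<Rightarrow> 'u::real_normed_vector" and g :: "'v::euclidean_space \<Rightarrow> 'w"
  shows "open S \<Longrightarrow> open T \<Longrightarrow> g ` S \<subseteq> T \<Longrightarrow> smooth_on S g \<Longrightarrow> smooth_on T f \<Longrightarrow> smooth_on S (\<lambda>x. f (g x))"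
  unfolding smooth_on_def using C_k_on_compose by blast

lemma smooth_on_Pair:
  assumes "open S" "smooth_on S f" "smooth_on S g"
  shows "smooth_on S (\<lambda>x. (f x, g x))"
proof -
  have "bounded_linear (\<lambda>x::'b. (x, 0::'c))" "bounded_linear (\<lambda>x::'c. (0::'b, x))"
    by (simp_all add: bounded_linear_Pair bounded_linear_ident bounded_linear_zero)
  from smooth_on_add[OF assms(1) smooth_on_bounded_linear_comp[OF assms(1) this(1) assms(2)]
      smooth_on_bounded_linear_comp[OF assms(1) this(2) assms(3)]]
  show ?thesis by simp
qed

section \<open>Families of linear maps depending on a point\<close>

text \<open>In a basis \<open>a y (X y)\<close> is a finite sum of products, to which the ordinary
  product rule applies. The expansion holds only on \<open>S\<close>, where \<open>a y\<close> is
  linear, hence the congruences on an open set.\<close>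

lemma has_derivative_linear_field:
  fixes a :: "'v::real_normed_vector \<Rightarrow> 'w::euclidean_space \<Rightarrow> 'u::real_normed_vector"
  assumes "open S" "x \<in> S" "\<And>y. y \<in> S \<Longrightarrow> linear (a y)"
    and "\<And>w. (\<lambda>y. a y w) differentiable (at x)" and "(X has_derivative X') (at x)"
  shows "((\<lambda>y. a y (X y)) has_derivative (\<lambda>h. fd (\<lambda>y. a y (X x)) x h + a x (X' h))) (at x)"
proof -
  have "((\<lambda>y. \<Sum>b\<in>Basis. (X y \<bullet> b) *\<^sub>R a y b) has_derivative
      (\<lambda>h. \<Sum>b\<in>Basis. ((X x \<bullet> b) *\<^sub>R fd (\<lambda>y. a y b) x h + (X' h \<bullet> b) *\<^sub>R a x b))) (at x)"
    using assms(4,5) by (auto intro!: derivative_eq_intros fd_works)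
  moreover have "((\<lambda>y. \<Sum>b\<in>Basis. (X x \<bullet> b) *\<^sub>R a y b) has_derivative
      (\<lambda>h. \<Sum>b\<in>Basis. (X x \<bullet> b) *\<^sub>R fd (\<lambda>y. a y b) x h)) (at x)"
    using assms(4) by (auto intro!: derivative_eq_intros fd_works)
  then have "((\<lambda>y. a y (X x)) has_derivative
      (\<lambda>h. \<Sum>b\<in>Basis. (X x \<bullet> b) *\<^sub>R fd (\<lambda>y. a y b) x h)) (at x)"
    by (subst has_derivative_cong_open[OF assms(1,2)]) (rule linear_basis_expand[OF assms(3)])
  then have "fd (\<lambda>y. a y (X x)) x = (\<lambda>h. \<Sum>b\<in>Basis. (X x \<bullet> b) *\<^sub>R fd (\<lambda>y. a y b) x h)"
    by (rule fd_eqI)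
  moreover have "(\<Sum>b\<in>Basis. (w \<bullet> b) *\<^sub>R a x b) = a x w" for w
    by (rule linear_basis_expand[OF assms(3)[OF assms(2)], symmetric])
  ultimately have "((\<lambda>y. \<Sum>b\<in>Basis. (X y \<bullet> b) *\<^sub>R a y b) has_derivative
      (\<lambda>h. fd (\<lambda>y. a y (X x)) x h + a x (X' h))) (at x)"
    by (simp add: sum.distrib)
  then show ?thesis
    by (subst has_derivative_cong_open[OF assms(1,2)]) (rule linear_basis_expand[OF assms(3)])
qed

text \<open>Linearity holds throughout a neighbourhood of the point, and differentiation preserves
  such an identity. This makes \<open>ed\<close> bilinear.\<close>

lemma fd_linear_field_const_linear:
  fixes a :: "'v::real_normed_vector \<Rightarrow> 'w::euclidean_space \<Rightarrow> 'u::real_normed_vector"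
  assumes "open S" "x \<in> S" "\<And>y. y \<in> S \<Longrightarrow> linear (a y)"
    and "\<And>w. (\<lambda>y. a y w) differentiable (at x)"
  shows "linear (\<lambda>w. fd (\<lambda>y. a y w) x h)"
proof (rule linearI)
  fix v w
  have "((\<lambda>y. a y v + a y w) has_derivative (\<lambda>h. fd (\<lambda>y. a y v) x h + fd (\<lambda>y. a y w) x h)) (at x)"
    using assms(4) by (auto intro!: has_derivative_add fd_works)
  then have "((\<lambda>y. a y (v + w)) has_derivative (\<lambda>h. fd (\<lambda>y. a y v) x h + fd (\<lambda>y. a y w) x h)) (at x)"
    by (subst has_derivative_cong_open[OF assms(1,2)]) (auto simp: linear_add[OF assms(3)])
  then show "fd (\<lambda>y. a y (v + w)) x h = fd (\<lambda>y. a y v) x h + fd (\<lambda>y. a y w) x h" by (simp add: fd_eqI)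
next
  fix c w
  have "((\<lambda>y. c *\<^sub>R a y w) has_derivative (\<lambda>h. c *\<^sub>R fd (\<lambda>y. a y w) x h)) (at x)"
    using assms(4) by (auto intro!: has_derivative_scaleR_right fd_works)
  then have "((\<lambda>y. a y (c *\<^sub>R w)) has_derivative (\<lambda>h. c *\<^sub>R fd (\<lambda>y. a y w) x h)) (at x)"
    by (subst has_derivative_cong_open[OF assms(1,2)]) (auto simp: linear_scale[OF assms(3)])
  then show "fd (\<lambda>y. a y (c *\<^sub>R w)) x h = c *\<^sub>R fd (\<lambda>y. a y w) x h" by (simp add: fd_eqI)
qed

lemma smooth_on_linear_field:
  fixes a :: "'v::euclidean_space \<Rightarrow> 'w::euclidean_space \<Rightarrow> 'u::real_normed_vector"
  assumes "open S" "\<And>y. y \<in> S \<Longrightarrow> linear (a y)" "\<And>w. smooth_on S (\<lambda>y. a y w)" "smooth_on S X"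
  shows "smooth_on S (\<lambda>y. a y (X y))"
proof -
  have "smooth_on S (\<lambda>y. \<Sum>b\<in>Basis. (X y \<bullet> b) *\<^sub>R a y b)"
    using assms by (intro smooth_on_sum smooth_on_scaleR smooth_on_inner smooth_on_const) auto
  then show ?thesis
    by (subst smooth_on_cong[OF assms(1)]) (rule linear_basis_expand[OF assms(2)])
qed

section \<open>Symmetry of second derivatives\<close>

text \<open>The mean value theorem in direction \<open>u\<close> turns the second difference into
  \<open>t\<close> times an increment of the derivative in direction \<open>u\<close>.
  Differentiability of the latter at \<open>x\<close> alone gives the limit, without continuity of
  second derivatives.\<close>

lemma second_difference_limit:
  fixes f :: "'v::real_normed_vector \<Rightarrow> real"
  assumes "open S" "x \<in> S" "\<And>y. y \<in> S \<Longrightarrow> f differentiable (at y)"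
    and "(\<lambda>y. fd f y u) differentiable (at x)"
  shows "((\<lambda>t. (f (x + t *\<^sub>R u + t *\<^sub>R v) - f (x + t *\<^sub>R u) - f (x + t *\<^sub>R v) + f x) / t\<^sup>2)
           \<longlongrightarrow> fd (\<lambda>y. fd f y u) x v) (at_right 0)"
proof (rule tendstoI)
  fix e :: real assume e: "e > 0"
  define G where "G = (\<lambda>y. fd f y u)"
  \<comment> \<open>The two displacements compared below have norms at most
    \<open>t * (norm u + norm v)\<close> and \<open>t * norm u\<close>; \<open>K\<close> bounds the
    sum of these factors, and the 1 keeps it positive.\<close>
  define K where "K = 2 * norm u + norm v + 1"
  have K: "K > 0" unfolding K_def by (auto intro: add_nonneg_pos)
  have G: "(G has_derivative fd G x) (at x)" using assms(4) fd_works unfolding G_def by blast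
  then have linG: "linear (fd G x)" using has_derivative_linear by blast
  obtain d where d: "d > 0" "\<And>y. norm (y - x) < d \<Longrightarrow> norm (G y - G x - fd G x (y - x)) \<le> e / (2 * K) * norm (y - x)"
    using G e K unfolding has_derivative_at_alt by (metis divide_pos_pos mult_pos_pos zero_less_numeral)
  obtain r where r: "r > 0" "ball x r \<subseteq> S" using assms(1,2) open_contains_ball by blast
  \<comment> \<open>For \<open>t < m\<close> the parallelogram spanned by
    \<open>t *\<^sub>R u\<close> and \<open>t *\<^sub>R v\<close> stays in \<open>ball x r\<close>
    and within the range \<open>d\<close> of the linear approximation.\<close>
  define m where "m = min d r / K"
  have m: "m > 0" unfolding m_def using d r K by simp
  have "\<bar>(f (x + t *\<^sub>R u + t *\<^sub>R v) - f (x + t *\<^sub>R u) - f (x + t *\<^sub>R v) + f x) / t\<^sup>2 - fd G x v\<bar> < e"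
    if t: "0 < t" "t < m" for t
  proof -
    have near: "norm (s *\<^sub>R u + c *\<^sub>R v) < min d r" "norm (s *\<^sub>R u + c *\<^sub>R v) \<le> t * (norm u + norm v)"
      if "0 \<le> s" "s \<le> t" "0 \<le> c" "c \<le> t" for s c
    proof -
      have "norm (s *\<^sub>R u + c *\<^sub>R v) \<le> s * norm u + c * norm v"
        using norm_triangle_ineq[of "s *\<^sub>R u" "c *\<^sub>R v"] that by simp
      also have "\<dots> \<le> t * norm u + t * norm v" using that by (intro add_mono mult_right_mono) auto
      finally show "norm (s *\<^sub>R u + c *\<^sub>R v) \<le> t * (norm u + norm v)" by (simp add: distrib_left)
      also have "\<dots> \<le> t * K" unfolding K_def using t by (intro mult_left_mono) auto
      also have "\<dots> < m * K" using t K by simp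
      also have "m * K = min d r" unfolding m_def using K by simp
      finally show "norm (s *\<^sub>R u + c *\<^sub>R v) < min d r" .
    qed
    have inS: "x + s *\<^sub>R u + c *\<^sub>R v \<in> S" if "0 \<le> s" "s \<le> t" "0 \<le> c" "c \<le> t" for s c
    proof -
      have "dist (x + (s *\<^sub>R u + c *\<^sub>R v)) x < r"
        using near(1)[OF that] unfolding dist_norm by (simp only: add_diff_cancel_left' min_less_iff_conj)
      then have "x + (s *\<^sub>R u + c *\<^sub>R v) \<in> ball x r" by (simp only: mem_ball dist_commute)
      then show ?thesis using r(2) by (simp only: add.assoc subset_iff)
    qed
    define g where "g = (\<lambda>s. f (x + s *\<^sub>R u + t *\<^sub>R v) - f (x + s *\<^sub>R u))"
    have f_der: "((\<lambda>s. f (x + s *\<^sub>R u + c *\<^sub>R v)) has_real_derivative G (x + s *\<^sub>R u + c *\<^sub>R v)) (at s)"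
      if "0 \<le> s" "s \<le> t" "0 \<le> c" "c \<le> t" for s c
    proof -
      have "(f has_derivative fd f (x + s *\<^sub>R u + c *\<^sub>R v)) (at (x + s *\<^sub>R u + c *\<^sub>R v))"
        using assms(3)[OF inS[OF that]] fd_works by blast
      moreover have "((\<lambda>s. x + s *\<^sub>R u + c *\<^sub>R v) has_derivative (\<lambda>h. h *\<^sub>R u)) (at s)"
        by (auto intro!: derivative_eq_intros)
      ultimately have "((\<lambda>s. f (x + s *\<^sub>R u + c *\<^sub>R v)) has_derivative (\<lambda>h. fd f (x + s *\<^sub>R u + c *\<^sub>R v) (h *\<^sub>R u))) (at s)"
        by (rule has_derivative_compose[rotated])
      moreover have "linear (fd f (x + s *\<^sub>R u + c *\<^sub>R v))" using assms(3)[OF inS[OF that]] fd_linear by blast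
      ultimately show ?thesis unfolding has_field_derivative_def G_def by (simp add: linear_scale mult_commute_abs)
    qed
    have "\<exists>z. 0 < z \<and> z < t \<and> g t - g 0 = (t - 0) * (G (x + z *\<^sub>R u + t *\<^sub>R v) - G (x + z *\<^sub>R u))"
    proof (rule MVT2)
      fix s assume "0 \<le> s" "s \<le> t"
      then show "(g has_real_derivative (G (x + s *\<^sub>R u + t *\<^sub>R v) - G (x + s *\<^sub>R u))) (at s)"
        unfolding g_def using f_der[of s t] f_der[of s 0] t by (auto intro!: DERIV_diff)
    qed (use t in simp)
    then obtain z where z: "0 < z" "z < t" "g t - g 0 = t * (G (x + z *\<^sub>R u + t *\<^sub>R v) - G (x + z *\<^sub>R u))"
      by auto
    let ?y1 = "x + z *\<^sub>R u + t *\<^sub>R v" and ?y2 = "x + z *\<^sub>R u"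
    have n1: "norm (?y1 - x) < d" "norm (?y1 - x) \<le> t * (norm u + norm v)"
      using near[of z t] z t by (auto simp: algebra_simps)
    have n2: "norm (?y2 - x) < d" "norm (?y2 - x) \<le> t * norm u"
      using near(1)[of z 0] z t by (auto intro: mult_right_mono)
    \<comment> \<open>Both points contain the same multiple of \<open>u\<close>, which drops
      out.\<close>
    have "fd G x (?y1 - x) - fd G x (?y2 - x) = t * fd G x v"
      by (simp add: linear_add[OF linG] linear_scale[OF linG] add.assoc)
    then have "\<bar>G ?y1 - G ?y2 - t * fd G x v\<bar> \<le> \<bar>G ?y1 - G x - fd G x (?y1 - x)\<bar> + \<bar>G ?y2 - G x - fd G x (?y2 - x)\<bar>"
      by linarith
    also have "\<dots> \<le> e / (2 * K) * norm (?y1 - x) + e / (2 * K) * norm (?y2 - x)"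
      using d(2)[OF n1(1)] d(2)[OF n2(1)] by (intro add_mono) auto
    also have "\<dots> \<le> e / (2 * K) * (t * (norm u + norm v)) + e / (2 * K) * (t * norm u)"
      using n1(2) n2(2) e K by (intro add_mono mult_left_mono) auto
    also have "\<dots> \<le> e / (2 * K) * (t * K)"
      unfolding distrib_left[symmetric] using e K t by (intro mult_left_mono) (auto simp: K_def)
    also have "\<dots> = t * (e / 2)" using K by simp
    finally have bnd: "\<bar>G ?y1 - G ?y2 - t * fd G x v\<bar> \<le> t * (e / 2)" .
    have "f (x + t *\<^sub>R u + t *\<^sub>R v) - f (x + t *\<^sub>R u) - f (x + t *\<^sub>R v) + f x = t * (G ?y1 - G ?y2)"
      using z(3) unfolding g_def by simp
    moreover have "t * a / t\<^sup>2 - b = (a - t * b) / t" for a b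
      using t by (simp add: field_simps power2_eq_square)
    ultimately have "(f (x + t *\<^sub>R u + t *\<^sub>R v) - f (x + t *\<^sub>R u) - f (x + t *\<^sub>R v) + f x) / t\<^sup>2 - fd G x v
        = (G ?y1 - G ?y2 - t * fd G x v) / t" by simp
    then have "\<bar>(f (x + t *\<^sub>R u + t *\<^sub>R v) - f (x + t *\<^sub>R u) - f (x + t *\<^sub>R v) + f x) / t\<^sup>2 - fd G x v\<bar> \<le> e / 2"
      using bnd t by (simp only: abs_divide abs_of_pos pos_divide_le_eq mult.commute)
    then show ?thesis using e by linarith
  qed
  then show "\<forall>\<^sub>F t in at_right 0. dist ((f (x + t *\<^sub>R u + t *\<^sub>R v) - f (x + t *\<^sub>R u) - f (x + t *\<^sub>R v) + f x) / t\<^sup>2) (fd (\<lambda>y. fd f y u) x v) < e"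
    unfolding eventually_at_right_field dist_real_def G_def using m by auto
qed

text \<open>The second difference quotient is symmetric in \<open>u\<close> and \<open>v\<close>, so
  both mixed derivatives are its limit.\<close>

lemma second_derivative_symmetric_real:
  fixes f :: "'v::real_normed_vector \<Rightarrow> real"
  assumes "open S" "x \<in> S" "\<And>y. y \<in> S \<Longrightarrow> f differentiable (at y)"
    and "(\<lambda>y. fd f y u) differentiable (at x)" "(\<lambda>y. fd f y v) differentiable (at x)"
  shows "fd (\<lambda>y. fd f y u) x v = fd (\<lambda>y. fd f y v) x u"
proof -
  have "((\<lambda>t. (f (x + t *\<^sub>R u + t *\<^sub>R v) - f (x + t *\<^sub>R u) - f (x + t *\<^sub>R v) + f x) / t\<^sup>2)
           \<longlongrightarrow> fd (\<lambda>y. fd f y v) x u) (at_right 0)"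
    using second_difference_limit[OF assms(1-3,5), of u] by (simp add: algebra_simps)
  then show ?thesis
    using tendsto_unique[OF _ second_difference_limit[OF assms(1-3,4), of v]] by simp
qed

text \<open>Taken componentwise, since the real case rests on the mean value theorem.\<close>

lemma second_derivative_symmetric:
  fixes f :: "'v::euclidean_space \<Rightarrow> 'u::euclidean_space"
  assumes "open S" "x \<in> S" "smooth_on S f"
  shows "fd (\<lambda>y. fd f y u) x v = fd (\<lambda>y. fd f y v) x u"
proof (rule euclidean_eqI)
  fix b :: 'u assume "b \<in> Basis"
  define g where "g = (\<lambda>y. f y \<bullet> b)"
  have sg: "smooth_on S g"
    unfolding g_def by (rule smooth_on_bounded_linear_comp[OF assms(1) bounded_linear_inner_left assms(3)])
  have g1: "fd g y w = fd f y w \<bullet> b" if "y \<in> S" for y w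
    using has_derivative_inner_left[OF fd_works[OF smooth_on_differentiable[OF assms(3) that]], of b]
    unfolding g_def by (simp add: fd_eqI)
  have g2: "fd (\<lambda>y. fd g y w) x w' = fd (\<lambda>y. fd f y w) x w' \<bullet> b" for w w'
  proof -
    have "fd (\<lambda>y. fd g y w) x = fd (\<lambda>y. fd f y w \<bullet> b) x"
      by (rule fd_cong_open[OF assms(1,2)]) (simp add: g1)
    also have "\<dots> = (\<lambda>w'. fd (\<lambda>y. fd f y w) x w' \<bullet> b)"
      by (intro fd_eqI has_derivative_inner_left fd_works smooth_on_differentiable[OF smooth_on_fd[OF assms(3)] assms(2)])
    finally show ?thesis by simp
  qed
  show "fd (\<lambda>y. fd f y u) x v \<bullet> b = fd (\<lambda>y. fd f y v) x u \<bullet> b"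
    unfolding g2[symmetric]
    by (rule second_derivative_symmetric_real[OF assms(1,2)])
      (use sg assms(2) smooth_on_fd smooth_on_differentiable in blast)+
qed

section \<open>Total differential equations\<close>

text \<open>The integral is what Du = A(x,u) with u 0 = 0 becomes along the ray through
  \<open>x\<close>. The solution is the fixed point of a contraction with factor
  \<open>C * r\<close> on the complete space of bounded continuous functions.\<close>

lemma picard_integral_equation:
  fixes A :: "'x::euclidean_space \<times> 'y::euclidean_space \<Rightarrow> 'x \<Rightarrow>\<^sub>L 'y"
  assumes A: "continuous_on UNIV A" and M: "\<And>z. norm (A z) \<le> M"
    and C: "\<And>x y y'. norm (A (x, y) - A (x, y')) \<le> C * norm (y - y')"
    and "0 \<le> C" "0 < r" "C * r < 1"
  obtains u :: "'x \<Rightarrow> 'y" where "continuous_on UNIV u"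
    "\<And>x. x \<in> cball 0 r \<Longrightarrow> u x = integral {0..1} (\<lambda>t. A (t *\<^sub>R x, u (t *\<^sub>R x)) x)"
proof -
  define P where "P = closest_point (cball (0::'x) r)"
  have P: "continuous_on UNIV P" "norm (P x) \<le> r" for x
    using assms(5) closest_point_in_set[of "cball (0::'x) r" x]
    by (auto simp: P_def intro!: continuous_on_closest_point)
  have P_id: "P x = x" if "x \<in> cball 0 r" for x using that by (simp add: P_def closest_point_self)
  define f where "f = (\<lambda>(u :: 'x \<Rightarrow>\<^sub>C 'y) x t. A (t *\<^sub>R x, apply_bcontfun u (t *\<^sub>R x)) (P x))"
  define g where "g = (\<lambda>u x. integral {0..1::real} (f u x))"
  have u_cont: "continuous_on S (\<lambda>z. apply_bcontfun u (h z))" if "continuous_on S h"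
    for u :: "'x \<Rightarrow>\<^sub>C 'y" and h and S :: "'c::topological_space set"
    using continuous_on_compose2[OF continuous_on_apply_bcontfun[of UNIV u] that] by simp
  have A_cont: "continuous_on S (\<lambda>z. A (h z))" if "continuous_on S h" for h and S :: "'c::topological_space set"
    using continuous_on_compose2[OF A that] by simp
  have P_cont: "continuous_on S (\<lambda>z. P (h z))" if "continuous_on S h" for h and S :: "'c::topological_space set"
    using continuous_on_compose2[OF P(1) that] by simp
  have f_cont: "continuous_on {0..1} (f u x)" for u x
    unfolding f_def by (intro continuous_intros A_cont u_cont)
  have "continuous_on (UNIV \<times> cbox 0 1) (\<lambda>(x, t). f u x t)" for u
    unfolding f_def case_prod_beta by (intro continuous_intros A_cont u_cont P_cont)
  then have g_cont: "continuous_on UNIV (g u)" for u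
    unfolding g_def using integral_continuous_on_param[of UNIV 0 1 "f u"] by simp
  have "norm (f u x t) \<le> M * r" for u x t
  proof -
    have "norm (f u x t) \<le> norm (A (t *\<^sub>R x, apply_bcontfun u (t *\<^sub>R x))) * norm (P x)"
      unfolding f_def by (rule norm_blinfun)
    also have "\<dots> \<le> M * r" using M P(2) order_trans[OF norm_ge_zero M] by (intro mult_mono) auto
    finally show ?thesis .
  qed
  then have "norm (g u x) \<le> M * r" for u x
    unfolding g_def using integral_bound[OF _ f_cont, where B = "M * r"] by simp
  then have g_bc: "g u \<in> bcontfun" for u by (rule bcontfun_normI[OF g_cont])
  define T where "T = (\<lambda>u. Bcontfun (g u))"
  have T: "apply_bcontfun (T u) = g u" for u unfolding T_def by (rule Bcontfun_inverse[OF g_bc])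
  have "dist (T u) (T v) \<le> (C * r) * dist u v" for u v
  proof (rule dist_bound)
    fix x
    have "g u x - g v x = integral {0..1} (\<lambda>t. f u x t - f v x t)"
      unfolding g_def by (intro Henstock_Kurzweil_Integration.integral_diff[symmetric] integrable_continuous_real f_cont)
    also have "norm \<dots> \<le> (C * r * dist u v) * (1 - 0)"
    proof (intro integral_bound continuous_on_diff f_cont)
      fix t
      let ?u = "apply_bcontfun u (t *\<^sub>R x)" and ?v = "apply_bcontfun v (t *\<^sub>R x)"
      have "f u x t - f v x t = (A (t *\<^sub>R x, ?u) - A (t *\<^sub>R x, ?v)) (P x)"
        unfolding f_def by (simp add: blinfun.diff_left)
      also have "norm \<dots> \<le> norm (A (t *\<^sub>R x, ?u) - A (t *\<^sub>R x, ?v)) * norm (P x)" by (rule norm_blinfun)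
      also have "\<dots> \<le> (C * norm (?u - ?v)) * r" using C P(2) \<open>0 \<le> C\<close> by (intro mult_mono) auto
      also have "\<dots> \<le> (C * dist u v) * r"
        using dist_bounded[of u "t *\<^sub>R x" v] \<open>0 \<le> C\<close> \<open>0 < r\<close>
        by (intro mult_mono mult_left_mono) (auto simp: dist_norm)
      finally show "norm (f u x t - f v x t) \<le> C * r * dist u v" by (simp add: mult.commute mult.left_commute)
    qed simp
    finally show "dist (T u x) (T v x) \<le> C * r * dist u v" unfolding T dist_norm by simp
  qed
  then obtain u where u: "T u = u"
    using banach_fix_type[of "C * r" T] \<open>0 \<le> C\<close> \<open>0 < r\<close> \<open>C * r < 1\<close> by auto
  show ?thesis
  proof (rule that)
    show "continuous_on UNIV (apply_bcontfun u)" by simp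
    fix x :: 'x assume "x \<in> cball 0 r"
    then show "u x = integral {0..1} (\<lambda>t. A (t *\<^sub>R x, u (t *\<^sub>R x)) x)"
      using T[of u] P_id unfolding u g_def f_def by (auto dest!: fun_cong[of _ _ x])
  qed
qed

text \<open>Rescaling the integration variable shows that \<open>u (s *\<^sub>R x)\<close> is the
  integral from 0 to \<open>s\<close> along the same ray; the fundamental theorem of calculus then
  applies.\<close>

lemma integral_equation_radial_derivative:
  fixes A :: "'x::euclidean_space \<times> 'y::euclidean_space \<Rightarrow> 'x \<Rightarrow>\<^sub>L 'y"
  assumes A: "continuous_on UNIV A" and u: "continuous_on UNIV u"
    and eq: "\<And>x. x \<in> cball 0 r \<Longrightarrow> u x = integral {0..1} (\<lambda>t. A (t *\<^sub>R x, u (t *\<^sub>R x)) x)"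
    and x: "x \<in> cball 0 r" and s: "s \<in> {0..1}"
  shows "((\<lambda>s. u (s *\<^sub>R x)) has_vector_derivative A (s *\<^sub>R x, u (s *\<^sub>R x)) x) (at s within {0..1})"
proof -
  define f where "f = (\<lambda>t. A (t *\<^sub>R x, u (t *\<^sub>R x)) x)"
  have f: "continuous_on S f" for S
    unfolding f_def
    by (intro continuous_intros continuous_on_compose2[OF A] continuous_on_compose2[OF u]) auto
  have "u (s *\<^sub>R x) = integral {0..s} f" if "s \<in> {0..1}" for s
  proof -
    have "norm (s *\<^sub>R x) \<le> 1 * r" unfolding norm_scaleR using that x by (intro mult_mono) auto
    then have "u (s *\<^sub>R x) = integral {0..1} (\<lambda>t. A (t *\<^sub>R s *\<^sub>R x, u (t *\<^sub>R s *\<^sub>R x)) (s *\<^sub>R x))"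
      by (intro eq) simp
    also have "\<dots> = integral {0..1} (\<lambda>t. s *\<^sub>R f (s * t))"
      unfolding f_def by (simp add: blinfun.scaleR_right mult.commute)
    also have "\<dots> = integral {0..s} f"
    \<comment> \<open>Rescaling divides by \<open>s\<close>; at \<open>s = 0\<close> both integrals
      are zero.\<close>
    proof (cases "s = 0")
      case False
      have "((\<lambda>t. f (s * t)) has_integral (1 / \<bar>s\<bar>) *\<^sub>R integral {0..s} f) ((\<lambda>t. t / s) ` {0..s})"
        by (intro has_integral_stretch_real integrable_integral integrable_continuous_real f False)
      moreover have "(\<lambda>t. t / s) ` {0..s} = {0..1}"
        using False that by (auto simp: field_simps image_iff intro!: bexI[of _ "s * _"])
      ultimately have "((\<lambda>t. s *\<^sub>R f (s * t)) has_integral s *\<^sub>R (1 / \<bar>s\<bar>) *\<^sub>R integral {0..s} f) {0..1}"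
        using has_integral_cmul by metis
      moreover have "s *\<^sub>R (1 / \<bar>s\<bar>) *\<^sub>R integral {0..s} f = integral {0..s} f"
        using False that by simp
      ultimately show ?thesis using integral_unique by metis
    qed simp
    finally show ?thesis .
  qed
  then show ?thesis
    using integral_has_vector_derivative[OF f s] s
    by (subst has_vector_derivative_cong_ev[where g = "\<lambda>s. integral {0..s} f"]) (auto simp: f_def)
qed

text \<open>Gronwall's inequality with a coefficient so small that \<open>sup |f| \<le> sup |f| / 2 + c\<close> suffices and no
  exponential is needed.\<close>

lemma small_gronwall:
  fixes f :: "real \<Rightarrow> 'y::real_normed_vector"
  assumes "\<And>t. t \<in> {0..1} \<Longrightarrow> (f has_vector_derivative f' t) (at t within {0..1})"
    and "\<And>t. t \<in> {0..1} \<Longrightarrow> norm (f' t) \<le> norm (f t) / 2 + c" and "f 0 = 0" and "t \<in> {0..1}"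
  shows "norm (f t) \<le> 2 * c"
proof -
  have "continuous_on {0..1} (\<lambda>t. norm (f t))"
    unfolding continuous_on_eq_continuous_within
    by (intro ballI continuous_norm has_vector_derivative_continuous[OF assms(1)])
  then obtain s where s: "s \<in> {0..1}" "\<And>t. t \<in> {0..1} \<Longrightarrow> norm (f t) \<le> norm (f s)"
    using continuous_attains_sup[of "{0..1::real}" "\<lambda>t. norm (f t)"] by auto
  have "norm (f s - f 0) \<le> (norm (f s) / 2 + c) * norm (s - 0)"
  proof (rule differentiable_bound[of "{0..1}" f "\<lambda>t h. h *\<^sub>R f' t"])
    fix t :: real assume t: "t \<in> {0..1}"
    show "(f has_derivative (\<lambda>h. h *\<^sub>R f' t)) (at t within {0..1})"
      using assms(1)[OF t] by (simp add: has_vector_derivative_def)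
    have "onorm (\<lambda>h. h *\<^sub>R f' t) \<le> norm (f' t)" by (intro onorm_le) (simp add: mult.commute)
    also have "\<dots> \<le> norm (f s) / 2 + c" using assms(2)[OF t] s(2)[OF t] by linarith
    finally show "onorm (\<lambda>h. h *\<^sub>R f' t) \<le> norm (f s) / 2 + c" .
  qed (use s in auto)
  also have "\<dots> \<le> (norm (f s) / 2 + c) * 1"
  proof (rule mult_left_mono)
    show "0 \<le> norm (f s) / 2 + c" using assms(2)[OF s(1)] norm_ge_zero[of "f' s"] by linarith
  qed (use s(1) in simp)
  finally show ?thesis using s(2)[OF assms(4)] assms(3) by simp
qed

text \<open>The derivative is uniformly continuous on the compact set, and the mean value inequality
  on segments, which lie in \<open>K\<close> by convexity, turns this into an error bound uniform in
  the base point. It is applied at all points of a curve at once.\<close>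

lemma uniform_linearization:
  fixes A :: "'z::euclidean_space \<Rightarrow> 'u::real_normed_vector"
  assumes "compact K" "convex K"
    and A': "\<And>z. z \<in> K \<Longrightarrow> (A has_derivative blinfun_apply (A' z)) (at z)"
    and cont: "continuous_on K A'" and "e > 0"
  obtains d where "d > 0" "\<And>z z'. z \<in> K \<Longrightarrow> z' \<in> K \<Longrightarrow> norm (z' - z) < d \<Longrightarrow>
    norm (A z' - A z - A' z (z' - z)) \<le> e * norm (z' - z)"
proof -
  obtain d where d: "d > 0" "\<And>z z'. z \<in> K \<Longrightarrow> z' \<in> K \<Longrightarrow> dist z' z < d \<Longrightarrow> dist (A' z') (A' z) < e"
    using compact_uniformly_continuous[OF cont assms(1)] \<open>e > 0\<close> unfolding uniformly_continuous_on_def by metis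
  show ?thesis
  proof (rule that[OF d(1)])
    fix z z' assume z: "z \<in> K" "z' \<in> K" "norm (z' - z) < d"
    have "norm (A z' - A z - A' z (z' - z)) \<le> norm (z' - z) * e"
    proof (rule differentiable_bound_linearization[where S = "closed_segment z z'" and f' = "\<lambda>y. blinfun_apply (A' y)"])
      fix y assume y: "y \<in> closed_segment z z'"
      then have yK: "y \<in> K" using z assms(2) closed_segment_subset by blast
      show "(A has_derivative blinfun_apply (A' y)) (at y within closed_segment z z')"
        using A'[OF yK] by (rule has_derivative_at_withinI)
      have "dist y z < d"
        using y z(3) dist_in_closed_segment[of y z z'] by (simp add: dist_norm norm_minus_commute)
      then have "norm (A' y - A' z) \<le> e" using d(2)[OF z(1) yK] by (simp add: dist_norm less_imp_le)
      then show "onorm (blinfun_apply (A' y) - blinfun_apply (A' z)) \<le> e"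
        by (simp add: norm_blinfun.rep_eq minus_blinfun.rep_eq fun_diff_def)
    next
      show "z + t *\<^sub>R (z' - z) \<in> closed_segment z z'" if "t \<in> {0..1}" for t
        using that by (auto simp: in_segment algebra_simps intro!: exI[of _ t])
    qed simp
    then show "norm (A z' - A z - A' z (z' - z)) \<le> e * norm (z' - z)" by (simp add: mult.commute)
  qed
qed

text \<open>The solution is obtained by integrating along rays.  For its differentiability, the error
  \<open>w t = u (t (x + h)) - u (t x) - t A h\<close> satisfies \<open>|w'| \<le> |w| / 2 + o(|h|)\<close>: by the integrability condition
  the terms of first order in \<open>h\<close> cancel.\<close>

lemma total_differential_equation_solvable:
  fixes A :: "'x::euclidean_space \<times> 'y::euclidean_space \<Rightarrow> 'x \<Rightarrow>\<^sub>L 'y"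
  assumes "\<rho> > 0" and A': "\<And>z. z \<in> cball 0 \<rho> \<Longrightarrow> (A has_derivative blinfun_apply (A' z)) (at z)"
    and cont: "continuous_on (cball 0 \<rho>) A'"
    and integrable: "\<And>z v w. z \<in> cball 0 \<rho> \<Longrightarrow> A' z (v, A z v) w = A' z (w, A z w) v"
  obtains r u where "r > 0" "u 0 = 0"
    "\<And>x. x \<in> ball 0 r \<Longrightarrow> (x, u x) \<in> cball 0 \<rho> \<and> (u has_derivative blinfun_apply (A (x, u x))) (at x)"
proof -
  define K where "K = cball (0 :: 'x \<times> 'y) \<rho>"
  have K: "compact K" "convex K" "closed K" "K \<noteq> {}" "0 \<in> K" unfolding K_def using \<open>\<rho> > 0\<close> by auto
  note A' = A'[folded K_def] and cont = cont[folded K_def] and integrable = integrable[folded K_def]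
  have "continuous_on K A"
    using A' has_derivative_continuous by (blast intro: continuous_at_imp_continuous_on)
  obtain M where M: "M > 0" "\<And>z. z \<in> K \<Longrightarrow> norm (A z) \<le> M"
    using compact_imp_bounded[OF compact_continuous_image[OF \<open>continuous_on K A\<close> K(1)]]
    unfolding bounded_pos by auto
  obtain C where C: "C > 0" "\<And>z. z \<in> K \<Longrightarrow> norm (A' z) \<le> C"
    using compact_imp_bounded[OF compact_continuous_image[OF cont K(1)]] unfolding bounded_pos by auto
  have lip: "norm (A z - A z') \<le> C * norm (z - z')" if "z \<in> K" "z' \<in> K" for z z'
  proof (rule differentiable_bound[OF K(2) _ _ that])
    fix z assume "z \<in> K"
    then show "(A has_derivative blinfun_apply (A' z)) (at z within K)" "onorm (A' z) \<le> C"
      using has_derivative_at_withinI[OF A'] C(2) by (simp_all only: norm_blinfun.rep_eq)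
  qed
  \<comment> \<open>Composition with the projection onto the convex set \<open>K\<close> extends the
    bound and the Lipschitz constant of \<open>A\<close> to the whole space. The solution will stay
    in \<open>K\<close>, where \<open>P\<close> is the identity.\<close>
  define P where "P = closest_point K"
  have P: "P z \<in> K" "z \<in> K \<Longrightarrow> P z = z" "norm (P z - P z') \<le> norm (z - z')" for z z'
    unfolding P_def using K closest_point_in_set closest_point_self closest_point_lipschitz[of K z z']
    by (auto simp: dist_norm)
  have P_cont: "continuous_on UNIV P" unfolding P_def using K continuous_on_closest_point by blast
  \<comment> \<open>The first bound gives \<open>C * r \<le> 1 / 4\<close>, enough for the
    contraction and for the coefficient 1/2 in \<open>small_gronwall\<close>; the second keeps the
    graph over the ball of radius \<open>r\<close> inside \<open>K\<close>.\<close>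
  define r where "r = min (1 / (4 * C)) (\<rho> / (2 * (1 + M)))"
  have r: "r > 0" "C * r \<le> 1 / 4" "r + M * r \<le> \<rho>"
  proof -
    show "r > 0" unfolding r_def using C M \<open>\<rho> > 0\<close> by simp
    have "r \<le> 1 / (4 * C)" unfolding r_def by simp
    then show "C * r \<le> 1 / 4" using C(1) by (simp add: field_simps)
    have "r \<le> \<rho> / (2 * (1 + M))" unfolding r_def by simp
    then have "(1 + M) * r \<le> \<rho> / 2" using M(1) by (simp add: field_simps)
    then show "r + M * r \<le> \<rho>" using \<open>\<rho> > 0\<close> by (simp add: algebra_simps)
  qed
  have AP_cont: "continuous_on UNIV (\<lambda>z. A (P z))"
    by (rule continuous_on_compose2[OF \<open>continuous_on K A\<close> P_cont]) (use P in auto)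
  obtain u where u: "continuous_on UNIV u"
    "\<And>x. x \<in> cball 0 r \<Longrightarrow> u x = integral {0..1} (\<lambda>t. A (P (t *\<^sub>R x, u (t *\<^sub>R x))) x)"
  proof (rule picard_integral_equation[OF AP_cont])
    show "norm (A (P z)) \<le> M" for z using M P by blast
    show "norm (A (P (x, y)) - A (P (x, y'))) \<le> C * norm (y - y')" for x y y'
    proof -
      have "norm (A (P (x, y)) - A (P (x, y'))) \<le> C * norm (P (x, y) - P (x, y'))" using lip P by blast
      also have "\<dots> \<le> C * norm ((x, y) - (x, y'))" by (rule mult_left_mono[OF P(3)]) (use C in simp)
      finally show ?thesis by (simp add: norm_Pair)
    qed
    show "C * r < 1" using r by linarith
  qed (use C r in auto)
  have bound: "norm (u x) \<le> M * norm x" if "x \<in> cball 0 r" for x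
  proof -
    have "norm (u x) \<le> (M * norm x) * (1 - 0)"
      unfolding u(2)[OF that]
    proof (intro integral_bound)
      show "continuous_on {0..1} (\<lambda>t. A (P (t *\<^sub>R x, u (t *\<^sub>R x))) x)"
        by (intro continuous_intros continuous_on_compose2[OF AP_cont] continuous_on_compose2[OF u(1)]) auto
      show "norm (A (P z) x) \<le> M * norm x" for z
        using norm_blinfun[of "A (P z)" x] mult_right_mono[OF M(2)[OF P(1)[of z]] norm_ge_zero[of x]] by linarith
    qed simp
    then show ?thesis by simp
  qed
  have inK: "(x, u x) \<in> K" if "x \<in> cball 0 r" for x
  proof -
    have "norm (x, u x) \<le> norm x + norm (u x)"
      using norm_triangle_ineq[of "(x, 0)" "(0, u x)"] by (simp add: norm_Pair)
    also have "\<dots> \<le> r + M * r"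
      using that order_trans[OF bound[OF that] mult_left_mono[of "norm x" r M]] M(1) by (intro add_mono) simp_all
    finally show ?thesis unfolding K_def using r by simp
  qed
  have scaled: "t *\<^sub>R x \<in> cball 0 r" if "x \<in> cball 0 r" "t \<in> {0..1}" for x :: 'x and t
  proof -
    have "norm (t *\<^sub>R x) \<le> 1 * r" unfolding norm_scaleR using that by (intro mult_mono) auto
    then show ?thesis by simp
  qed
  have ode: "((\<lambda>t. u (t *\<^sub>R x)) has_vector_derivative A (t *\<^sub>R x, u (t *\<^sub>R x)) x) (at t within {0..1})"
    if "x \<in> cball 0 r" "t \<in> {0..1}" for x t
    using integral_equation_radial_derivative[OF AP_cont u that] inK[OF scaled[OF that]] P(2) by simp
  have u0: "u 0 = 0" using bound[of 0] r by simp
  \<comment> \<open>The factor 2 is that of \<open>small_gronwall\<close>; \<open>H\<close> becomes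
    a Lipschitz constant of \<open>u\<close>.\<close>
  define H where "H = 2 * (M + 1)"
  have incr: "norm (u (t *\<^sub>R (x + h)) - u (t *\<^sub>R x)) \<le> H * norm h"
    if x: "x \<in> cball 0 r" "x + h \<in> cball 0 r" and t: "t \<in> {0..1}" for x h t
  proof -
    let ?z = "\<lambda>t. (t *\<^sub>R x, u (t *\<^sub>R x))" and ?z' = "\<lambda>t. (t *\<^sub>R (x + h), u (t *\<^sub>R (x + h)))"
    have "norm (u (t *\<^sub>R (x + h)) - u (t *\<^sub>R x)) \<le> 2 * ((M + 1) * norm h)"
    proof (rule small_gronwall[where f = "\<lambda>t. u (t *\<^sub>R (x + h)) - u (t *\<^sub>R x)"
          and f' = "\<lambda>t. A (?z' t) (x + h) - A (?z t) x"])
      fix t :: real assume t: "t \<in> {0..1}"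
      show "((\<lambda>t. u (t *\<^sub>R (x + h)) - u (t *\<^sub>R x)) has_vector_derivative A (?z' t) (x + h) - A (?z t) x)
        (at t within {0..1})"
        by (intro has_vector_derivative_diff ode x t)
      let ?D = "u (t *\<^sub>R (x + h)) - u (t *\<^sub>R x)"
      have "norm (?z' t - ?z t) \<le> norm (t *\<^sub>R h) + norm ?D"
        using norm_triangle_ineq[of "(t *\<^sub>R h, 0)" "(0, ?D)"] by (simp add: norm_Pair scaleR_right_distrib)
      also have "\<dots> \<le> norm h + norm ?D" using t by (simp add: mult_left_le_one_le)
      finally have n: "norm (?z' t - ?z t) \<le> norm h + norm ?D" .
      have "A (?z' t) (x + h) - A (?z t) x = (A (?z' t) - A (?z t)) (x + h) + A (?z t) h"
        by (simp add: blinfun.diff_left blinfun.add_right)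
      also have "norm \<dots> \<le> norm (A (?z' t) - A (?z t)) * norm (x + h) + norm (A (?z t)) * norm h"
        using norm_triangle_ineq norm_blinfun by (meson add_mono order_trans)
      also have "\<dots> \<le> C * norm (?z' t - ?z t) * r + M * norm h"
        using lip[OF inK[OF scaled[OF x(2) t]] inK[OF scaled[OF x(1) t]]] M(2)[OF inK[OF scaled[OF x(1) t]]] x C(1) M(1)
        by (intro add_mono mult_mono) auto
      also have "\<dots> = (C * r) * norm (?z' t - ?z t) + M * norm h" by simp
      also have "\<dots> \<le> 1 / 4 * (norm h + norm ?D) + M * norm h"
        using r(2) n M(1) by (intro add_mono mult_mono) auto
      also have "\<dots> \<le> norm ?D / 2 + (M + 1) * norm h"
        using norm_ge_zero[of ?D] norm_ge_zero[of h] by (simp add: algebra_simps del: norm_ge_zero)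
      finally show "norm (A (?z' t) (x + h) - A (?z t) x) \<le> norm ?D / 2 + (M + 1) * norm h" .
    qed (use t in auto)
    then show ?thesis by (simp only: H_def mult.assoc)
  qed
  have deriv: "(u has_derivative blinfun_apply (A (x, u x))) (at x)" if "x \<in> ball 0 r" for x
    unfolding has_derivative_at_alt
  proof (intro conjI allI impI blinfun.bounded_linear_right)
    fix e :: real assume e: "e > 0"
    have H: "H > 0" unfolding H_def using M by simp
    have x: "x \<in> cball 0 r" using that by auto
    \<comment> \<open>The linearization error is at most
      \<open>\<epsilon> * ((1 + H) * norm h)\<close>; applied to a vector of norm at most
      \<open>r\<close> it contributes \<open>e / 4 * norm h\<close>.\<close>
    define \<epsilon> where "\<epsilon> = e / (4 * (1 + H) * r)"
    have \<epsilon>: "\<epsilon> > 0" unfolding \<epsilon>_def using e H r by simp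
    obtain d where d: "d > 0" "\<And>z z'. z \<in> K \<Longrightarrow> z' \<in> K \<Longrightarrow> norm (z' - z) < d \<Longrightarrow>
        norm (A z' - A z - A' z (z' - z)) \<le> \<epsilon> * norm (z' - z)"
      using uniform_linearization[OF K(1,2) A' cont \<epsilon>] by blast
    obtain b where b: "b > 0" "ball x b \<subseteq> cball 0 r"
      using \<open>x \<in> ball 0 r\<close> open_contains_ball[of "ball (0::'x) r"] by (metis ball_subset_cball open_ball order_trans)
    \<comment> \<open>In this order: \<open>x + h\<close> stays in the domain, the two points of the
      graph are within \<open>d\<close>, and the term quadratic in \<open>h\<close> is at most
      \<open>e / 4 * norm h\<close>.\<close>
    define m where "m = min b (min (d / (1 + H)) (e / (4 * (1 + H) * C)))"
    have m: "m > 0" unfolding m_def using b d e H C by simp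
    show "\<exists>d>0. \<forall>y. norm (y - x) < d \<longrightarrow> norm (u y - u x - A (x, u x) (y - x)) \<le> e * norm (y - x)"
    proof (intro exI[of _ m] conjI allI impI m)
      fix y assume y: "norm (y - x) < m"
      define h where "h = y - x"
      have h: "norm h < b" "(1 + H) * norm h < d" "(1 + H) * (C * norm h) \<le> e / 4"
      proof -
        show "norm h < b" using y unfolding h_def m_def by simp
        have "norm h < d / (1 + H)" using y unfolding h_def m_def by simp
        then show "(1 + H) * norm h < d" using H by (simp add: pos_less_divide_eq mult.commute)
        have "norm h \<le> e / (4 * (1 + H) * C)" using y unfolding h_def m_def by simp
        then have "norm h * (4 * (1 + H) * C) \<le> e" using H C(1) by (subst (asm) pos_le_divide_eq) simp_all
        then show "(1 + H) * (C * norm h) \<le> e / 4" by (simp add: algebra_simps)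
      qed
      have xh: "x + h \<in> cball 0 r" using b(2) h(1) by (auto simp: subset_iff dist_norm h_def norm_minus_commute)
      let ?z = "\<lambda>t. (t *\<^sub>R x, u (t *\<^sub>R x))" and ?z' = "\<lambda>t. (t *\<^sub>R (x + h), u (t *\<^sub>R (x + h)))"
      define w where "w = (\<lambda>t. u (t *\<^sub>R (x + h)) - u (t *\<^sub>R x) - t *\<^sub>R A (?z t) h)"
      define w' where "w' = (\<lambda>t. A (?z' t) (x + h) - A (?z t) x
          - (t *\<^sub>R A' (?z t) (x, A (?z t) x) h + A (?z t) h))"
      have "norm (w 1) \<le> 2 * (e / 2 * norm h)"
      proof (rule small_gronwall[where f = w and f' = w'])
        fix t :: real assume t: "t \<in> {0..1}"
        have zK: "?z t \<in> K" "?z' t \<in> K" using inK[OF scaled[OF _ t]] x xh by auto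
        have z_der: "(?z has_vector_derivative (x, A (?z t) x)) (at t within {0..1})"
          by (intro has_vector_derivative_Pair ode x t) (auto intro!: derivative_eq_intros)
        have "((\<lambda>t. A (?z t)) has_derivative (\<lambda>s. A' (?z t) (s *\<^sub>R (x, A (?z t) x)))) (at t within {0..1})"
          by (rule has_derivative_compose[OF z_der[unfolded has_vector_derivative_def] A'[OF zK(1)]])
        then have "((\<lambda>t. A (?z t) h) has_derivative (\<lambda>s. A' (?z t) (s *\<^sub>R (x, A (?z t) x)) h)) (at t within {0..1})"
          by (rule bounded_linear.has_derivative[OF blinfun.bounded_linear_left])
        then have "((\<lambda>t. A (?z t) h) has_vector_derivative A' (?z t) (x, A (?z t) x) h) (at t within {0..1})"
          unfolding has_vector_derivative_def by (simp only: blinfun.scaleR_right blinfun.scaleR_left)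
        then show "(w has_vector_derivative w' t) (at t within {0..1})"
          unfolding w_def w'_def
          by (intro has_vector_derivative_diff ode x xh t)
             (auto intro!: has_vector_derivative_scaleR[THEN has_vector_derivative_eq_rhs] derivative_eq_intros)
        let ?D = "u (t *\<^sub>R (x + h)) - u (t *\<^sub>R x)"
        define R where "R = A (?z' t) - A (?z t) - A' (?z t) (?z' t - ?z t)"
        have zz: "?z' t - ?z t = (t *\<^sub>R h, ?D)" by (simp add: scaleR_right_distrib)
        have nD: "norm ?D \<le> H * norm h" using incr[OF x xh t] .
        have nzz: "norm (?z' t - ?z t) \<le> (1 + H) * norm h"
        proof -
          have "norm (?z' t - ?z t) \<le> norm (t *\<^sub>R h) + norm ?D"
            unfolding zz using norm_triangle_ineq[of "(t *\<^sub>R h, 0)" "(0, ?D)"] by (simp add: norm_Pair)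
          also have "\<dots> \<le> norm h + H * norm h" using t nD by (intro add_mono) (simp_all add: mult_left_le_one_le)
          finally show ?thesis by (simp add: algebra_simps)
        qed
        then have "norm (?z' t - ?z t) < d" using h(2) by linarith
        then have "norm R \<le> \<epsilon> * norm (?z' t - ?z t)" unfolding R_def using d(2)[OF zK] by blast
        also have "\<dots> \<le> \<epsilon> * ((1 + H) * norm h)" using nzz \<epsilon> by (intro mult_left_mono) auto
        finally have nR: "norm R \<le> \<epsilon> * ((1 + H) * norm h)" .
        have Az': "A (?z' t) = A (?z t) + A' (?z t) (t *\<^sub>R h, ?D) + R" unfolding R_def zz by simp
        \<comment> \<open>The increment of \<open>u\<close> is the predicted one plus the error
          \<open>w t\<close>. The predicted part cancels, by \<open>integrable\<close>, against a
          term from the derivative of \<open>t *\<^sub>R A (?z t) h\<close>; what remains is linear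
          in \<open>w t\<close>, quadratic in \<open>h\<close>, or linearization error.\<close>
        have split: "(t *\<^sub>R h, ?D) = t *\<^sub>R (h, A (?z t) h) + (0, w t)" unfolding w_def by simp
        have split': "A' (?z t) (t *\<^sub>R h, ?D) x = A' (?z t) (0, w t) x + t *\<^sub>R A' (?z t) (h, A (?z t) h) x"
          unfolding split
          by (simp only: blinfun.add_right blinfun.add_left blinfun.scaleR_right blinfun.scaleR_left add.commute)
        have "w' t = A' (?z t) (t *\<^sub>R h, ?D) x + A' (?z t) (t *\<^sub>R h, ?D) h + R (x + h)
            - t *\<^sub>R A' (?z t) (h, A (?z t) h) x"
          unfolding w'_def Az' integrable[OF zK(1), of x h]
          by (simp add: blinfun.add_left blinfun.add_right)
        then have w'_eq: "w' t = A' (?z t) (0, w t) x + A' (?z t) (?z' t - ?z t) h + R (x + h)"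
          unfolding split' zz by simp
        have "norm (A' (?z t) (0, w t) x) \<le> norm (A' (?z t)) * norm (0 :: 'x, w t) * norm x"
          using norm_blinfun order_trans mult_right_mono norm_ge_zero by meson
        also have "\<dots> \<le> C * norm (w t) * r"
          using C(1) C(2)[OF zK(1)] x by (intro mult_mono) (auto simp: norm_Pair)
        also have "\<dots> = C * r * norm (w t)" by simp
        also have "\<dots> \<le> 1 / 4 * norm (w t)" by (rule mult_right_mono[OF r(2) norm_ge_zero])
        also have "\<dots> \<le> norm (w t) / 2" by simp
        finally have n1: "norm (A' (?z t) (0, w t) x) \<le> norm (w t) / 2" .
        have "norm (A' (?z t) (?z' t - ?z t) h) \<le> norm (A' (?z t)) * norm (?z' t - ?z t) * norm h"
          using norm_blinfun order_trans mult_right_mono norm_ge_zero by meson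
        also have "\<dots> \<le> C * ((1 + H) * norm h) * norm h"
          using C(1) C(2)[OF zK(1)] nzz H by (intro mult_mono) auto
        also have "\<dots> = ((1 + H) * (C * norm h)) * norm h" by simp
        also have "\<dots> \<le> e / 4 * norm h" using h(3) by (intro mult_right_mono) auto
        finally have n2: "norm (A' (?z t) (?z' t - ?z t) h) \<le> e / 4 * norm h" .
        have "norm (R (x + h)) \<le> norm R * norm (x + h)" by (rule norm_blinfun)
        also have "\<dots> \<le> (\<epsilon> * ((1 + H) * norm h)) * r" using nR xh \<epsilon> H by (intro mult_mono) auto
        also have "\<dots> = (\<epsilon> * (4 * (1 + H) * r)) / 4 * norm h" by simp
        also have "\<epsilon> * (4 * (1 + H) * r) = e" unfolding \<epsilon>_def using H r(1) by simp
        finally have n3: "norm (R (x + h)) \<le> e / 4 * norm h" .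
        have "norm (w' t) \<le> norm (A' (?z t) (0, w t) x) + norm (A' (?z t) (?z' t - ?z t) h) + norm (R (x + h))"
          unfolding w'_eq using norm_triangle_ineq by (meson add_mono order_trans order_refl)
        also have "\<dots> \<le> norm (w t) / 2 + e / 2 * norm h" using n1 n2 n3 by simp
        finally show "norm (w' t) \<le> norm (w t) / 2 + e / 2 * norm h" .
      qed (auto simp: w_def)
      then show "norm (u y - u x - A (x, u x) (y - x)) \<le> e * norm (y - x)"
        unfolding w_def h_def by simp
    qed
  qed
  show ?thesis
  proof (rule that[of r u])
    show "(x, u x) \<in> cball 0 \<rho> \<and> (u has_derivative blinfun_apply (A (x, u x))) (at x)" if "x \<in> ball 0 r" for x
      using inK[of x] deriv[OF that] that unfolding K_def by simp
  qed (fact r(1) u0)+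
qed

section \<open>Frobenius' theorem\<close>

text \<open>An operator is a sum of rank-one operators that depend linearly on its values at the
  basis vectors.\<close>

lemma smooth_on_blinfunI:
  fixes f :: "'v::euclidean_space \<Rightarrow> 'x::euclidean_space \<Rightarrow>\<^sub>L 'y::real_normed_vector"
  assumes "open S" "\<And>b. b \<in> Basis \<Longrightarrow> smooth_on S (\<lambda>z. f z b)"
  shows "smooth_on S f"
proof -
  have "f z = (\<Sum>b\<in>Basis. blinfun_scaleR_left (f z b) o\<^sub>L blinfun_inner_left b)" for z
  proof (rule blinfun_eqI)
    fix v :: 'x
    show "f z v = (\<Sum>b\<in>Basis. blinfun_scaleR_left (f z b) o\<^sub>L blinfun_inner_left b) v"
      unfolding blinfun.sum_left
      using linear_basis_expand[OF bounded_linear.linear[OF blinfun.bounded_linear_right[of "f z"]], of v] by simp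
  qed
  then have "f = (\<lambda>z. \<Sum>b\<in>Basis. blinfun_scaleR_left (f z b) o\<^sub>L blinfun_inner_left b)" by blast
  moreover have "smooth_on S (\<lambda>z. \<Sum>b\<in>Basis. blinfun_scaleR_left (f z b) o\<^sub>L blinfun_inner_left b)"
    by (intro smooth_on_sum smooth_on_bilinear[OF bounded_bilinear_blinfun_compose] smooth_on_const
        smooth_on_bounded_linear_comp[OF _ bounded_linear_blinfun_scaleR_left] assms)
  ultimately show ?thesis by metis
qed

lemma smooth_on_blinfun_apply:
  "open S \<Longrightarrow> smooth_on S f \<Longrightarrow> smooth_on S (\<lambda>z. blinfun_apply (f z) v)"
  by (rule smooth_on_bounded_linear_comp[OF _ blinfun.bounded_linear_left])

text \<open>Continuity of \<open>f\<close> suffices because \<open>g\<close> vanishes at the point.\<close>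

lemma has_derivative_bilinear_vanishing:
  fixes f :: "'z::real_normed_vector \<Rightarrow> 'a::real_normed_vector" and g :: "'z \<Rightarrow> 'b::real_normed_vector"
    and p :: "'a \<Rightarrow> 'b \<Rightarrow> 'c::real_normed_vector"
  assumes p: "bounded_bilinear p" and f: "isCont f z" and g: "(g has_derivative g') (at z)" and "g z = 0"
  shows "((\<lambda>y. p (f y) (g y)) has_derivative (\<lambda>h. p (f z) (g' h))) (at z)"
proof -
  interpret p: bounded_bilinear p by fact
  obtain K where K: "K > 0" "\<And>a b. norm (p a b) \<le> norm a * norm b * K" using p.pos_bounded by blast
  \<comment> \<open>Since \<open>g\<close> vanishes at \<open>z\<close>, it is bounded by
    \<open>L * norm (y - z)\<close> nearby; the 1 absorbs the remainder of the linear
    approximation.\<close>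
  define L where "L = onorm g' + 1"
  have bl: "bounded_linear g'" using g has_derivative_bounded_linear by blast
  have L: "L > 0" unfolding L_def using onorm_pos_le[OF bl] by linarith
  obtain d1 where d1: "d1 > 0" "\<And>y. norm (y - z) < d1 \<Longrightarrow> norm (g y) \<le> L * norm (y - z)"
  proof -
    obtain d where d: "d > 0" "\<And>y. norm (y - z) < d \<Longrightarrow> norm (g y - g z - g' (y - z)) \<le> 1 * norm (y - z)"
      using g unfolding has_derivative_at_alt by (metis zero_less_one)
    have "norm (g y) \<le> L * norm (y - z)" if "norm (y - z) < d" for y
    proof -
      have "norm (g y) \<le> norm (g y - g' (y - z)) + norm (g' (y - z))"
        using norm_triangle_ineq[of "g y - g' (y - z)" "g' (y - z)"] by simp
      also have "\<dots> \<le> 1 * norm (y - z) + onorm g' * norm (y - z)"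
        using d(2)[OF that] \<open>g z = 0\<close> onorm[OF bl] by (intro add_mono) auto
      finally show ?thesis by (simp add: L_def algebra_simps)
    qed
    then show thesis using that d(1) by blast
  qed
  \<comment> \<open>The first factor tends to 0 and the second is of first order.\<close>
  have "((\<lambda>y. p (f y - f z) (g y)) has_derivative (\<lambda>h. 0)) (at z)"
    unfolding has_derivative_at_alt
  proof (intro conjI allI impI bounded_linear_zero)
    fix e :: real assume e: "e > 0"
    then have "e / (L * K) > 0" using L K by simp
    then obtain d2 where d2: "d2 > 0" "\<And>y. norm (y - z) < d2 \<Longrightarrow> norm (f y - f z) < e / (L * K)"
      using f unfolding continuous_at_eps_delta dist_norm by meson
    have "norm (p (f y - f z) (g y)) \<le> e * norm (y - z)" if "norm (y - z) < min d1 d2" for y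
    proof -
      have "norm (p (f y - f z) (g y)) \<le> norm (f y - f z) * norm (g y) * K" by (rule K)
      also have "\<dots> \<le> e / (L * K) * (L * norm (y - z)) * K"
        using d1(2)[of y] d2(2)[of y] that K L e by (intro mult_mono) auto
      also have "\<dots> = e * norm (y - z)" using K L by simp
      finally show ?thesis .
    qed
    then show "\<exists>d>0. \<forall>y. norm (y - z) < d \<longrightarrow>
        norm (p (f y - f z) (g y) - p (f z - f z) (g z) - 0) \<le> e * norm (y - z)"
      using d1(1) d2(1) by (intro exI[of _ "min d1 d2"]) (auto simp: p.zero_left)
  qed
  moreover have "((\<lambda>y. p (f z) (g y)) has_derivative (\<lambda>h. p (f z) (g' h))) (at z)"
    by (rule bounded_linear.has_derivative[OF p.bounded_linear_right g])
  ultimately have "((\<lambda>y. p (f y - f z) (g y) + p (f z) (g y)) has_derivative (\<lambda>h. 0 + p (f z) (g' h))) (at z)"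
    by (rule has_derivative_add)
  then show ?thesis by (simp add: p.diff_left)
qed

text \<open>Close to the identity \<open>G z\<close> is bounded below, hence invertible in finite
  dimension, with uniformly bounded inverses. Continuity and differentiability of the inverse follow
  from one identity comparing it at two points.\<close>

lemma smooth_blinfun_inverse:
  fixes G :: "'z::euclidean_space \<Rightarrow> 'y::euclidean_space \<Rightarrow>\<^sub>L 'y"
  assumes "open S" "z0 \<in> S" and G: "smooth_on S G" and "G z0 = id_blinfun"
  obtains W B where "open W" "z0 \<in> W" "W \<subseteq> S" "smooth_on W B"
    "\<And>z. z \<in> W \<Longrightarrow> B z o\<^sub>L G z = id_blinfun" "\<And>z. z \<in> W \<Longrightarrow> G z o\<^sub>L B z = id_blinfun"
proof -
  \<comment> \<open>The bound 1/2 gives \<open>norm v \<le> 2 * norm (G z v)\<close>, hence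
    injectivity and the bound 2 for the inverse.\<close>
  define W where "W = {z \<in> S. norm (G z - id_blinfun) < 1 / 2}"
  have "continuous_on S (\<lambda>z. norm (G z - id_blinfun))"
    by (intro continuous_intros smooth_on_continuous_on[OF G])
  then have "open W"
    using continuous_open_preimage[OF _ assms(1) open_lessThan[of "1 / 2"]] unfolding W_def
    by (simp only: vimage_def Int_def lessThan_iff mem_Collect_eq)
  have "z0 \<in> W" "W \<subseteq> S" unfolding W_def using assms by auto
  have GW: "smooth_on W G" using G \<open>W \<subseteq> S\<close> smooth_on_subset by blast
  have "\<exists>B. B o\<^sub>L G z = id_blinfun \<and> G z o\<^sub>L B = id_blinfun \<and> norm B \<le> 2" if "z \<in> W" for z
  proof -
    have below: "norm v \<le> 2 * norm (G z v)" for v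
    proof -
      have "norm v \<le> norm (G z v) + norm ((G z - id_blinfun) v)"
        using norm_triangle_ineq4[of "G z v" "(G z - id_blinfun) v"] by (simp add: blinfun.diff_left)
      also have "norm ((G z - id_blinfun) v) \<le> norm (G z - id_blinfun) * norm v" by (rule norm_blinfun)
      also have "\<dots> \<le> 1 / 2 * norm v" using that unfolding W_def by (intro mult_right_mono) auto
      finally show ?thesis by simp
    qed
    have lin: "linear (blinfun_apply (G z))" by (rule bounded_linear.linear[OF blinfun.bounded_linear_right])
    have "inj (blinfun_apply (G z))"
      unfolding linear_injective_0[OF lin] using below by (metis mult_zero_right norm_le_zero_iff norm_zero)
    then obtain g where g: "linear g" "\<And>x. g (G z x) = x" "\<And>x. G z (g x) = x"
      using linear_injective_isomorphism[OF lin] by blast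
    have bl: "bounded_linear g" using g(1) linear_conv_bounded_linear by blast
    have "norm (Blinfun g) \<le> 2"
      using below[of "g _"] g(3) by (intro norm_blinfun_bound) (auto simp: bounded_linear_Blinfun_apply[OF bl])
    then show ?thesis
      using g by (intro exI[of _ "Blinfun g"]) (auto intro!: blinfun_eqI simp: bounded_linear_Blinfun_apply[OF bl])
  qed
  then obtain B where B: "\<And>z. z \<in> W \<Longrightarrow> B z o\<^sub>L G z = id_blinfun"
    "\<And>z. z \<in> W \<Longrightarrow> G z o\<^sub>L B z = id_blinfun" "\<And>z. z \<in> W \<Longrightarrow> norm (B z) \<le> 2"
    by metis
  have Bv: "B z (G z v) = v" "G z (B z v) = v" if "z \<in> W" for z v
    using B(1,2)[OF that] by (metis blinfun_apply_blinfun_compose blinfun_apply_id_blinfun)+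
  \<comment> \<open>The unknown \<open>B y\<close> on the right multiplies a factor vanishing at
    \<open>y = z\<close>. So boundedness of \<open>B\<close> yields continuity, and continuity
    yields differentiability.\<close>
  have diff: "B y = B z - (B y o\<^sub>L ((G y - G z) o\<^sub>L B z))" if "y \<in> W" "z \<in> W" for y z
    by (rule blinfun_eqI) (simp add: blinfun.diff_left blinfun.diff_right Bv that)
  have B_cont: "isCont B z" if z: "z \<in> W" for z
    unfolding continuous_at
  proof (rule Lim_transform_within_open[OF _ \<open>open W\<close> z])
    have "isCont G z" using GW z \<open>open W\<close> smooth_on_continuous_on continuous_on_eq_continuous_at by blast
    then have "((\<lambda>y. 4 * norm (G y - G z)) \<longlongrightarrow> 0) (at z)"
      by (intro tendsto_mult_right_zero tendsto_norm_zero) (simp add: LIM_zero_iff continuous_at)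
    moreover have "eventually (\<lambda>y. norm (B y - B z) \<le> 4 * norm (G y - G z)) (at z)"
      unfolding eventually_at_topological
    proof (intro exI[of _ W] conjI ballI impI \<open>open W\<close> z)
      fix y assume y: "y \<in> W"
      have "norm (B y - B z) = norm (B y o\<^sub>L ((G y - G z) o\<^sub>L B z))"
        by (subst diff[OF y z]) simp
      also have "\<dots> \<le> norm (B y) * (norm (G y - G z) * norm (B z))"
        by (rule order_trans[OF norm_blinfun_compose mult_left_mono[OF norm_blinfun_compose norm_ge_zero]])
      also have "\<dots> \<le> 2 * (norm (G y - G z) * 2)" using B(3) y z by (intro mult_mono) auto
      finally show "norm (B y - B z) \<le> 4 * norm (G y - G z)" by simp
    qed
    ultimately have "((\<lambda>y. B y - B z) \<longlongrightarrow> 0) (at z)" by (rule Lim_null_comparison[rotated])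
    then show "(B \<longlongrightarrow> B z) (at z)" by (simp add: LIM_zero_iff)
  qed simp
  have B_der: "(B has_derivative (\<lambda>h. - (B z o\<^sub>L (fd G z h o\<^sub>L B z)))) (at z)" if z: "z \<in> W" for z
  proof -
    have dG: "(G has_derivative fd G z) (at z)" using GW z smooth_on_differentiable fd_works by blast
    have "((\<lambda>y. (G y - G z) o\<^sub>L B z) has_derivative (\<lambda>h. fd G z h o\<^sub>L B z)) (at z)"
      using dG by (intro bounded_linear.has_derivative[OF
          bounded_bilinear.bounded_linear_left[OF bounded_bilinear_blinfun_compose]])
        (auto intro!: derivative_eq_intros)
    from has_derivative_diff[OF has_derivative_const
        has_derivative_bilinear_vanishing[OF bounded_bilinear_blinfun_compose B_cont[OF z] this]]
    have "((\<lambda>y. B z - (B y o\<^sub>L ((G y - G z) o\<^sub>L B z))) has_derivative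
        (\<lambda>h. - (B z o\<^sub>L (fd G z h o\<^sub>L B z)))) (at z)"
      by simp
    then show ?thesis
      using has_derivative_cong_open[OF \<open>open W\<close> z, where f = B, OF diff[OF _ z]] by simp
  qed
  \<comment> \<open>The derivative is a product of \<open>B\<close> with a derivative of
    \<open>G\<close>, so smoothness climbs one order at a time.\<close>
  have "C_k_on k W B" for k
  proof (induction k)
    case 0
    then show ?case using B_cont by (simp add: continuous_at_imp_continuous_on)
  next
    case (Suc k)
    show ?case
    proof (rule C_k_on_SucI[OF \<open>open W\<close> B_der])
      fix v
      have "C_k_on k W (\<lambda>z. fd G z v)" using smooth_on_fd[OF GW] unfolding smooth_on_def by blast
      then have "C_k_on k W (\<lambda>z. B z o\<^sub>L (fd G z v o\<^sub>L B z))"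
        by (intro C_k_on_bilinear[OF bounded_bilinear_blinfun_compose \<open>open W\<close>] Suc)
      then show "C_k_on k W (\<lambda>z. - (B z o\<^sub>L (fd G z v o\<^sub>L B z)))"
        by (rule C_k_on_bounded_linear_comp[OF \<open>open W\<close> bounded_linear_minus[OF bounded_linear_ident]])
    qed
  qed
  then have "smooth_on W B" unfolding smooth_on_def by blast
  then show ?thesis using that \<open>open W\<close> \<open>z0 \<in> W\<close> \<open>W \<subseteq> S\<close> B(1,2) by blast
qed

text \<open>A linear right inverse embeds the target as a complement of the kernel.\<close>

lemma dim_kernel_surj:
  fixes f :: "'z::euclidean_space \<Rightarrow> 'y::euclidean_space"
  assumes f: "linear f" "surj f"
  shows "dim {v. f v = 0} + DIM('y) = DIM('z)"
proof -
  obtain g where g: "linear g" "f \<circ> g = id" using linear_surjective_right_inverse[OF f] by blast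
  have fg: "f (g x) = x" for x using g(2) by (metis comp_apply id_apply)
  have "inj g" using fg by (metis injI)
  have "x = (x - g (f x)) + g (f x) \<and> f (x - g (f x)) = 0" for x
    using fg by (simp add: linear_diff[OF f(1)])
  then have "{x + y |x y. x \<in> {v. f v = 0} \<and> y \<in> range g} = UNIV" by blast
  moreover have "{v. f v = 0} \<inter> range g = {0}" using fg linear_0[OF g(1)] linear_0[OF f(1)] by auto
  moreover have "subspace {v. f v = 0}" using f(1) by (rule linear_subspace_kernel)
  moreover have "subspace (range g)" using g(1) by (simp add: linear_subspace_image)
  ultimately have "dim (UNIV :: 'z set) + dim {0::'z} = dim {v. f v = 0} + dim (range g)"
    using dim_sums_Int[of "{v. f v = 0}" "range g"] by simp
  moreover have "dim (range g) = DIM('y)" using dim_image_eq[OF g(1)] \<open>inj g\<close> by (simp add: inj_on_def)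
  ultimately show ?thesis by simp
qed

text \<open>\<open>P\<close> parametrizes the kernel at \<open>z0\<close> and \<open>Q\<close> is a
  right inverse of \<open>\<Lambda> z0\<close>. In this fixed splitting \<open>\<Lambda> z\<close>
  restricted to the second summand is the identity at \<open>z0\<close>, so it stays invertible
  nearby; minus its inverse times the restriction to the first summand is
  \<open>A z\<close>.\<close>

lemma kernel_local_frame:
  fixes \<Lambda> :: "'z::euclidean_space \<Rightarrow> 'z \<Rightarrow> 'y::euclidean_space"
  assumes "open S" "z0 \<in> S" and lin: "\<And>z. z \<in> S \<Longrightarrow> linear (\<Lambda> z)"
    and smooth: "\<And>v. smooth_on S (\<lambda>z. \<Lambda> z v)" and surj: "surj (\<Lambda> z0)"
    and dims: "DIM('z) = DIM('x::euclidean_space) + DIM('y)"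
  obtains W and P :: "'x::euclidean_space \<Rightarrow> 'z" and Q :: "'y \<Rightarrow> 'z" and A :: "'z \<Rightarrow> 'x \<Rightarrow>\<^sub>L 'y"
  where "open W" "z0 \<in> W" "W \<subseteq> S" "linear P" "linear Q" "bij (\<lambda>(x, y). P x + Q y)" "smooth_on W A"
    "\<And>z x y. z \<in> W \<Longrightarrow> \<Lambda> z (P x + Q y) = 0 \<longleftrightarrow> y = A z x"
proof -
  note lin0 = lin[OF \<open>z0 \<in> S\<close>]
  obtain Q where Q: "linear Q" "\<Lambda> z0 \<circ> Q = id" using linear_surjective_right_inverse[OF lin0 surj] by blast
  have LQ: "\<Lambda> z0 (Q y) = y" for y using Q(2) by (metis comp_apply id_apply)
  have "dim (UNIV :: 'x set) = dim {v. \<Lambda> z0 v = 0}" using dim_kernel_surj[OF lin0 surj] dims by simp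
  \<comment> \<open>\<open>'x\<close> and the kernel merely have the same dimension; an isometry
    between them provides \<open>P\<close>.\<close>
  then obtain P P' where P: "linear P" "range P = {v. \<Lambda> z0 v = 0}" "\<And>x::'x. P' (P x) = x"
    using isometries_subspaces[OF subspace_UNIV linear_subspace_kernel[OF lin0]] by (metis UNIV_I)
  have LP: "\<Lambda> z0 (P x) = 0" for x using P(2) by blast
  have bij: "bij (\<lambda>(x, y). P x + Q y)"
  proof (rule bijI)
    show "inj (\<lambda>(x, y). P x + Q y)"
    proof (rule injI, clarify)
      fix a b c d assume eq: "P a + Q b = P c + Q d"
      then have "\<Lambda> z0 (P a + Q b) = \<Lambda> z0 (P c + Q d)" by simp
      then have "b = d" by (simp add: linear_add[OF lin0] LP LQ)
      then have "P a = P c" using eq by simp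
      then have "a = c" using P(3) by metis
      then show "a = c \<and> b = d" using \<open>b = d\<close> by simp
    qed
    have "v \<in> range (\<lambda>(x, y). P x + Q y)" for v
    proof -
      have "\<Lambda> z0 (v - Q (\<Lambda> z0 v)) = 0" by (simp add: linear_diff[OF lin0] LQ)
      then obtain x where "P x = v - Q (\<Lambda> z0 v)" using P(2) by (metis (mono_tags) mem_Collect_eq rangeE)
      then show ?thesis by (intro image_eqI[of _ _ "(x, \<Lambda> z0 v)"]) auto
    qed
    then show "surj (\<lambda>(x, y). P x + Q y)" by blast
  qed
  have bl: "bounded_linear (\<lambda>y. \<Lambda> z (Q y))" "bounded_linear (\<lambda>x. \<Lambda> z (P x))" if "z \<in> S" for z
    using linear_compose[OF Q(1) lin[OF that]] linear_compose[OF P(1) lin[OF that]]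
    by (simp_all add: linear_conv_bounded_linear[symmetric] o_def)
  define G where "G = (\<lambda>z. Blinfun (\<lambda>y. \<Lambda> z (Q y)))"
  define H where "H = (\<lambda>z. Blinfun (\<lambda>x. \<Lambda> z (P x)))"
  have G: "G z y = \<Lambda> z (Q y)" and H: "H z x = \<Lambda> z (P x)" if "z \<in> S" for z x y
    unfolding G_def H_def using bl[OF that] by (simp_all add: bounded_linear_Blinfun_apply)
  have G_smooth: "smooth_on S G"
    by (rule smooth_on_blinfunI[OF assms(1)], subst smooth_on_cong[OF assms(1) G]) (auto intro: smooth)
  have H_smooth: "smooth_on S H"
    by (rule smooth_on_blinfunI[OF assms(1)], subst smooth_on_cong[OF assms(1) H]) (auto intro: smooth)
  have "G z0 = id_blinfun" by (rule blinfun_eqI) (simp add: G \<open>z0 \<in> S\<close> LQ)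
  from smooth_blinfun_inverse[OF assms(1,2) G_smooth this]
  obtain W B where W: "open W" "z0 \<in> W" "W \<subseteq> S" and B: "smooth_on W B"
    "\<And>z. z \<in> W \<Longrightarrow> B z o\<^sub>L G z = id_blinfun" "\<And>z. z \<in> W \<Longrightarrow> G z o\<^sub>L B z = id_blinfun" by blast
  have Bv: "B z (G z v) = v" "G z (B z v) = v" if "z \<in> W" for z v
    using B(2,3)[OF that] by (metis blinfun_apply_blinfun_compose blinfun_apply_id_blinfun)+
  define A where "A = (\<lambda>z. - (B z o\<^sub>L H z))"
  have A_smooth: "smooth_on W A"
    unfolding A_def
    by (intro smooth_on_bounded_linear_comp[OF W(1) bounded_linear_minus[OF bounded_linear_ident]]
        smooth_on_bilinear[OF bounded_bilinear_blinfun_compose W(1) B(1)] smooth_on_subset[OF H_smooth W(3)])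
  have "\<Lambda> z (P x + Q y) = 0 \<longleftrightarrow> y = A z x" if z: "z \<in> W" for z x y
  proof -
    have "\<Lambda> z (P x + Q y) = H z x + G z y" using z W(3) G H linear_add[OF lin] by (metis subsetD)
    moreover have "H z x + G z y = 0 \<longleftrightarrow> G z y = - H z x" by (metis add.commute eq_neg_iff_add_eq_0)
    moreover have "G z y = - H z x \<longleftrightarrow> y = - B z (H z x)" using Bv[OF z] by (metis blinfun.minus_right)
    ultimately show ?thesis by (simp add: A_def blinfun.minus_left)
  qed
  then show ?thesis using that[OF W P(1) Q(1) bij A_smooth] by blast
qed

text \<open>Keep the \<open>P\<close>-component of \<open>v\<close> fixed and let the graph
  determine the other one. A single \<open>W\<close> serves all \<open>v\<close>, so several
  sections can be taken over it.\<close>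

lemma kernel_section:
  fixes \<Lambda> :: "'z::euclidean_space \<Rightarrow> 'z \<Rightarrow> 'y::euclidean_space"
  assumes "open S" "z0 \<in> S" "\<And>z. z \<in> S \<Longrightarrow> linear (\<Lambda> z)" "\<And>v. smooth_on S (\<lambda>z. \<Lambda> z v)"
    "surj (\<Lambda> z0)" and dims: "DIM('z) = DIM('x::euclidean_space) + DIM('y)"
  obtains W where "open W" "z0 \<in> W" "W \<subseteq> S"
    "\<And>v. \<Lambda> z0 v = 0 \<Longrightarrow> \<exists>X. smooth_on W X \<and> X z0 = v \<and> (\<forall>z\<in>W. \<Lambda> z (X z) = 0)"
proof (rule kernel_local_frame[where 'x = 'x, OF assms])
  fix W and P :: "'x \<Rightarrow> 'z" and Q :: "'y \<Rightarrow> 'z" and A :: "'z \<Rightarrow> 'x \<Rightarrow>\<^sub>L 'y"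
  assume W: "open W" "z0 \<in> W" "W \<subseteq> S" and PQ: "linear P" "linear Q" "bij (\<lambda>(x, y). P x + Q y)"
    and A: "smooth_on W A" "\<And>z x y. z \<in> W \<Longrightarrow> \<Lambda> z (P x + Q y) = 0 \<longleftrightarrow> y = A z x"
  have "\<exists>X. smooth_on W X \<and> X z0 = v \<and> (\<forall>z\<in>W. \<Lambda> z (X z) = 0)" if v: "\<Lambda> z0 v = 0" for v
  proof -
    have "v \<in> range (\<lambda>(x, y). P x + Q y)" using bij_is_surj[OF PQ(3)] by simp
    then obtain x y where xy: "v = P x + Q y" by auto
    have "bounded_linear Q" using PQ(2) linear_conv_bounded_linear by blast
    then have "smooth_on W (\<lambda>z. P x + Q (A z x))"
      by (intro smooth_on_add smooth_on_const W smooth_on_bounded_linear_comp[of W Q]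
          smooth_on_blinfun_apply A)
    moreover have "P x + Q (A z0 x) = v" using A(2)[OF W(2)] v xy by metis
    ultimately show ?thesis using A(2) by (intro exI[of _ "\<lambda>z. P x + Q (A z x)"]) auto
  qed
  then show thesis using that W by blast
qed

text \<open>Frobenius' theorem for the kernel of a family of forms: \<open>s\<close> is the graph of a solution \<open>u\<close> of
  \<open>Du = A(x, u)\<close>, and the integrability condition for this equation is involutivity of the kernel.\<close>

lemma frobenius_kernel:
  fixes \<Lambda> :: "'z::euclidean_space \<Rightarrow> 'z \<Rightarrow> 'y::euclidean_space"
  assumes S: "open S" "z0 \<in> S" and lin: "\<And>z. z \<in> S \<Longrightarrow> linear (\<Lambda> z)"
    and smooth: "\<And>v. smooth_on S (\<lambda>z. \<Lambda> z v)" and surj: "surj (\<Lambda> z0)"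
    and dims: "DIM('z) = DIM('x::euclidean_space) + DIM('y)"
    and closed: "\<And>z v w. z \<in> S \<Longrightarrow> \<Lambda> z v = 0 \<Longrightarrow> \<Lambda> z w = 0 \<Longrightarrow>
      fd (\<lambda>y. \<Lambda> y w) z v = fd (\<lambda>y. \<Lambda> y v) z w"
  obtains r and s :: "'x::euclidean_space \<Rightarrow> 'z" where "r > 0" "s 0 = z0" "smooth_on (ball 0 r) s" "inj_on s (ball 0 r)"
    "s ` ball 0 r \<subseteq> S"
    "\<And>x. x \<in> ball 0 r \<Longrightarrow> inj (fd s x) \<and> range (fd s x) = {v. \<Lambda> (s x) v = 0}"
proof (rule kernel_local_frame[where 'x = 'x, OF assms(1-6)])
  fix W and P :: "'x \<Rightarrow> 'z" and Q :: "'y \<Rightarrow> 'z" and A :: "'z \<Rightarrow> 'x \<Rightarrow>\<^sub>L 'y"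
  assume W: "open W" "z0 \<in> W" "W \<subseteq> S" and PQ: "linear P" "linear Q" "bij (\<lambda>(x, y). P x + Q y)"
    and A_smooth: "smooth_on W A" and A: "\<And>z x y. z \<in> W \<Longrightarrow> \<Lambda> z (P x + Q y) = 0 \<longleftrightarrow> y = A z x"
  have dA: "(A has_derivative fd A z) (at z)" if "z \<in> W" for z
    using A_smooth that smooth_on_differentiable fd_works by blast
  \<comment> \<open>Differentiating \<open>\<Lambda> y (X v y) = 0\<close> expresses the derivative
    of \<open>A\<close> by that of \<open>\<Lambda>\<close>; the hypothesis \<open>closed\<close>
    makes it symmetric in \<open>v\<close> and \<open>w\<close>.\<close>
  have integ: "fd A z (P v + Q (A z v)) w = fd A z (P w + Q (A z w)) v" if z: "z \<in> W" for z v w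
  proof -
    define X where "X = (\<lambda>v y. P v + Q (A y v))"
    have X0: "\<Lambda> y (X v y) = 0" if "y \<in> W" for y v using A[OF that] unfolding X_def by blast
    have dX: "(X v has_derivative (\<lambda>h. Q (fd A z h v))) (at z)" for v
    proof -
      have "((\<lambda>y. Q (A y v)) has_derivative (\<lambda>h. Q (fd A z h v))) (at z)"
        by (intro bounded_linear.has_derivative[of Q] bounded_linear.has_derivative[OF blinfun.bounded_linear_left] dA[OF z])
          (use PQ(2) in \<open>simp add: linear_conv_bounded_linear\<close>)
      then show ?thesis unfolding X_def by (auto intro!: derivative_eq_intros)
    qed
    have "((\<lambda>y. \<Lambda> y (X v y)) has_derivative (\<lambda>h. fd (\<lambda>y. \<Lambda> y (X v z)) z h + \<Lambda> z (Q (fd A z h v)))) (at z)" for v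
      by (rule has_derivative_linear_field[OF W(1) z lin smooth_on_differentiable[OF smooth] dX])
        (use z W(3) in auto)
    moreover have "((\<lambda>y. \<Lambda> y (X v y)) has_derivative (\<lambda>h. 0)) (at z)" for v
      by (subst has_derivative_cong_open[OF W(1) z X0]) auto
    ultimately have "(\<lambda>h. fd (\<lambda>y. \<Lambda> y (X v z)) z h + \<Lambda> z (Q (fd A z h v))) = (\<lambda>h. 0)" for v
      by (rule has_derivative_unique)
    then have *: "\<Lambda> z (Q (fd A z h v)) = - fd (\<lambda>y. \<Lambda> y (X v z)) z h" for h v
      by (auto simp: fun_eq_iff eq_neg_iff_add_eq_0 add.commute)
    have zS: "z \<in> S" using z W(3) by blast
    have "\<Lambda> z (Q (fd A z (X v z) w)) = \<Lambda> z (Q (fd A z (X w z) v))"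
      unfolding * using closed[OF zS X0[OF z] X0[OF z]] by simp
    \<comment> \<open>The summand \<open>P 0\<close> brings the vector into the form of the graph
      criterion, and \<open>A z\<close> is 0 at 0.\<close>
    then have "\<Lambda> z (P 0 + Q (fd A z (X v z) w - fd A z (X w z) v)) = 0"
      by (simp add: linear_0[OF PQ(1)] linear_diff[OF PQ(2)] linear_diff[OF lin[OF zS]])
    then show ?thesis using A[OF z] unfolding X_def by (simp add: blinfun.zero_right)
  qed
  \<comment> \<open>Affine coordinates centred at \<open>z0\<close> and adapted to the splitting, in
    which the kernels are the graphs of \<open>a\<close>.\<close>
  define \<psi> where "\<psi> = (\<lambda>(x, y). z0 + (P x + Q y))"
  have \<psi>_lin: "bounded_linear (\<lambda>(x, y). P x + Q y)"
    unfolding linear_conv_bounded_linear[symmetric]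
    by (auto intro!: linearI simp: linear_add[OF PQ(1)] linear_add[OF PQ(2)] linear_scale[OF PQ(1)]
        linear_scale[OF PQ(2)] algebra_simps)
  have \<psi>_smooth: "smooth_on T \<psi>" if "open T" for T
    unfolding \<psi>_def case_prod_beta
    using smooth_on_add[OF that smooth_on_const smooth_on_bounded_linear[OF that \<psi>_lin]] by (simp add: case_prod_beta)
  have "open (\<psi> -` W)"
    by (rule open_vimage[OF W(1) smooth_on_continuous_on[OF \<psi>_smooth[OF open_UNIV]]])
  moreover have "0 \<in> \<psi> -` W" using W(2) linear_0[OF PQ(1)] linear_0[OF PQ(2)] by (simp add: \<psi>_def zero_prod_def)
  ultimately obtain \<rho> where \<rho>: "\<rho> > 0" "cball 0 \<rho> \<subseteq> \<psi> -` W" using open_contains_cball by blast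
  define a where "a = (\<lambda>q. A (\<psi> q))"
  have a_smooth: "smooth_on (\<psi> -` W) a"
    unfolding a_def by (rule smooth_on_compose[OF \<open>open (\<psi> -` W)\<close> W(1) _ \<psi>_smooth A_smooth]) (use \<open>open (\<psi> -` W)\<close> in auto)
  have da: "(a has_derivative (\<lambda>h. fd A (\<psi> q) (P (fst h) + Q (snd h)))) (at q)" if "q \<in> \<psi> -` W" for q
  proof -
    have "(\<psi> has_derivative (\<lambda>h. P (fst h) + Q (snd h))) (at q)"
    proof -
      have "((\<lambda>q. z0 + (\<lambda>(x, y). P x + Q y) q) has_derivative (\<lambda>h. 0 + (\<lambda>(x, y). P x + Q y) h)) (at q)"
        by (intro has_derivative_add has_derivative_const bounded_linear_imp_has_derivative \<psi>_lin)
      then show ?thesis unfolding \<psi>_def case_prod_beta' by simp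
    qed
    moreover have "(A has_derivative fd A (\<psi> q)) (at (\<psi> q))" using dA that by blast
    ultimately show ?thesis unfolding a_def by (rule has_derivative_compose)
  qed
  define a' where "a' = (\<lambda>q. Blinfun (fd a q))"
  have a': "(a has_derivative blinfun_apply (a' q)) (at q)" if "q \<in> \<psi> -` W" for q
    unfolding a'_def using da[OF that] fd_eqI[OF da[OF that]] has_derivative_bounded_linear
    by (metis bounded_linear_Blinfun_apply)
  have "continuous_on (cball 0 \<rho>) a'"
  proof (rule continuous_on_subset[OF _ \<rho>(2)], rule continuous_at_imp_continuous_on, rule ballI,
      rule continuous_blinfun_componentwiseI1)
    fix q i assume q: "q \<in> \<psi> -` W"
    have "continuous_on (\<psi> -` W) (\<lambda>q. fd a q i)" using smooth_on_fd[OF a_smooth] smooth_on_continuous_on by blast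
    then have "continuous_on (\<psi> -` W) (\<lambda>q. a' q i)"
      by (rule continuous_on_eq) (use a' fd_eqI in metis)
    then show "isCont (\<lambda>q. a' q i) q" using q \<open>open (\<psi> -` W)\<close> continuous_on_eq_continuous_at by blast
  qed
  moreover have "a' q (v, a q v) w = a' q (w, a q w) v" if "q \<in> cball 0 \<rho>" for q v w
  proof -
    have q: "q \<in> \<psi> -` W" using that \<rho>(2) by blast
    have "a' q h = fd A (\<psi> q) (P (fst h) + Q (snd h))" for h
      using has_derivative_unique[OF a'[OF q] da[OF q]] by metis
    then show ?thesis using integ[of "\<psi> q" v w] q unfolding a_def by simp
  qed
  ultimately obtain r and u :: "'x \<Rightarrow> 'y" where r: "r > 0" and u: "u 0 = 0"
    "\<And>x. x \<in> ball 0 r \<Longrightarrow> (x, u x) \<in> cball 0 \<rho> \<and> (u has_derivative blinfun_apply (a (x, u x))) (at x)"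
    using total_differential_equation_solvable[OF \<rho>(1), of a a'] a' \<rho>(2)
    by (metis (no_types, lifting) subsetD)
  have in_W: "(x, u x) \<in> \<psi> -` W" if "x \<in> ball 0 r" for x using u(2)[OF that] \<rho>(2) by blast
  \<comment> \<open>The equation improves regularity: the derivative of \<open>u\<close> at
    \<open>x\<close> is \<open>a (x, u x)\<close>, which is as smooth as \<open>u\<close>.\<close>
  have "C_k_on k (ball 0 r) u" for k
  proof (induction k)
    case 0
    have "continuous_on (ball 0 r) u"
      using u(2) has_derivative_continuous by (blast intro: continuous_at_imp_continuous_on)
    then show ?case by simp
  next
    case (Suc k)
    have id: "C_k_on k (ball 0 r) (\<lambda>x::'x. x)" by (rule C_k_on_bounded_linear[OF open_ball bounded_linear_ident])
    have "C_k_on k (ball 0 r) (\<lambda>x. (x, 0::'y) + (0::'x, u x))"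
      by (intro C_k_on_add open_ball C_k_on_bounded_linear_comp[OF open_ball _ id] C_k_on_bounded_linear_comp[OF open_ball _ Suc]
          bounded_linear_Pair bounded_linear_ident bounded_linear_zero)
    then have pair: "C_k_on k (ball 0 r) (\<lambda>x. (x, u x))" by simp
    have "C_k_on k (ball 0 r) (\<lambda>x. a (x, u x))"
      by (rule C_k_on_compose[OF open_ball \<open>open (\<psi> -` W)\<close> _ pair]) (use in_W a_smooth in \<open>auto simp: smooth_on_def\<close>)
    then show ?case
      using u(2) by (intro C_k_on_SucI[OF open_ball, where f' = "\<lambda>x. blinfun_apply (a (x, u x))"]
          C_k_on_bounded_linear_comp[OF open_ball blinfun.bounded_linear_left]) auto
  qed
  then have u_smooth: "smooth_on (ball 0 r) u" unfolding smooth_on_def by blast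
  define s where "s = (\<lambda>x. \<psi> (x, u x))"
  have ds: "fd s x = (\<lambda>h. P h + Q (A (s x) h))" if "x \<in> ball 0 r" for x
  proof -
    have "((\<lambda>x. z0 + (P x + Q (u x))) has_derivative (\<lambda>h. 0 + (P h + Q (a (x, u x) h)))) (at x)"
      using PQ(1,2) u(2)[OF that]
      by (intro has_derivative_add has_derivative_const bounded_linear_imp_has_derivative
          bounded_linear.has_derivative[of Q]) (simp_all add: linear_conv_bounded_linear)
    then show ?thesis unfolding s_def \<psi>_def a_def by (simp add: fd_eqI)
  qed
  show thesis
  proof (rule that[OF r])
    show "s 0 = z0" unfolding s_def \<psi>_def using u(1) linear_0[OF PQ(1)] linear_0[OF PQ(2)] by simp
    show "smooth_on (ball 0 r) s"
      unfolding s_def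
      by (rule smooth_on_compose[OF open_ball open_UNIV _ _ \<psi>_smooth[OF open_UNIV]])
        (simp_all add: smooth_on_Pair u_smooth smooth_on_bounded_linear bounded_linear_ident)
    show "inj_on s (ball 0 r)"
    proof (rule inj_onI)
      fix x y assume "s x = s y"
      then have "(\<lambda>(x, y). P x + Q y) (x, u x) = (\<lambda>(x, y). P x + Q y) (y, u y)" by (simp add: s_def \<psi>_def)
      then show "x = y" using injD[OF bij_is_inj[OF PQ(3)]] by blast
    qed
    show "s ` ball 0 r \<subseteq> S" using in_W W(3) unfolding s_def by auto
  next
    fix x :: 'x assume x: "x \<in> ball 0 r"
    have sW: "s x \<in> W" using in_W[OF x] by (simp add: s_def)
    show "inj (fd s x) \<and> range (fd s x) = {v. \<Lambda> (s x) v = 0}"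
    proof
      show "inj (fd s x)"
      proof (rule injI)
        fix h k assume "fd s x h = fd s x k"
        then have "(\<lambda>(x, y). P x + Q y) (h, A (s x) h) = (\<lambda>(x, y). P x + Q y) (k, A (s x) k)" by (simp add: ds[OF x])
        then show "h = k" using injD[OF bij_is_inj[OF PQ(3)]] by blast
      qed
      show "range (fd s x) = {v. \<Lambda> (s x) v = 0}"
      proof (intro equalityI subsetI)
        fix v assume "v \<in> {v. \<Lambda> (s x) v = 0}"
        moreover have "v \<in> range (\<lambda>(x, y). P x + Q y)" using bij_is_surj[OF PQ(3)] by simp
        then obtain h k where "v = P h + Q k" by auto
        ultimately show "v \<in> range (fd s x)" using A[OF sW] by (auto simp: ds[OF x])
      qed (use A[OF sW] in \<open>auto simp: ds[OF x]\<close>)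
    qed
  qed
qed

section \<open>Forms on a chart of the cotangent bundle\<close>

definition ed :: "('z::real_normed_vector \<Rightarrow> 'z \<Rightarrow> real) \<Rightarrow> 'z \<Rightarrow> 'z \<Rightarrow> 'z \<Rightarrow> real" where
  "ed a x u v = fd (\<lambda>y. a y v) x u - fd (\<lambda>y. a y u) x v"

lemma ext_deriv_eq_ed: "ext_deriv \<alpha> i = ed (\<alpha> i)"
  by (simp add: ext_deriv_def ed_def fun_eq_iff)

lemma ed_antisym: "ed a x u v = - ed a x v u"
  by (simp add: ed_def)

lemma ed_cong:
  assumes "open S" "x \<in> S" "\<And>y v. y \<in> S \<Longrightarrow> a y v = b y v"
  shows "ed a x u v = ed b x u v"
  using fd_cong_open[OF assms(1,2), of "\<lambda>y. a y v" "\<lambda>y. b y v" for v] assms(3) by (simp add: ed_def)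

text \<open>The value space is left general, so that (1,1) tensors and vector-valued forms are
  covered too.\<close>

definition smooth_form_on :: "'z::euclidean_space set \<Rightarrow> ('z \<Rightarrow> 'w::euclidean_space \<Rightarrow> 'u::real_normed_vector) \<Rightarrow> bool" where
  "smooth_form_on S a \<longleftrightarrow> (\<forall>z\<in>S. linear (a z)) \<and> (\<forall>v. smooth_on S (\<lambda>z. a z v))"

lemma smooth_form_onD:
  assumes "smooth_form_on S a"
  shows "z \<in> S \<Longrightarrow> linear (a z)" "smooth_on S (\<lambda>z. a z v)" "z \<in> S \<Longrightarrow> (\<lambda>z. a z v) differentiable (at z)"
  using assms smooth_on_differentiable unfolding smooth_form_on_def by blast+

lemma smooth_form_on_apply:
  assumes "open S" "smooth_form_on S a" "smooth_on S X"
  shows "smooth_on S (\<lambda>z. a z (X z))"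
  by (rule smooth_on_linear_field[OF assms(1) _ _ assms(3)]) (use smooth_form_onD[OF assms(2)] in auto)

lemma smooth_form_on_compose:
  assumes "open S" "smooth_form_on S a" "smooth_form_on S L"
  shows "smooth_form_on S (\<lambda>z v. a z (L z v))"
  unfolding smooth_form_on_def
  using linear_compose[of "L _" "a _"] smooth_form_onD[OF assms(2)] smooth_form_onD[OF assms(3)]
    smooth_form_on_apply[OF assms(1,2)] by (auto simp: o_def)

lemma fd_form_apply:
  assumes "open S" "x \<in> S" "smooth_form_on S a" "(X has_derivative X') (at x)"
  shows "fd (\<lambda>y. a y (X y)) x h = fd (\<lambda>y. a y (X x)) x h + a x (X' h)"
  by (rule fun_cong[OF fd_eqI[OF has_derivative_linear_field[OF assms(1,2) _ _ assms(4)]]])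
     (use smooth_form_onD[OF assms(3)] assms(2) in auto)

lemma linear_fd_form:
  assumes "open S" "x \<in> S" "smooth_form_on S a"
  shows "linear (\<lambda>w. fd (\<lambda>y. a y w) x h)"
  by (rule fd_linear_field_const_linear[OF assms(1,2)]) (use smooth_form_onD[OF assms(3)] assms(2) in auto)

lemma linear_fd_form_direction:
  assumes "x \<in> S" "smooth_form_on S a"
  shows "linear (fd (\<lambda>y. a y w) x)"
  using fd_linear smooth_form_onD(3)[OF assms(2,1)] by blast

lemma ed_linear:
  assumes "open S" "x \<in> S" "smooth_form_on S a"
  shows "linear (ed a x u)" "linear (\<lambda>u. ed a x u v)"
  unfolding ed_def
  by (auto intro!: linear_compose_sub linear_fd_form[OF assms] linear_fd_form_direction[OF assms(2,3)])

lemma smooth_form_on_ed: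
  assumes "open S" "smooth_form_on S a"
  shows "smooth_form_on S (\<lambda>z v. ed a z u v)" "smooth_form_on S (\<lambda>z u. ed a z u v)"
proof -
  have "smooth_on S (\<lambda>z. ed a z u v)" for u v
    unfolding ed_def by (intro smooth_on_diff smooth_on_fd assms(1) smooth_form_onD(2)[OF assms(2)])
  then show "smooth_form_on S (\<lambda>z v. ed a z u v)" "smooth_form_on S (\<lambda>z u. ed a z u v)"
    unfolding smooth_form_on_def using ed_linear[OF assms(1) _ assms(2)] by auto
qed

text \<open>The second derivatives of \<open>T\<close> are symmetric and cancel in the
  antisymmetrization. \<open>b\<close> has to be the pull-back on \<open>S\<close> only.\<close>

lemma ed_pullback:
  fixes T :: "'y::euclidean_space \<Rightarrow> 'z::euclidean_space"
  assumes S: "open S" "open S'" "T ` S \<subseteq> S'" and T: "smooth_on S T" and a: "smooth_form_on S' a" and "x \<in> S"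
    and b: "\<And>y v. y \<in> S \<Longrightarrow> b y v = a (T y) (fd T y v)"
  shows "ed b x u v = ed a (T x) (fd T x u) (fd T x v)"
proof -
  have dT: "(T has_derivative fd T x) (at x)" using T \<open>x \<in> S\<close> smooth_on_differentiable fd_works by blast
  have Tx: "T x \<in> S'" using S(3) \<open>x \<in> S\<close> by blast
  have aT: "smooth_form_on S (\<lambda>y. a (T y))"
    unfolding smooth_form_on_def
    using smooth_form_onD(1)[OF a] S(3) smooth_on_compose[OF S T smooth_form_onD(2)[OF a]] by blast
  have "fd (\<lambda>y. b y v) x u = fd (\<lambda>z. a z (fd T x v)) (T x) (fd T x u) + a (T x) (fd (\<lambda>y. fd T y v) x u)" for u v
  proof -
    have "fd (\<lambda>y. b y v) x u = fd (\<lambda>y. a (T y) (fd T y v)) x u"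
      by (rule fun_cong[OF fd_cong_open[OF S(1) \<open>x \<in> S\<close> b]])
    also have "\<dots> = fd (\<lambda>y. a (T y) (fd T x v)) x u + a (T x) (fd (\<lambda>y. fd T y v) x u)"
      by (rule fd_form_apply[OF S(1) \<open>x \<in> S\<close> aT]) (use smooth_on_fd[OF T] \<open>x \<in> S\<close> smooth_on_differentiable fd_works in blast)
    also have "fd (\<lambda>y. a (T y) (fd T x v)) x = (\<lambda>h. fd (\<lambda>z. a z (fd T x v)) (T x) (fd T x h))"
      by (rule fd_eqI[OF has_derivative_compose[OF dT fd_works[OF smooth_form_onD(3)[OF a Tx]]]])
    finally show ?thesis .
  qed
  moreover have "fd (\<lambda>y. fd T y v) x u = fd (\<lambda>y. fd T y u) x v"
    by (rule second_derivative_symmetric[OF S(1) \<open>x \<in> S\<close> T])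
  ultimately show ?thesis unfolding ed_def by simp
qed

text \<open>For constant fields no brackets occur, and the six second derivatives cancel in pairs by
  symmetry.\<close>

lemma ed_closed:
  assumes "open S" "x \<in> S" "smooth_form_on S a"
  shows "fd (\<lambda>z. ed a z v w) x u + fd (\<lambda>z. ed a z w u) x v + fd (\<lambda>z. ed a z u v) x w = 0"
proof -
  define d where "d = (\<lambda>v w u. fd (\<lambda>z. fd (\<lambda>y. a y w) z v) x u)"
  have sym: "d v w u = d u w v" for u v w
    unfolding d_def by (rule second_derivative_symmetric[OF assms(1,2) smooth_form_onD(2)[OF assms(3)]])
  have "fd (\<lambda>z. ed a z v w) x = (\<lambda>u. d v w u - d w v u)" for v w
    unfolding ed_def d_def
    by (intro fd_eqI has_derivative_diff fd_works
        smooth_on_differentiable[OF smooth_on_fd[OF smooth_form_onD(2)[OF assms(3)]] assms(2)])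
  then show ?thesis using sym[of v w u] sym[of w u v] sym[of w v u] by simp
qed

lemma ed_exact:
  assumes "open S" "x \<in> S" "smooth_on S f"
  shows "ed (\<lambda>z. fd f z) x u v = 0"
  unfolding ed_def using second_derivative_symmetric[OF assms] by simp

text \<open>The last term is \<open>a\<close> evaluated at the torsion of \<open>L\<close> on the constant fields \<open>X\<close>, \<open>Y\<close>.\<close>

lemma ed_recursion:
  assumes "open S" "x \<in> S" and a: "smooth_form_on S a" and L: "smooth_form_on S L"
    and b: "\<And>z v. b z v = a z (L z v)" and c: "\<And>z v. c z v = b z (L z v)"
  shows "ed c x X Y = ed b x (L x X) Y + ed b x X (L x Y) - ed a x (L x X) (L x Y)
    - a x (fd (\<lambda>z. L z Y) x (L x X) - fd (\<lambda>z. L z X) x (L x Y)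
        - L x (fd (\<lambda>z. L z Y) x X) + L x (fd (\<lambda>z. L z X) x Y))"
proof -
  have b_form: "smooth_form_on S b"
    using smooth_form_on_compose[OF assms(1) a L] b by (metis (no_types, lifting) ext)
  have dL: "((\<lambda>z. L z Y) has_derivative fd (\<lambda>z. L z Y) x) (at x)" for Y
    using smooth_form_onD(3)[OF L assms(2)] fd_works by blast
  have b': "fd (\<lambda>z. b z Y) x H = fd (\<lambda>z. a z (L x Y)) x H + a x (fd (\<lambda>z. L z Y) x H)" for Y H
    unfolding b by (rule fd_form_apply[OF assms(1,2) a dL])
  have c': "fd (\<lambda>z. c z Y) x H = fd (\<lambda>z. b z (L x Y)) x H + b x (fd (\<lambda>z. L z Y) x H)" for Y H
    unfolding c by (rule fd_form_apply[OF assms(1,2) b_form dL])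
  note lin = smooth_form_onD(1)[OF a assms(2)]
  show ?thesis
    unfolding ed_def c' b' unfolding b by (simp add: linear_add[OF lin] linear_diff[OF lin])
qed

section \<open>Linear symplectic algebra\<close>

text \<open>The value of d\<theta> in natural coordinates (see \<open>ed_fibre_form_id\<close>), the
  same at every point.\<close>

definition symplectic :: "'v::euclidean_space \<times> 'v \<Rightarrow> 'v \<times> 'v \<Rightarrow> real" where
  "symplectic Z V = snd Z \<bullet> fst V - snd V \<bullet> fst Z"

text \<open>The vector dual to a covector under \<open>symplectic\<close>; its components are read
  off from the values on vertical and horizontal basis vectors.\<close>

definition sharp :: "('v::euclidean_space \<times> 'v \<Rightarrow> real) \<Rightarrow> 'v \<times> 'v" where
  "sharp b = (- (\<Sum>e\<in>Basis. b (0, e) *\<^sub>R e), \<Sum>e\<in>Basis. b (e, 0) *\<^sub>R e)"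

lemma symplectic_antisym: "symplectic Z V = - symplectic V Z"
  by (simp add: symplectic_def)

lemma symplectic_linear: "linear (symplectic Z)" "linear (\<lambda>Z. symplectic Z V)"
  by (auto intro!: linearI simp: symplectic_def inner_add_left inner_add_right algebra_simps)

lemma bounded_bilinear_symplectic: "bounded_bilinear symplectic"
  by (simp add: bilinear_conv_bounded_bilinear[symmetric] bilinear_def symplectic_linear)

lemma symplectic_nondegenerate:
  assumes "\<And>V. symplectic Z V = symplectic Z' V"
  shows "Z = Z'"
proof (rule prod_eqI)
  show "fst Z = fst Z'"
    by (rule euclidean_eqI) (use assms[of "(0, _)"] in \<open>simp add: symplectic_def inner_commute\<close>)
  show "snd Z = snd Z'"
    by (rule euclidean_eqI) (use assms[of "(_, 0)"] in \<open>simp add: symplectic_def\<close>)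
qed

lemma symplectic_sharp:
  assumes "linear b"
  shows "symplectic (sharp b) V = b V"
proof -
  have 1: "linear (\<lambda>u. b (u, 0))" and 2: "linear (\<lambda>w. b (0, w))"
    using linear_compose[OF _ assms, of "\<lambda>u. (u, 0)"] linear_compose[OF _ assms, of "\<lambda>w. (0, w)"]
    by (simp_all add: o_def linear_conv_bounded_linear bounded_linear_Pair bounded_linear_ident bounded_linear_zero)
  have "b V = b ((fst V, 0) + (0, snd V))" by simp
  also have "\<dots> = b (fst V, 0) + b (0, snd V)" by (rule linear_add[OF assms])
  also have "b (fst V, 0) = (\<Sum>e\<in>Basis. (fst V \<bullet> e) *\<^sub>R b (e, 0))" by (rule linear_basis_expand[OF 1])
  also have "b (0, snd V) = (\<Sum>e\<in>Basis. (snd V \<bullet> e) *\<^sub>R b (0, e))" by (rule linear_basis_expand[OF 2])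
  finally show ?thesis
    by (simp add: symplectic_def sharp_def inner_sum_left inner_sum_right inner_commute mult.commute)
qed

text \<open>The forms become the components of one map. A nonzero vector orthogonal to its range
  would hold the coefficients of a linear relation between them.\<close>

lemma independent_forms_surj:
  fixes \<alpha> :: "nat \<Rightarrow> 'z::euclidean_space \<Rightarrow> real" and e :: "nat \<Rightarrow> 'y::euclidean_space"
  assumes lin: "\<And>k. k \<le> n \<Longrightarrow> linear (\<alpha> k)" and e: "bij_betw e {..n} Basis"
    and ind: "\<And>c :: nat \<Rightarrow> real. (\<And>v. (\<Sum>k\<le>n. c k * \<alpha> k v) = 0) \<Longrightarrow> \<forall>k\<le>n. c k = 0"
  shows "linear (\<lambda>v. \<Sum>k\<le>n. \<alpha> k v *\<^sub>R e k)" "surj (\<lambda>v. \<Sum>k\<le>n. \<alpha> k v *\<^sub>R e k)"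
    "(\<Sum>k\<le>n. \<alpha> k v *\<^sub>R e k) = 0 \<longleftrightarrow> (\<forall>k\<le>n. \<alpha> k v = 0)"
proof -
  let ?\<Lambda> = "\<lambda>v. \<Sum>k\<le>n. \<alpha> k v *\<^sub>R e k"
  show \<Lambda>: "linear ?\<Lambda>"
    by (intro linear_compose_sum ballI linearI) (simp_all add: linear_add[OF lin] linear_scale[OF lin] scaleR_add_left)
  have eB: "e k \<in> Basis" if "k \<le> n" for k using e that by (auto simp: bij_betw_def)
  show "surj ?\<Lambda>"
  proof (rule ccontr)
    assume "\<not> surj ?\<Lambda>"
    then have "span (range ?\<Lambda>) \<noteq> UNIV"
      unfolding span_eq_iff[THEN iffD2, OF linear_subspace_image[OF \<Lambda> subspace_UNIV]] .
    then have "dim (range ?\<Lambda>) < DIM('y)"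
      using dim_eq_full[of "range ?\<Lambda>"] dim_subset_UNIV[of "range ?\<Lambda>"] by linarith
    then obtain c where c: "c \<noteq> 0" "\<And>y. y \<in> span (range ?\<Lambda>) \<Longrightarrow> orthogonal c y"
      using orthogonal_to_subspace_exists by blast
    have "(\<Sum>k\<le>n. (c \<bullet> e k) * \<alpha> k v) = 0" for v
    proof -
      have "orthogonal c (?\<Lambda> v)" by (intro c(2) span_base rangeI)
      then show ?thesis by (simp add: orthogonal_def inner_sum_right mult.commute)
    qed
    then have *: "c \<bullet> e k = 0" if "k \<le> n" for k using ind[of "\<lambda>k. c \<bullet> e k"] that by blast
    have "c \<bullet> b = 0" if "b \<in> Basis" for b
    proof -
      have "b \<in> e ` {..n}" using that bij_betw_imp_surj_on[OF e] by (simp only:)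
      then show ?thesis using * by auto
    qed
    then show False using c(1) euclidean_all_zero_iff by blast
  qed
  have "?\<Lambda> v \<bullet> e j = \<alpha> j v" if j: "j \<le> n" for j
  proof -
    have "?\<Lambda> v \<bullet> e j = (\<Sum>k\<le>n. if k = j then \<alpha> k v else 0)"
      unfolding inner_sum_left
    proof (intro sum.cong refl)
      fix k assume "k \<in> {..n}"
      then have "e k = e j \<longleftrightarrow> k = j" using e j by (auto simp: bij_betw_def inj_on_def)
      then show "\<alpha> k v *\<^sub>R e k \<bullet> e j = (if k = j then \<alpha> k v else 0)"
        using eB[of k] eB[OF j] \<open>k \<in> {..n}\<close> by (simp add: inner_Basis)
    qed
    then show ?thesis using j by simp
  qed
  then show "?\<Lambda> v = 0 \<longleftrightarrow> (\<forall>k\<le>n. \<alpha> k v = 0)" by (metis (no_types, lifting) atMost_iff inner_zero_left scaleR_zero_left sum.neutral)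
qed

text \<open>With \<open>X\<close> dual to \<open>a\<close>, the vectors \<open>L\<^sup>k X\<close> are pairwise \<open>symplectic\<close>-orthogonal, so they lie in the common
  kernel, which they span for dimension reasons.\<close>

lemma lagrangian_kernel:
  fixes L :: "'v::euclidean_space \<times> 'v \<Rightarrow> 'v \<times> 'v" and a :: "'v \<times> 'v \<Rightarrow> real"
  assumes L: "linear L" "\<And>X Y. symplectic (L X) Y = symplectic X (L Y)" and a: "linear a" and n: "DIM('v) = n + 1"
    and ind: "\<And>c :: nat \<Rightarrow> real. (\<And>v. (\<Sum>k\<le>n. c k * a ((L ^^ k) v)) = 0) \<Longrightarrow> \<forall>k\<le>n. c k = 0"
    and v: "\<And>k. k \<le> n \<Longrightarrow> a ((L ^^ k) v) = 0"
  shows "a ((L ^^ m) v) = 0"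
proof -
  obtain e where e: "bij_betw e {..n} (Basis :: 'v set)"
    using finite_same_card_bij[of "{..n}" "Basis :: 'v set"] n by auto
  have pow_lin: "linear (L ^^ k)" for k
  proof (induction k)
    case 0 then show ?case by (simp add: linear_ident)
  next
    case (Suc k) then show ?case using linear_compose[OF Suc L(1)] by (simp add: o_def)
  qed
  have lin: "linear (\<lambda>v. a ((L ^^ k) v))" for k using linear_compose[OF pow_lin a] by (simp add: o_def)
  note \<Lambda> = independent_forms_surj[OF lin e ind]
  let ?\<Lambda> = "\<lambda>v. \<Sum>k\<le>n. a ((L ^^ k) v) *\<^sub>R e k"
  define X where "X = sharp a"
  have X: "symplectic X V = a V" for V unfolding X_def by (rule symplectic_sharp[OF a])
  have adj: "symplectic ((L ^^ k) Y) Z = symplectic Y ((L ^^ k) Z)" for k Y Z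
    by (induction k arbitrary: Y Z) (simp_all add: L(2) funpow_swap1)
  \<comment> \<open>With \<open>j + k\<close> as a single power, the value equals its own negative,
    because \<open>L\<close> is symmetric and \<open>symplectic\<close> antisymmetric.\<close>
  have iso: "a ((L ^^ j) ((L ^^ k) X)) = 0" for j k
  proof -
    have "symplectic X ((L ^^ m) X) = 0" for m using adj[of m X X] symplectic_antisym[of X "(L ^^ m) X"] by simp
    then show ?thesis unfolding X[symmetric] using funpow_add[of j k L] by (metis comp_apply)
  qed
  \<comment> \<open>The range of \<open>c\<close> is the span of the vectors
    \<open>(L ^^ k) X\<close>. By duality a relation among these vectors is one among the forms,
    whence injectivity.\<close>
  define c where "c = (\<lambda>w. \<Sum>k\<le>n. (w \<bullet> e k) *\<^sub>R (L ^^ k) X)"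
  have c: "linear c"
    unfolding c_def by (intro linear_compose_sum ballI linearI) (simp_all add: inner_add_left scaleR_add_left)
  have "inj c"
    unfolding linear_injective_0[OF c]
  proof (intro allI impI)
    fix w assume "c w = 0"
    then have "(\<Sum>k\<le>n. (w \<bullet> e k) * a ((L ^^ k) v)) = symplectic 0 v" for v
      unfolding \<open>c w = 0\<close>[symmetric] c_def
      by (simp add: linear_sum[OF symplectic_linear(2)] linear_scale[OF symplectic_linear(2)] adj X)
    then have *: "w \<bullet> e k = 0" if "k \<le> n" for k
      using ind[of "\<lambda>k. w \<bullet> e k"] that by (simp add: linear_0[OF symplectic_linear(2)])
    have "w \<bullet> b = 0" if "b \<in> Basis" for b
    proof -
      have "b \<in> e ` {..n}" using that bij_betw_imp_surj_on[OF e] by (simp only:)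
      then show ?thesis using * by auto
    qed
    then show "w = 0" using euclidean_all_zero_iff by blast
  qed
  then have "dim (range c) = DIM('v)" using dim_image_eq[OF c] by (simp add: inj_on_def)
  moreover have "dim {v. ?\<Lambda> v = 0} = DIM('v)" using dim_kernel_surj[OF \<Lambda>(1,2)] by simp
  \<comment> \<open>The power \<open>j\<close> is arbitrary here, which carries the vanishing beyond
    \<open>n\<close>.\<close>
  moreover have a_c: "a ((L ^^ j) (c w)) = 0" for j w
    unfolding c_def by (simp add: linear_sum[OF lin] linear_scale[OF lin] iso)
  then have "range c \<subseteq> {v. ?\<Lambda> v = 0}" by (auto simp: \<Lambda>(3))
  ultimately have "range c = {v. ?\<Lambda> v = 0}"
    using subspace_dim_equal[of "range c" "{v. ?\<Lambda> v = 0}"] linear_subspace_image[OF c subspace_UNIV]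
      linear_subspace_kernel[OF \<Lambda>(1)] by simp
  moreover have "v \<in> {v. ?\<Lambda> v = 0}" using v by (simp add: \<Lambda>(3))
  ultimately obtain w where "v = c w" by blast
  then show ?thesis using a_c by blast
qed

section \<open>The complete lift in one chart and its torsion\<close>

text \<open>The 1-form S^b_a p_b dx^a: the canonical form for S = id, its pull-back under the fibre
  map for S = R.\<close>

definition fibre_form :: "('v::euclidean_space \<Rightarrow> 'v \<Rightarrow> 'v) \<Rightarrow> 'v \<times> 'v \<Rightarrow> 'v \<times> 'v \<Rightarrow> real" where
  "fibre_form S z Z = snd z \<bullet> S (fst z) (fst Z)"

lemma smooth_on_fst_compose:
  fixes f :: "'v::euclidean_space \<Rightarrow> 'u::real_normed_vector"
  assumes "open U" "smooth_on U f"
  shows "smooth_on (U \<times> (UNIV :: 'w::euclidean_space set)) (\<lambda>z. f (fst z))"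
  by (rule smooth_on_compose[of _ U]) (auto intro!: open_Times assms smooth_on_bounded_linear bounded_linear_fst)

lemma smooth_on_snd: "open S \<Longrightarrow> smooth_on S snd"
  by (rule smooth_on_bounded_linear[OF _ bounded_linear_snd])

lemma smooth_form_on_fibre_form:
  assumes "open U" "smooth_form_on U S"
  shows "smooth_form_on (U \<times> UNIV) (fibre_form S)"
proof -
  have "linear (fibre_form S z)" if "z \<in> U \<times> UNIV" for z
  proof -
    have "linear (S (fst z))" using that smooth_form_onD(1)[OF assms(2)] by auto
    from linear_add[OF this] linear_scale[OF this] show ?thesis
      by (auto intro!: linearI simp: fibre_form_def inner_add_right)
  qed
  moreover have "smooth_on (U \<times> UNIV) (\<lambda>z. fibre_form S z Z)" for Z
    unfolding fibre_form_def
    by (intro smooth_on_inner smooth_on_snd open_Times assms open_UNIV smooth_on_fst_compose smooth_form_onD(2)[OF assms(2)])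
  ultimately show ?thesis unfolding smooth_form_on_def by blast
qed

lemma ed_fibre_form:
  assumes "open U" "smooth_form_on U S" "z \<in> U \<times> UNIV"
  shows "ed (fibre_form S) z Z V =
    snd z \<bullet> (fd (\<lambda>y. S y (fst V)) (fst z) (fst Z) - fd (\<lambda>y. S y (fst Z)) (fst z) (fst V))
    + snd Z \<bullet> S (fst z) (fst V) - snd V \<bullet> S (fst z) (fst Z)"
proof -
  have "((\<lambda>y. fibre_form S y V) has_derivative
      (\<lambda>H. snd z \<bullet> fd (\<lambda>y. S y (fst V)) (fst z) (fst H) + snd H \<bullet> S (fst z) (fst V))) (at z)" for V
  proof -
    have "((\<lambda>y. S y (fst V)) has_derivative fd (\<lambda>y. S y (fst V)) (fst z)) (at (fst z))"
      using assms(3) smooth_form_onD(3)[OF assms(2)] by (intro fd_works) auto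
    from has_derivative_compose[OF has_derivative_fst[OF has_derivative_ident] this]
    show ?thesis unfolding fibre_form_def by (auto intro!: derivative_eq_intros)
  qed
  then have "fd (\<lambda>y. fibre_form S y V) z H = snd z \<bullet> fd (\<lambda>y. S y (fst V)) (fst z) (fst H) + snd H \<bullet> S (fst z) (fst V)" for V H
    by (rule fun_cong[OF fd_eqI])
  then show ?thesis unfolding ed_def by (simp add: inner_diff_right)
qed

text \<open>The defining equation of the complete lift, solved explicitly:
  \<open>ed (fibre_form R)\<close> is the pulled-back 2-form, and \<open>sharp\<close> inverts the
  symplectic form.\<close>

definition lift_field :: "('v::euclidean_space \<Rightarrow> 'v \<Rightarrow> 'v) \<Rightarrow> 'v \<times> 'v \<Rightarrow> 'v \<times> 'v \<Rightarrow> 'v \<times> 'v" where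
  "lift_field R z Z = sharp (ed (fibre_form R) z Z)"

locale torsion_free_chart =
  fixes U :: "'v::euclidean_space set" and R :: "'v \<Rightarrow> 'v \<Rightarrow> 'v"
  assumes open_U: "open U" and smooth_R: "smooth_form_on U R"
    and torsion_R: "x \<in> U \<Longrightarrow> nijenhuis R (\<lambda>_. u) (\<lambda>_. v) x = 0"
begin

abbreviation "\<C> \<equiv> U \<times> (UNIV :: 'v set)"
abbreviation "\<omega>1 \<equiv> ed (fibre_form R)"
abbreviation "L \<equiv> lift_field R"

lemma open_cotangent: "open \<C>" by (simp add: open_Times open_U)

lemma smooth_fibre_form: "smooth_form_on \<C> (fibre_form R)"
  by (rule smooth_form_on_fibre_form[OF open_U smooth_R])

lemma symplectic_lift: "z \<in> \<C> \<Longrightarrow> symplectic (L z Z) V = \<omega>1 z Z V"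
  unfolding lift_field_def by (rule symplectic_sharp[OF ed_linear(1)[OF open_cotangent _ smooth_fibre_form]])

text \<open>\<open>symplectic\<close> and \<open>\<omega>1\<close> are both antisymmetric.\<close>

lemma symplectic_lift_adjoint: "z \<in> \<C> \<Longrightarrow> symplectic (L z Z) V = symplectic Z (L z V)"
  using symplectic_lift ed_antisym symplectic_antisym by metis

lemma smooth_lift: "smooth_form_on \<C> L"
  unfolding smooth_form_on_def
proof (intro conjI ballI allI)
  fix z assume z: "z \<in> \<C>"
  show "linear (L z)"
  proof (rule linearI)
    fix X Y c
    show "L z (X + Y) = L z X + L z Y" "L z (c *\<^sub>R X) = c *\<^sub>R L z X"
      by (rule symplectic_nondegenerate, simp only: symplectic_lift[OF z] linear_add[OF symplectic_linear(2)] linear_scale[OF symplectic_linear(2)]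
          linear_add[OF ed_linear(2)[OF open_cotangent z smooth_fibre_form]] linear_scale[OF ed_linear(2)[OF open_cotangent z smooth_fibre_form]])+
  qed
next
  fix Z
  have "smooth_on \<C> (\<lambda>z. \<omega>1 z Z V)" for V
    using smooth_form_onD(2)[OF smooth_form_on_ed(1)[OF open_cotangent smooth_fibre_form]] by blast
  then have "smooth_on \<C> (\<lambda>z. (\<Sum>e\<in>Basis. \<omega>1 z Z (h e) *\<^sub>R e))" for h :: "'v \<Rightarrow> 'v \<times> 'v"
    by (intro smooth_on_sum open_cotangent smooth_on_scaleR smooth_on_const)
  then show "smooth_on \<C> (\<lambda>z. L z Z)"
    unfolding lift_field_def sharp_def
    by (intro smooth_on_Pair open_cotangent smooth_on_bounded_linear_comp[OF open_cotangent bounded_linear_minus[OF bounded_linear_ident]])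
qed

text \<open>Pairing with a vertical vector \<open>(0, b)\<close> removes the derivatives of
  \<open>R\<close> and leaves the base component: the lift projects to \<open>R\<close>.\<close>

lemma fst_lift: "z \<in> \<C> \<Longrightarrow> fst (L z Z) = R (fst z) (fst Z)"
proof (rule euclidean_eqI)
  fix b :: 'v assume z: "z \<in> \<C>"
  have "linear (R (fst z))" using z smooth_form_onD(1)[OF smooth_R] by auto
  moreover have "linear (fd (\<lambda>y. R y (fst Z)) (fst z))"
    using z linear_fd_form_direction[OF _ smooth_R] by auto
  moreover have "linear (\<lambda>w. fd (\<lambda>y. R y w) (fst z) (fst Z))"
    using z linear_fd_form[OF open_U _ smooth_R] by auto
  ultimately have "R (fst z) 0 = 0" "fd (\<lambda>y. R y (fst Z)) (fst z) 0 = 0" "fd (\<lambda>y. R y 0) (fst z) (fst Z) = 0"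
    using linear_0 by blast+
  then have "\<omega>1 z Z (0, b) = - (b \<bullet> R (fst z) (fst Z))"
    unfolding ed_fibre_form[OF open_U smooth_R z] by simp
  then show "fst (L z Z) \<bullet> b = R (fst z) (fst Z) \<bullet> b"
    using symplectic_lift[OF z, of Z "(0, b)"] by (simp add: symplectic_def inner_commute)
qed

lemma smooth_R2: "smooth_form_on U (\<lambda>x v. R x (R x v))"
  by (rule smooth_form_on_compose[OF open_U smooth_R smooth_R])

text \<open>The torsion of \<open>R\<close> enters here: its vanishing matches the derivative terms
  on the two sides, so that the square of the lift is the lift of the square.\<close>

lemma symplectic_lift_lift:
  assumes z: "z \<in> \<C>"
  shows "symplectic (L z (L z Z)) V = ed (fibre_form (\<lambda>x v. R x (R x v))) z Z V"
proof -
  obtain x p where xp: "z = (x, p)" "x \<in> U" using z by auto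
  define u where "u = fst Z"
  define v where "v = fst V"
  define D where "D = (\<lambda>h w. fd (\<lambda>y. R y w) x h)"
  have dR: "((\<lambda>y. R y w) has_derivative (\<lambda>h. D h w)) (at x)" for w
    unfolding D_def using smooth_form_onD(3)[OF smooth_R xp(2)] fd_works by blast
  have R0: "R x 0 = 0" and D0: "D h 0 = 0" for h
    using linear_0[OF smooth_form_onD(1)[OF smooth_R xp(2)]] linear_0[OF linear_fd_form[OF open_U xp(2) smooth_R]]
    unfolding D_def by auto
  have "nijenhuis R (\<lambda>_. u) (\<lambda>_. v) x = D (R x u) v - D (R x v) u + R x (D v u) - R x (D u v)"
    using linear_neg[OF smooth_form_onD(1)[OF smooth_R xp(2)]]
    unfolding nijenhuis_def lie_bracket_def D_def
    by (simp add: R0)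
  then have N: "D (R x u) v - D (R x v) u = R x (D u v) - R x (D v u)"
    using torsion_R[OF xp(2)] by (simp add: algebra_simps)
  have dR2: "fd (\<lambda>y. R y (R y w)) x h = D h (R x w) + R x (D h w)" for w h
    unfolding D_def by (rule fd_form_apply[OF open_U xp(2) smooth_R dR[unfolded D_def]])
  have e1: "\<omega>1 z X Y = p \<bullet> (D (fst X) (fst Y) - D (fst Y) (fst X)) + snd X \<bullet> R x (fst Y) - snd Y \<bullet> R x (fst X)" for X Y
    unfolding ed_fibre_form[OF open_U smooth_R z] by (simp add: xp D_def)
  have fL: "fst (L z Z) = R x u" using fst_lift[OF z] by (simp add: xp u_def)
  \<comment> \<open>The vertical component of \<open>L z Z\<close> is needed only against
    \<open>R x v\<close>, and pairing with the horizontal vector \<open>(R x v, 0)\<close> gives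
    it.\<close>
  have "snd (L z Z) \<bullet> R x v = symplectic (L z Z) (R x v, 0)" by (simp add: symplectic_def)
  also have "\<dots> = p \<bullet> (D u (R x v) - D (R x v) u) + snd Z \<bullet> R x (R x v)"
    unfolding symplectic_lift[OF z] e1 by (simp add: u_def)
  finally have sL: "snd (L z Z) \<bullet> R x v = p \<bullet> (D u (R x v) - D (R x v) u) + snd Z \<bullet> R x (R x v)" .
  have "symplectic (L z (L z Z)) V = p \<bullet> (D (R x u) v - D v (R x u)) + snd (L z Z) \<bullet> R x v - snd V \<bullet> R x (R x u)"
    unfolding symplectic_lift[OF z] e1 fL by (simp add: v_def)
  also have "\<dots> = p \<bullet> ((D (R x u) v - D (R x v) u) + D u (R x v) - D v (R x u))
      + snd Z \<bullet> R x (R x v) - snd V \<bullet> R x (R x u)"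
    unfolding sL by (simp add: inner_diff_right inner_add_right)
  also have "\<dots> = ed (fibre_form (\<lambda>x v. R x (R x v))) z Z V"
    unfolding ed_fibre_form[OF open_U smooth_R2 z] N using dR2
    by (simp add: xp u_def v_def inner_diff_right inner_add_right)
  finally show ?thesis .
qed

text \<open>The 2-forms \<open>symplectic (L X) Y\<close> and \<open>symplectic (L (L X)) Y\<close> are exact, and the torsion of \<open>L\<close> is
  expressed by their exterior derivatives.\<close>

lemma torsion_lift:
  assumes z: "z \<in> \<C>"
  shows "fd (\<lambda>y. L y Y) z (L z X) - fd (\<lambda>y. L y X) z (L z Y)
      - L z (fd (\<lambda>y. L y Y) z X) + L z (fd (\<lambda>y. L y X) z Y) = 0" (is "?N = 0")
proof (rule symplectic_nondegenerate)
  fix Z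
  define e where "e = (\<lambda>H Y Z. fd (\<lambda>y. \<omega>1 y Y Z) z H)"
  have anti: "e H Y Z = - e H Z Y" for H Y Z
  proof -
    have "((\<lambda>y. \<omega>1 y Z Y) has_derivative (\<lambda>H. e H Z Y)) (at z)"
      unfolding e_def using fd_works[OF smooth_form_onD(3)[OF smooth_form_on_ed(1)[OF open_cotangent smooth_fibre_form] z]] by blast
    then have "((\<lambda>y. - \<omega>1 y Z Y) has_derivative (\<lambda>H. - e H Z Y)) (at z)" by (rule has_derivative_minus)
    then show ?thesis unfolding e_def ed_antisym[of "fibre_form R" _ Y Z] by (simp add: fd_eqI)
  qed
  have closed1: "e X Y Z + e Y Z X + e Z X Y = 0" for X Y Z
    unfolding e_def by (rule ed_closed[OF open_cotangent z smooth_fibre_form])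
  have dL: "((\<lambda>y. L y Y) has_derivative fd (\<lambda>y. L y Y) z) (at z)" for Y
    using smooth_form_onD(3)[OF smooth_lift z] fd_works by blast
  have sL: "symplectic (fd (\<lambda>y. L y Y) z H) Z = e H Y Z" for H Y Z
  proof -
    have "((\<lambda>y. symplectic (L y Y) Z) has_derivative (\<lambda>H. symplectic (fd (\<lambda>y. L y Y) z H) Z)) (at z)"
      by (rule bounded_linear.has_derivative[OF bounded_bilinear.bounded_linear_left[OF bounded_bilinear_symplectic] dL])
    then have "((\<lambda>y. \<omega>1 y Y Z) has_derivative (\<lambda>H. symplectic (fd (\<lambda>y. L y Y) z H) Z)) (at z)"
      by (subst has_derivative_cong_open[OF open_cotangent z, where g = "\<lambda>y. symplectic (L y Y) Z"])
        (simp_all add: symplectic_lift)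
    then show ?thesis unfolding e_def by (simp add: fd_eqI)
  qed
  let ?\<omega>2 = "ed (fibre_form (\<lambda>x v. R x (R x v)))"
  \<comment> \<open>The second 2-form is \<open>\<omega>1\<close> with \<open>L\<close> in one slot.
    The term that differentiates \<open>L\<close> has \<open>L\<close> moved to the other slot by
    symmetry.\<close>
  have d2: "fd (\<lambda>y. ?\<omega>2 y Y Z) z H = e H (L z Y) Z + e H Y (L z Z)" for H Y Z
  proof -
    have "fd (\<lambda>y. ?\<omega>2 y Y Z) z H = fd (\<lambda>y. \<omega>1 y (L y Y) Z) z H"
      by (rule fun_cong[OF fd_cong_open[OF open_cotangent z]]) (simp add: symplectic_lift_lift[symmetric] symplectic_lift)
    also have "\<dots> = fd (\<lambda>y. \<omega>1 y (L z Y) Z) z H + \<omega>1 z (fd (\<lambda>y. L y Y) z H) Z"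
      by (rule fd_form_apply[OF open_cotangent z smooth_form_on_ed(2)[OF open_cotangent smooth_fibre_form] dL])
    also have "\<omega>1 z (fd (\<lambda>y. L y Y) z H) Z = e H Y (L z Z)"
      using symplectic_lift[OF z] symplectic_lift_adjoint[OF z] sL by metis
    finally show ?thesis by (simp add: e_def)
  qed
  have closed2: "fd (\<lambda>y. ?\<omega>2 y Y Z) z X + fd (\<lambda>y. ?\<omega>2 y Z X) z Y + fd (\<lambda>y. ?\<omega>2 y X Y) z Z = 0"
    by (rule ed_closed[OF open_cotangent z smooth_form_on_fibre_form[OF open_U smooth_R2]])
  have "symplectic ?N Z = e (L z X) Y Z - e (L z Y) X Z - e X Y (L z Z) + e Y X (L z Z)"
    by (simp only: linear_add[OF symplectic_linear(2)] linear_diff[OF symplectic_linear(2)] sL symplectic_lift_adjoint[OF z])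
  \<comment> \<open>The terms of \<open>closed2\<close> in which \<open>L\<close> acts on
    \<open>X\<close> or \<open>Y\<close> are eliminated with \<open>closed1\<close>; antisymmetry in
    the last two arguments of \<open>e\<close> does the rest.\<close>
  also have "\<dots> = 0"
    using closed2[unfolded d2] closed1[of "L z X" Y Z] closed1[of X "L z Y" Z] closed1[of X Y "L z Z"]
      anti[of "L z Y" X Z] anti[of X Y "L z Z"] anti[of Y X "L z Z"] by linarith
  finally show "symplectic ?N Z = symplectic 0 Z" by (simp add: linear_0[OF symplectic_linear(2)])
qed

lemma smooth_iterates:
  assumes "smooth_form_on \<C> (a :: _ \<Rightarrow> _ \<Rightarrow> real)"
  shows "smooth_form_on \<C> (\<lambda>z v. a z ((L z ^^ k) v))"
proof (induction k)
  case 0 then show ?case using assms by simp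
next
  case (Suc k)
  then show ?case using smooth_form_on_compose[OF open_cotangent Suc smooth_lift]
    by (simp add: funpow_swap1)
qed

text \<open>The recursion goes back two indices, so the induction carries two consecutive ones. Its
  right-hand side stays on the kernel because \<open>L\<close> preserves it.\<close>

lemma iterates_closed_on_kernel:
  assumes f: "smooth_on \<C> f" and n: "DIM('v) = n + 1"
    and ind: "\<And>z (c :: nat \<Rightarrow> real). z \<in> \<C> \<Longrightarrow> (\<And>v. (\<Sum>k\<le>n. c k * fd f z ((L z ^^ k) v)) = 0) \<Longrightarrow> \<forall>k\<le>n. c k = 0"
    and closed1: "\<And>z u v. z \<in> \<C> \<Longrightarrow> (\<And>k. k \<le> n \<Longrightarrow> fd f z ((L z ^^ k) u) = 0) \<Longrightarrow>
      (\<And>k. k \<le> n \<Longrightarrow> fd f z ((L z ^^ k) v) = 0) \<Longrightarrow> ed (\<lambda>z v. fd f z (L z v)) z u v = 0"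
    and z: "z \<in> \<C>" and u: "\<And>k. k \<le> n \<Longrightarrow> fd f z ((L z ^^ k) u) = 0"
    and v: "\<And>k. k \<le> n \<Longrightarrow> fd f z ((L z ^^ k) v) = 0"
  shows "ed (\<lambda>z v. fd f z ((L z ^^ m) v)) z u v = 0"
proof -
  define \<alpha> where "\<alpha> = (\<lambda>k z v. fd f z ((L z ^^ k) v))"
  define D where "D = {v. \<forall>k\<le>n. \<alpha> k z v = 0}"
  have "linear (fd f z)" using fd_linear smooth_on_differentiable[OF f z] by blast
  then have D_all: "\<alpha> m z v = 0" if "v \<in> D" for m v
    unfolding \<alpha>_def
    using lagrangian_kernel[OF smooth_form_onD(1)[OF smooth_lift z] symplectic_lift_adjoint[OF z] _ n ind[OF z]] that
    by (simp add: D_def \<alpha>_def)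
  have shift: "\<alpha> (Suc k) y v = \<alpha> k y (L y v)" for k y v by (simp add: \<alpha>_def funpow_swap1)
  \<comment> \<open>For \<open>k = n\<close> this needs the form of index \<open>n + 1\<close>,
    which is not among those defining \<open>D\<close>; \<open>D_all\<close> supplies it.\<close>
  have D_inv: "L z v \<in> D" if "v \<in> D" for v
    using D_all[OF that] unfolding D_def by (simp add: shift[symmetric])
  have "smooth_form_on \<C> (\<lambda>z. fd f z)"
    unfolding smooth_form_on_def using f smooth_on_fd smooth_on_differentiable fd_linear by blast
  then have \<alpha>_smooth: "smooth_form_on \<C> (\<alpha> k)" for k
    unfolding \<alpha>_def by (rule smooth_iterates)
  have "\<forall>u\<in>D. \<forall>v\<in>D. ed (\<alpha> m) z u v = 0 \<and> ed (\<alpha> (Suc m)) z u v = 0" for m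
  proof (induction m)
    case 0
    have "\<alpha> 0 = (\<lambda>z. fd f z)" "\<alpha> (Suc 0) = (\<lambda>z v. fd f z (L z v))" by (simp_all add: \<alpha>_def)
    then show ?case using ed_exact[OF open_cotangent z f] closed1[OF z] by (simp add: D_def \<alpha>_def)
  next
    case (Suc m)
    have "ed (\<alpha> (Suc (Suc m))) z u v = 0" if "u \<in> D" "v \<in> D" for u v
    proof -
      have "ed (\<alpha> (Suc (Suc m))) z u v = ed (\<alpha> (Suc m)) z (L z u) v + ed (\<alpha> (Suc m)) z u (L z v) - ed (\<alpha> m) z (L z u) (L z v)
          - \<alpha> m z 0"
        \<comment> \<open>The zero vector in the last term is replaced by the torsion expression
          that \<open>ed_recursion\<close> produces.\<close>
        unfolding torsion_lift[OF z, of v u, symmetric]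
        by (rule ed_recursion[OF open_cotangent z \<alpha>_smooth smooth_lift]) (simp_all add: shift)
      then show ?thesis using Suc that D_inv linear_0[OF smooth_form_onD(1)[OF \<alpha>_smooth z]] by simp
    qed
    then show ?case using Suc by blast
  qed
  moreover have "u \<in> D" "v \<in> D" using u v by (simp_all add: D_def \<alpha>_def)
  ultimately show ?thesis unfolding \<alpha>_def by blast
qed

end

section \<open>Changes of natural coordinates\<close>

text \<open>The chart conditions alone, so that the same lemmas serve \<open>E\<close> and its
  cotangent bundle.\<close>

definition smooth_atlas :: "('i, 'a, 'v::euclidean_space) manifold \<Rightarrow> bool" where
  "smooth_atlas M \<longleftrightarrow>
     (\<forall>i\<in>charts M. inj_on (coord M i) (chart_dom M i) \<and> open (chart_img M i)) \<and>
     (\<forall>i\<in>charts M. \<forall>j\<in>charts M. open (overlap M i j) \<and> smooth_on (overlap M i j) (transition M i j))"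

lemma overlap_subset: "overlap M i j \<subseteq> chart_img M i"
  by (auto simp: overlap_def chart_img_def)

lemma atlas_param:
  assumes "smooth_atlas M" "i \<in> charts M"
  shows "e \<in> chart_dom M i \<Longrightarrow> param M i (coord M i e) = e"
    and "x \<in> chart_img M i \<Longrightarrow> param M i x \<in> chart_dom M i"
    and "x \<in> chart_img M i \<Longrightarrow> coord M i (param M i x) = x"
  using assms unfolding smooth_atlas_def param_def chart_img_def
  by (auto intro: inv_into_into f_inv_into_f)

lemma atlas_overlap_iff:
  assumes "smooth_atlas M" "i \<in> charts M" "x \<in> chart_img M i"
  shows "x \<in> overlap M i j \<longleftrightarrow> param M i x \<in> chart_dom M j"
  using atlas_param[OF assms(1,2)] assms(3) unfolding overlap_def
  by (auto simp: image_iff intro!: bexI[of _ "param M i x"])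

lemma atlas_transition_coord:
  assumes "smooth_atlas M" "i \<in> charts M" "e \<in> chart_dom M i"
  shows "transition M i j (coord M i e) = coord M j e"
  using atlas_param(1)[OF assms] by (simp add: transition_def)

lemma atlas_transition:
  assumes "smooth_atlas M" "i \<in> charts M" "j \<in> charts M" "x \<in> overlap M i j"
  shows "transition M i j x \<in> overlap M j i" "transition M j i (transition M i j x) = x"
    "fd (transition M j i) (transition M i j x) (fd (transition M i j) x v) = v"
    "transition M i j differentiable (at x)"
proof -
  have in_img: "transition M i j x \<in> overlap M j i" "transition M j i (transition M i j x) = x"
    if "x \<in> overlap M i j" for x
    using that atlas_transition_coord[OF assms(1,2)] atlas_transition_coord[OF assms(1,3)]
    by (auto simp: overlap_def)
  then show "transition M i j x \<in> overlap M j i" "transition M j i (transition M i j x) = x" using assms(4) by auto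
  have o: "open (overlap M i j)" "smooth_on (overlap M i j) (transition M i j)" "smooth_on (overlap M j i) (transition M j i)"
    using assms unfolding smooth_atlas_def by auto
  show d: "transition M i j differentiable (at x)" by (rule smooth_on_differentiable[OF o(2) assms(4)])
  have "((\<lambda>x. transition M j i (transition M i j x)) has_derivative
      (\<lambda>v. fd (transition M j i) (transition M i j x) (fd (transition M i j) x v))) (at x)"
    by (rule has_derivative_compose[OF fd_works[OF d] fd_works[OF smooth_on_differentiable[OF o(3) in_img(1)[OF assms(4)]]]])
  moreover have "((\<lambda>x. transition M j i (transition M i j x)) has_derivative (\<lambda>v. v)) (at x)"
    by (subst has_derivative_cong_open[OF o(1) assms(4) in_img(2)]) auto
  ultimately show "fd (transition M j i) (transition M i j x) (fd (transition M i j) x v) = v"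
    using has_derivative_unique by metis
qed

text \<open>The chain rule on a triple overlap. It provides the consistency for extending one
  covector component to all charts.\<close>

lemma atlas_cocycle:
  assumes M: "smooth_atlas M" and i: "i \<in> charts M" and j: "j \<in> charts M" and k: "k \<in> charts M"
    and e: "e \<in> chart_dom M i" "e \<in> chart_dom M j" "e \<in> chart_dom M k"
  shows "fd (transition M i k) (coord M i e) v =
    fd (transition M j k) (coord M j e) (fd (transition M i j) (coord M i e) v)"
proof -
  define S where "S = overlap M i j \<inter> overlap M i k"
  have "open S" using M i j k unfolding S_def smooth_atlas_def by auto
  have xS: "coord M i e \<in> S" using e by (auto simp: S_def overlap_def)
  have eq: "transition M i k x = transition M j k (transition M i j x)" if "x \<in> S" for x
  proof -
    have x: "x \<in> chart_img M i" using that overlap_subset[of M i j] unfolding S_def by blast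
    then have "param M i x \<in> chart_dom M j" "param M i x \<in> chart_dom M k"
      using that atlas_overlap_iff[OF M i x] unfolding S_def by auto
    then show ?thesis
      using atlas_param(1)[OF M j] by (simp add: transition_def)
  qed
  have "coord M j e \<in> overlap M j k" using e by (auto simp: overlap_def)
  note djk = fd_works[OF atlas_transition(4)[OF M j k this]]
  have "coord M i e \<in> overlap M i j" using xS by (simp add: S_def)
  note dij = fd_works[OF atlas_transition(4)[OF M i j this]]
  have "fd (transition M i k) (coord M i e) = fd (\<lambda>x. transition M j k (transition M i j x)) (coord M i e)"
    by (rule fd_cong_open[OF \<open>open S\<close> xS eq])
  also have "\<dots> = (\<lambda>v. fd (transition M j k) (coord M j e) (fd (transition M i j) (coord M i e) v))"
    using has_derivative_compose[OF dij, of "transition M j k"] djk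
    unfolding atlas_transition_coord[OF M i e(1), of j] by (intro fd_eqI) blast
  finally show ?thesis by simp
qed

section \<open>The atlas of the cotangent bundle\<close>

lemma cotangent_bundle_simps [simp]:
  "points (cotangent_bundle E) = {(e, p). e \<in> points E \<and> p \<in> covectors E e}"
  "charts (cotangent_bundle E) = charts E"
  "chart_dom (cotangent_bundle E) i = {(e, p). e \<in> chart_dom E i \<and> p \<in> covectors E e}"
  "coord (cotangent_bundle E) i (e, p) = (coord E i e, p i)"
  by (simp_all add: cotangent_bundle_def)

lemma adjoint_eqI:
  fixes f :: "'v::euclidean_space \<Rightarrow> 'w::euclidean_space"
  assumes "linear f" "\<And>v. q \<bullet> v = p \<bullet> f v"
  shows "q = adjoint f p"
  by (rule euclidean_eqI) (simp add: adjoint_clauses[OF assms(1)] assms(2))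

text \<open>Expanded in an orthonormal basis, the adjoint involves \<open>S\<close> only through its
  values on fixed vectors.\<close>

lemma smooth_on_adjoint:
  assumes "open U" "smooth_form_on U S"
  shows "smooth_on (U \<times> UNIV) (\<lambda>z. adjoint (S (fst z)) (snd z))"
proof -
  have o: "open (U \<times> UNIV)" by (simp add: open_Times assms(1))
  have *: "smooth_on (U \<times> UNIV) (\<lambda>z. \<Sum>b\<in>Basis. (snd z \<bullet> S (fst z) b) *\<^sub>R b)"
    by (intro smooth_on_sum smooth_on_scaleR smooth_on_inner smooth_on_const smooth_on_snd o
        smooth_on_fst_compose[OF assms(1)] smooth_form_onD(2)[OF assms(2)])
  have **: "(\<Sum>b\<in>Basis. (snd z \<bullet> S (fst z) b) *\<^sub>R b) = adjoint (S (fst z)) (snd z)" if "z \<in> U \<times> UNIV" for z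
  proof -
    have "linear (S (fst z))" using that smooth_form_onD(1)[OF assms(2)] by auto
    then show ?thesis
      by (subst (2) euclidean_representation[symmetric]) (simp add: adjoint_clauses)
  qed
  show ?thesis by (rule iffD1[OF smooth_on_cong[OF o] *]) (rule **)
qed

locale cotangent_atlas =
  fixes E :: "('i, 'a, 'v::euclidean_space) manifold"
  assumes E: "smooth_atlas E"
begin

abbreviation "tr \<equiv> transition E"
abbreviation "M \<equiv> cotangent_bundle E"

lemma linear_fd_tr: "i \<in> charts E \<Longrightarrow> j \<in> charts E \<Longrightarrow> x \<in> overlap E i j \<Longrightarrow> linear (fd (tr i j) x)"
  using atlas_transition(4)[OF E] fd_linear by blast

lemma covectorsD:
  assumes "p \<in> covectors E e" "i \<in> charts E" "j \<in> charts E" "e \<in> chart_dom E i" "e \<in> chart_dom E j"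
  shows "p i \<bullet> v = p j \<bullet> fd (tr i j) (coord E i e) v"
  using assms unfolding covectors_def by blast

lemma covector_component:
  assumes "p \<in> covectors E e" "i \<in> charts E" "j \<in> charts E" "e \<in> chart_dom E i" "e \<in> chart_dom E j"
  shows "p j = adjoint (fd (tr j i) (coord E j e)) (p i)"
  using assms covectorsD[OF assms(1,3,2,5,4)]
  by (intro adjoint_eqI linear_fd_tr) (auto simp: overlap_def)

text \<open>A covector is a family over all charts: the transformation law defines the other
  components, and the cocycle identity makes them compatible. Hence the momenta fill the whole model
  space in each chart.\<close>

lemma covector_exists:
  assumes i: "i \<in> charts E" and e: "e \<in> chart_dom E i"
  obtains p where "p \<in> covectors E e" "p i = q"
proof -
  define p where "p = (\<lambda>j. if j \<in> charts E \<and> e \<in> chart_dom E j then adjoint (fd (tr j i) (coord E j e)) q else 0)"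
  have p: "p j \<bullet> v = q \<bullet> fd (tr j i) (coord E j e) v" if "j \<in> charts E" "e \<in> chart_dom E j" for j v
  proof -
    have "linear (fd (tr j i) (coord E j e))" using that i e by (intro linear_fd_tr) (auto simp: overlap_def)
    then show ?thesis using that by (simp add: p_def adjoint_clauses)
  qed
  have "p \<in> covectors E e"
    unfolding covectors_def
  proof (intro CollectI conjI ballI allI impI)
    fix j k v assume jk: "j \<in> charts E" "k \<in> charts E" "e \<in> chart_dom E j \<inter> chart_dom E k"
    then show "p j \<bullet> v = p k \<bullet> fd (tr j k) (coord E j e) v"
      using p[of j] p[of k] atlas_cocycle[OF E jk(1,2) i _ _ e] by simp
  qed (auto simp: p_def)
  \<comment> \<open>The derivative of the transition from chart \<open>i\<close> to itself is both
    involutive and idempotent, hence the identity.\<close>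
  moreover have "p i = q"
  proof (rule vector_eq_ldot[THEN iffD1, rule_format])
    fix v
    have x: "coord E i e \<in> overlap E i i" using e by (auto simp: overlap_def)
    have "fd (tr i i) (coord E i e) (fd (tr i i) (coord E i e) v) = v"
      using atlas_transition(3)[OF E i i x] atlas_transition_coord[OF E i e] by simp
    moreover have "fd (tr i i) (coord E i e) v = fd (tr i i) (coord E i e) (fd (tr i i) (coord E i e) v)"
      by (rule atlas_cocycle[OF E i i i e e e])
    ultimately show "v \<bullet> p i = v \<bullet> q" using p[OF i e, of v] by (simp add: inner_commute)
  qed
  ultimately show ?thesis using that by blast
qed

lemma chart_img_cotangent: "i \<in> charts E \<Longrightarrow> chart_img M i = chart_img E i \<times> UNIV"
proof -
  assume i: "i \<in> charts E"
  have "(coord E i e, q) \<in> chart_img M i" if e: "e \<in> chart_dom E i" for e q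
  proof -
    obtain p where "p \<in> covectors E e" "p i = q" using covector_exists[OF i e] by blast
    then show ?thesis using e unfolding chart_img_def by (intro image_eqI[of _ _ "(e, p)"]) auto
  qed
  then show ?thesis by (auto simp: chart_img_def)
qed

lemma overlap_cotangent: "i \<in> charts E \<Longrightarrow> overlap M i j = overlap E i j \<times> UNIV"
proof -
  assume i: "i \<in> charts E"
  have "(coord E i e, q) \<in> overlap M i j" if e: "e \<in> chart_dom E i" "e \<in> chart_dom E j" for e q
  proof -
    obtain p where "p \<in> covectors E e" "p i = q" using covector_exists[OF i e(1)] by blast
    then show ?thesis using e unfolding overlap_def by (intro image_eqI[of _ _ "(e, p)"]) auto
  qed
  then show ?thesis by (auto simp: overlap_def)
qed

text \<open>One component determines those in all charts around the point, and the remaining entries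
  are normalized to 0.\<close>

lemma inj_on_coord_cotangent: "i \<in> charts E \<Longrightarrow> inj_on (coord M i) (chart_dom M i)"
proof (rule inj_onI, clarsimp)
  fix e p e' p'
  assume i: "i \<in> charts E" and e: "e \<in> chart_dom E i" "p \<in> covectors E e"
    and e': "e' \<in> chart_dom E i" "p' \<in> covectors E e'" and eq: "coord E i e = coord E i e'" "p i = p' i"
  have "e = e'" using eq(1) e(1) e'(1) i E unfolding smooth_atlas_def inj_on_def by blast
  moreover have "p j = p' j" for j
  proof (cases "j \<in> charts E \<and> e \<in> chart_dom E j")
    case True
    then show ?thesis
      using covector_component[OF e(2) i _ e(1), of j] covector_component[OF e'(2) i _ e'(1), of j] eq \<open>e = e'\<close> by simp
  next
    case False
    then show ?thesis using e(2) e'(2) \<open>e = e'\<close> unfolding covectors_def by auto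
  qed
  ultimately show "e = e' \<and> p = p'" by blast
qed

text \<open>Momenta change by the inverse transposed Jacobian, the inverse being taken as the
  derivative of the opposite transition.\<close>

definition cot_tr :: "'i \<Rightarrow> 'i \<Rightarrow> 'v \<times> 'v \<Rightarrow> 'v \<times> 'v" where
  "cot_tr i j z = (tr i j (fst z), adjoint (fd (tr j i) (tr i j (fst z))) (snd z))"

lemma transition_cotangent:
  assumes i: "i \<in> charts E" and j: "j \<in> charts E" and z: "z \<in> overlap M i j"
  shows "transition M i j z = cot_tr i j z"
proof -
  obtain e p where ep: "e \<in> chart_dom E i" "e \<in> chart_dom E j" "p \<in> covectors E e" "z = (coord E i e, p i)"
    using z unfolding overlap_def by auto
  have "transition M i j z = (coord E j e, p j)"
    unfolding transition_def param_def ep(4)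
    using inv_into_f_f[OF inj_on_coord_cotangent[OF i], of "(e, p)"] ep by simp
  then show ?thesis
    unfolding cot_tr_def ep(4) using covector_component[OF ep(3) i j ep(1,2)] atlas_transition_coord[OF E i ep(1)] by simp
qed

lemma smooth_cot_tr:
  assumes i: "i \<in> charts E" and j: "j \<in> charts E"
  shows "smooth_on (overlap M i j) (cot_tr i j)"
proof -
  have o: "open (overlap E i j)" "open (overlap E j i)" "smooth_on (overlap E i j) (tr i j)" "smooth_on (overlap E j i) (tr j i)"
    using E i j unfolding smooth_atlas_def by auto
  have img: "tr i j ` overlap E i j \<subseteq> overlap E j i" using atlas_transition(1)[OF E i j] by blast
  have oM: "open (overlap M i j)" unfolding overlap_cotangent[OF i] by (simp add: open_Times o)
  have "smooth_form_on (overlap E i j) (\<lambda>x. fd (tr j i) (tr i j x))"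
    unfolding smooth_form_on_def
    using linear_fd_tr[OF j i atlas_transition(1)[OF E i j]] smooth_on_compose[OF o(1,2) img o(3) smooth_on_fd[OF o(4)]]
    by blast
  then have "smooth_on (overlap M i j) (\<lambda>z. adjoint (fd (tr j i) (tr i j (fst z))) (snd z))"
    unfolding overlap_cotangent[OF i] by (rule smooth_on_adjoint[OF o(1)])
  moreover have "smooth_on (overlap M i j) (\<lambda>z. tr i j (fst z))"
    unfolding overlap_cotangent[OF i] by (rule smooth_on_fst_compose[OF o(1,3)])
  ultimately show ?thesis unfolding cot_tr_def[abs_def] by (intro smooth_on_Pair oM)
qed

lemma cotangent_smooth_atlas: "smooth_atlas M"
  unfolding smooth_atlas_def
proof (intro conjI ballI)
  fix i assume "i \<in> charts M"
  then have i: "i \<in> charts E" by simp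
  show "inj_on (coord M i) (chart_dom M i)" by (rule inj_on_coord_cotangent[OF i])
  show "open (chart_img M i)"
    unfolding chart_img_cotangent[OF i] using E i by (simp add: open_Times smooth_atlas_def)
  fix j assume "j \<in> charts M"
  then have j: "j \<in> charts E" by simp
  show o: "open (overlap M i j)"
    unfolding overlap_cotangent[OF i] using E i j by (simp add: open_Times smooth_atlas_def)
  show "smooth_on (overlap M i j) (transition M i j)"
    using smooth_on_cong[OF o, of "transition M i j" "cot_tr i j"] transition_cotangent[OF i j] smooth_cot_tr[OF i j]
    by blast
qed

text \<open>Base vectors change by the Jacobian and momenta by its inverse transpose, which cancel
  in the pairing once the Jacobian intertwines \<open>S\<close> and \<open>S'\<close>.\<close>

lemma fibre_form_cot_tr:
  assumes i: "i \<in> charts E" and j: "j \<in> charts E" and z: "z \<in> overlap M i j"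
    and S: "\<And>v. fd (tr i j) (fst z) (S (fst z) v) = S' (tr i j (fst z)) (fd (tr i j) (fst z) v)"
  shows "fibre_form S z Z = fibre_form S' (transition M i j z) (fd (transition M i j) z Z)"
proof -
  have x: "fst z \<in> overlap E i j" using z unfolding overlap_cotangent[OF i] by auto
  have oM: "open (overlap M i j)" and dT: "transition M i j differentiable (at z)"
    using cotangent_smooth_atlas i j atlas_transition(4)[OF cotangent_smooth_atlas _ _ z] unfolding smooth_atlas_def by auto
  have "((\<lambda>y. fst (transition M i j y)) has_derivative (\<lambda>h. fst (fd (transition M i j) z h))) (at z)"
    by (rule has_derivative_fst[OF fd_works[OF dT]])
  moreover have "((\<lambda>y. fst (transition M i j y)) has_derivative (\<lambda>h. fd (tr i j) (fst z) (fst h))) (at z)"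
  proof (subst has_derivative_cong_open[OF oM z, where g = "\<lambda>y. tr i j (fst y)"])
    show "((\<lambda>y. tr i j (fst y)) has_derivative (\<lambda>h. fd (tr i j) (fst z) (fst h))) (at z)"
      by (rule has_derivative_compose[OF has_derivative_fst[OF has_derivative_ident] fd_works[OF atlas_transition(4)[OF E i j x]]])
  qed (simp add: transition_cotangent[OF i j] cot_tr_def)
  ultimately have "fst (fd (transition M i j) z Z) = fd (tr i j) (fst z) (fst Z)"
    using has_derivative_unique by metis
  moreover have "linear (fd (tr j i) (tr i j (fst z)))"
    by (rule linear_fd_tr[OF j i atlas_transition(1)[OF E i j x]])
  ultimately show ?thesis
    unfolding fibre_form_def transition_cotangent[OF i j z] cot_tr_def
    by (simp add: adjoint_clauses S[symmetric] atlas_transition(3)[OF E i j x])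
qed

lemma ed_fibre_form_cot_tr:
  assumes i: "i \<in> charts E" and j: "j \<in> charts E" and z: "z \<in> overlap M i j"
    and S': "smooth_form_on (chart_img E j) S'"
    and S: "\<And>x v. x \<in> overlap E i j \<Longrightarrow> fd (tr i j) x (S x v) = S' (tr i j x) (fd (tr i j) x v)"
  shows "ed (fibre_form S) z Z V =
    ed (fibre_form S') (transition M i j z) (fd (transition M i j) z Z) (fd (transition M i j) z V)"
proof (rule ed_pullback[where S = "overlap M i j" and S' = "chart_img E j \<times> UNIV"])
  show "open (overlap M i j)" "smooth_on (overlap M i j) (transition M i j)"
    using cotangent_smooth_atlas i j unfolding smooth_atlas_def by auto
  have oj: "open (chart_img E j)" using E j unfolding smooth_atlas_def by blast
  then show "open (chart_img E j \<times> (UNIV :: 'v set))" by (simp add: open_Times)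
  show "smooth_form_on (chart_img E j \<times> UNIV) (fibre_form S')" by (rule smooth_form_on_fibre_form[OF oj S'])
  show "transition M i j ` overlap M i j \<subseteq> chart_img E j \<times> UNIV"
    unfolding chart_img_cotangent[OF j, symmetric]
    using atlas_transition(1)[OF cotangent_smooth_atlas, of i j] i j overlap_subset[of M j i] by fastforce
  fix y v assume "y \<in> overlap M i j"
  then show "fibre_form S y v = fibre_form S' (transition M i j y) (fd (transition M i j) y v)"
    using S overlap_cotangent[OF i] by (intro fibre_form_cot_tr[OF i j]) auto
qed (rule z)

lemma ed_fibre_form_id:
  fixes z :: "'w::euclidean_space \<times> 'w"
  shows "ed (fibre_form (\<lambda>x v. v)) z = symplectic"
proof -
  have "smooth_form_on (UNIV :: 'w set) (\<lambda>x v :: 'w. v)"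
    unfolding smooth_form_on_def by (simp add: smooth_on_const linear_ident)
  from ed_fibre_form[OF open_UNIV this, of z] show ?thesis
    by (intro ext) (simp add: symplectic_def)
qed

text \<open>The identity tensors are intertwined by every Jacobian, so changes of natural
  coordinates are symplectic.\<close>

lemma symplectic_cot_tr:
  assumes "i \<in> charts E" "j \<in> charts E" "z \<in> overlap M i j"
  shows "symplectic Z V = symplectic (fd (transition M i j) z Z) (fd (transition M i j) z V)"
  using ed_fibre_form_cot_tr[OF assms, of "\<lambda>x v. v" "\<lambda>x v. v"]
  by (simp add: ed_fibre_form_id smooth_form_on_def smooth_on_const linear_ident)

end

section \<open>Integrability\<close>

lemma canonical_form_eq: "canonical_form i = fibre_form (\<lambda>x v. v)"
  by (auto simp: canonical_form_def fibre_form_def fun_eq_iff)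

text \<open>\<open>fibre_form (R i)\<close> is the pull-back of the canonical form under the fibre
  map, which fixes base points, and exterior differentiation commutes with pull-back.\<close>

lemma pullback_fibre_map:
  assumes U: "open U" and R: "smooth_form_on U (R i)" and z: "z \<in> U \<times> UNIV"
  shows "pullback2 (fibre_map R) (ext_deriv canonical_form) i z Z V = ed (fibre_form (R i)) z Z V"
proof -
  have T_eq: "fibre_map R i = (\<lambda>z. (fst z, adjoint (R i (fst z)) (snd z)))"
    by (auto simp: fibre_map_def fun_eq_iff)
  have o: "open (U \<times> UNIV)" by (simp add: open_Times U)
  have T: "smooth_on (U \<times> UNIV) (fibre_map R i)"
    unfolding T_eq by (intro smooth_on_Pair o smooth_on_adjoint U R smooth_on_bounded_linear bounded_linear_fst)
  have form: "fibre_form (R i) y v = fibre_form (\<lambda>x v. v) (fibre_map R i y) (fd (fibre_map R i) y v)"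
    if y: "y \<in> U \<times> UNIV" for y v
  proof -
    have "((\<lambda>y. fst (fibre_map R i y)) has_derivative (\<lambda>h. fst (fd (fibre_map R i) y h))) (at y)"
      by (rule has_derivative_fst[OF fd_works[OF smooth_on_differentiable[OF T y]]])
    moreover have "((\<lambda>y. fst (fibre_map R i y)) has_derivative (\<lambda>h. fst h)) (at y)"
      unfolding T_eq by (auto intro!: derivative_eq_intros)
    ultimately have "fst (fd (fibre_map R i) y v) = fst v" using has_derivative_unique by metis
    moreover have "linear (R i (fst y))" using y smooth_form_onD(1)[OF R] by auto
    ultimately show ?thesis unfolding fibre_form_def by (simp add: T_eq adjoint_clauses)
  qed
  have "smooth_form_on (UNIV :: 'a set) (\<lambda>x v :: 'a. v)"
    unfolding smooth_form_on_def by (simp add: smooth_on_const linear_ident)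
  then have id: "smooth_form_on (UNIV :: ('a \<times> 'a) set) (fibre_form (\<lambda>x v. v))"
    using smooth_form_on_fibre_form[OF open_UNIV] by fastforce
  show ?thesis
    unfolding pullback2_def ext_deriv_eq_ed canonical_form_eq
    by (rule ed_pullback[OF o open_UNIV _ T id z form, symmetric]) auto
qed

section \<open>The iterated forms and their kernel across charts\<close>

locale cotangent_lift = cotangent_atlas E
  for E :: "('i, 'a, 'v::euclidean_space) manifold" +
  fixes R :: "('i, 'v) tensor11" and F :: "'a \<times> ('i \<Rightarrow> 'v) \<Rightarrow> real" and n :: nat
  assumes points: "points E = (\<Union>i\<in>charts E. chart_dom E i)"
    and R: "tensor_field11 E R" and torsion: "vanishing_torsion E R"
    and F: "smooth_function (cotangent_bundle E) F" and n: "DIM('v) = n + 1"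
    and ind: "independent_forms (cotangent_bundle E) n
      (iterated_forms (cotangent_bundle E) (complete_lift R) F)"
begin

abbreviation "Fc i \<equiv> F \<circ> param M i"
abbreviation "L i \<equiv> lift_field (R i)"
abbreviation "\<alpha> k i z v \<equiv> fd (Fc i) z ((L i z ^^ k) v)"
abbreviation "K i z \<equiv> {v. \<forall>k\<le>n. \<alpha> k i z v = 0}"

lemma open_chart_img: "i \<in> charts E \<Longrightarrow> open (chart_img E i)" "i \<in> charts E \<Longrightarrow> open (chart_img M i)"
  using E cotangent_smooth_atlas unfolding smooth_atlas_def by auto

lemma smooth_R: "i \<in> charts E \<Longrightarrow> smooth_form_on (chart_img E i) (R i)"
  using R unfolding tensor_field11_def smooth_form_on_def by blast

lemma chart: "i \<in> charts E \<Longrightarrow> torsion_free_chart (chart_img E i) (R i)"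
  using open_chart_img smooth_R torsion smooth_on_const
  unfolding torsion_free_chart_def vanishing_torsion_def by blast

text \<open>Nondegeneracy of \<open>symplectic\<close> gives the uniqueness required by the definite
  description.\<close>

lemma complete_lift_eq:
  assumes i: "i \<in> charts E" and z: "z \<in> chart_img M i"
  shows "complete_lift R i z = L i z"
proof
  fix Z
  interpret C: torsion_free_chart "chart_img E i" "R i" by (rule chart[OF i])
  have z': "z \<in> chart_img E i \<times> UNIV" using z chart_img_cotangent[OF i] by simp
  have pb: "pullback2 (fibre_map R) (ext_deriv canonical_form) i z Z V = ed (fibre_form (R i)) z Z V" for V
    by (rule pullback_fibre_map[where R = R, OF open_chart_img(1)[OF i] smooth_R[OF i] z'])
  show "complete_lift R i z Z = L i z Z"
    unfolding complete_lift_def pb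
      ext_deriv_eq_ed canonical_form_eq ed_fibre_form_id C.symplectic_lift[OF z', symmetric]
    by (rule the_equality) (auto intro: symplectic_nondegenerate)
qed

lemma iterated_forms_eq:
  assumes i: "i \<in> charts E" and z: "z \<in> chart_img M i"
  shows "iterated_forms M (complete_lift R) F k i z v = \<alpha> k i z v"
proof (induction k arbitrary: v)
  case 0
  show ?case by (simp add: iterated_forms_def differential_def comp_def)
next
  case (Suc k)
  have "iterated_forms M (complete_lift R) F (Suc k) i z v = iterated_forms M (complete_lift R) F k i z (L i z v)"
    by (simp add: iterated_forms_def tensor_on_form_def complete_lift_eq[OF i z])
  then show ?case using Suc[of "L i z v"] by (simp add: funpow_swap1)
qed

lemma annihilator_eq:
  "i \<in> charts E \<Longrightarrow> z \<in> chart_img M i \<Longrightarrow> annihilator n (iterated_forms M (complete_lift R) F) i z = K i z"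
  by (simp add: annihilator_def iterated_forms_eq)

lemma smooth_F: "i \<in> charts E \<Longrightarrow> smooth_on (chart_img M i) (Fc i)"
  using F unfolding smooth_function_def by simp

lemma independent:
  fixes c :: "nat \<Rightarrow> real"
  assumes "i \<in> charts E" "z \<in> chart_img M i" "\<And>v. (\<Sum>k\<le>n. c k * \<alpha> k i z v) = 0"
  shows "\<forall>k\<le>n. c k = 0"
  using ind assms unfolding independent_forms_def by (simp add: iterated_forms_eq)

lemma linear_L: "i \<in> charts E \<Longrightarrow> z \<in> chart_img M i \<Longrightarrow> linear (L i z)"
  using smooth_form_onD(1)[OF torsion_free_chart.smooth_lift[OF chart]] chart_img_cotangent by metis

lemma smooth_forms: "i \<in> charts E \<Longrightarrow> smooth_form_on (chart_img M i) (\<lambda>z v. \<alpha> k i z v)"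
proof -
  assume i: "i \<in> charts E"
  interpret C: torsion_free_chart "chart_img E i" "R i" by (rule chart[OF i])
  have "smooth_form_on (chart_img M i) (\<lambda>z. fd (Fc i) z)"
    unfolding smooth_form_on_def using smooth_F[OF i] smooth_on_fd smooth_on_differentiable fd_linear by blast
  then show ?thesis
    unfolding chart_img_cotangent[OF i] by (rule C.smooth_iterates)
qed

lemma kernel_all:
  assumes i: "i \<in> charts E" and z: "z \<in> chart_img M i" and "v \<in> K i z"
  shows "\<alpha> m i z v = 0"
proof -
  interpret C: torsion_free_chart "chart_img E i" "R i" by (rule chart[OF i])
  have z': "z \<in> chart_img E i \<times> UNIV" using z chart_img_cotangent[OF i] by simp
  have lin: "linear (fd (Fc i) z)" using fd_linear[OF smooth_on_differentiable[OF smooth_F[OF i] z]] .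
  show ?thesis
  proof (rule lagrangian_kernel[OF linear_L[OF i z] C.symplectic_lift_adjoint[OF z'] lin n])
    show "\<forall>k\<le>n. c k = 0" if "\<And>v. (\<Sum>k\<le>n. c k * \<alpha> k i z v) = 0" for c :: "nat \<Rightarrow> real"
      by (rule independent[OF i z that])
    show "\<alpha> k i z v = 0" if "k \<le> n" for k using assms(3) that by blast
  qed
qed

lemma ext_deriv_lift:
  assumes i: "i \<in> charts E" and z: "z \<in> chart_img M i"
  shows "ext_deriv (tensor_on_form (complete_lift R) (differential M F)) i z u v = ed (\<lambda>z v. \<alpha> 1 i z v) z u v"
  unfolding ext_deriv_eq_ed
  by (rule ed_cong[OF open_chart_img(2)[OF i] z]) (simp add: tensor_on_form_def differential_def complete_lift_eq[OF i])

text \<open>\<open>L\<close> is determined by two 2-forms, and changes of natural coordinates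
  preserve both.\<close>

lemma lift_natural:
  assumes i: "i \<in> charts E" and j: "j \<in> charts E" and z: "z \<in> overlap M i j"
  shows "L j (transition M i j z) (fd (transition M i j) z Z) = fd (transition M i j) z (L i z Z)"
proof (rule symplectic_nondegenerate)
  fix V
  let ?T = "transition M i j"
  interpret Ci: torsion_free_chart "chart_img E i" "R i" by (rule chart[OF i])
  interpret Cj: torsion_free_chart "chart_img E j" "R j" by (rule chart[OF j])
  have zi: "z \<in> chart_img E i \<times> UNIV" using z overlap_subset[of M i j] chart_img_cotangent[OF i] by auto
  have Tz: "?T z \<in> overlap M j i" and inv: "transition M j i (?T z) = z"
    using atlas_transition(1,2)[OF cotangent_smooth_atlas _ _ z] i j by auto
  then have zj: "?T z \<in> chart_img E j \<times> UNIV" using overlap_subset[of M j i] chart_img_cotangent[OF j] by auto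
  \<comment> \<open>The Jacobian is invertible, so the arbitrary test vector \<open>V\<close> is the
    image of some \<open>V'\<close>.\<close>
  define V' where "V' = fd (transition M j i) (?T z) V"
  have V: "fd ?T z V' = V"
    using atlas_transition(3)[OF cotangent_smooth_atlas _ _ Tz] i j inv unfolding V'_def by simp
  have "symplectic (L j (?T z) (fd ?T z Z)) V = ed (fibre_form (R j)) (?T z) (fd ?T z Z) (fd ?T z V')"
    unfolding V by (rule Cj.symplectic_lift[OF zj])
  also have "\<dots> = ed (fibre_form (R i)) z Z V'"
    using R i j unfolding tensor_field11_def by (intro ed_fibre_form_cot_tr[OF i j z smooth_R[OF j], symmetric]) blast
  also have "\<dots> = symplectic (L i z Z) V'" by (rule Ci.symplectic_lift[OF zi, symmetric])
  also have "\<dots> = symplectic (fd ?T z (L i z Z)) (fd ?T z V')" by (rule symplectic_cot_tr[OF i j z])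
  finally show "symplectic (L j (?T z) (fd ?T z Z)) V = symplectic (fd ?T z (L i z Z)) V" unfolding V .
qed

text \<open>\<open>Fc i\<close> and \<open>Fc j\<close> are one function read in two charts, and the
  Jacobian intertwines the lifts.\<close>

lemma forms_natural:
  assumes i: "i \<in> charts E" and j: "j \<in> charts E" and z: "z \<in> overlap M i j"
  shows "\<alpha> k j (transition M i j z) (fd (transition M i j) z v) = \<alpha> k i z v"
proof -
  let ?T = "transition M i j"
  have o: "open (overlap M i j)" using cotangent_smooth_atlas i j unfolding smooth_atlas_def by auto
  have Tz: "?T z \<in> chart_img M j"
    using atlas_transition(1)[OF cotangent_smooth_atlas _ _ z] i j overlap_subset[of M j i] by auto
  have "(L j (?T z) ^^ k) (fd ?T z v) = fd ?T z ((L i z ^^ k) v)"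
    by (induction k arbitrary: v) (simp_all add: lift_natural[OF i j z])
  moreover have "fd (Fc i) z = fd (\<lambda>y. Fc j (?T y)) z"
  proof (rule fd_cong_open[OF o z])
    fix y assume y: "y \<in> overlap M i j"
    then have "y \<in> chart_img M i" using overlap_subset[of M i j] by blast
    then have "param M i y \<in> chart_dom M j" using atlas_overlap_iff[OF cotangent_smooth_atlas] y i by auto
    then show "Fc i y = Fc j (?T y)"
      using atlas_param(1)[OF cotangent_smooth_atlas, of j "param M i y"] j by (simp add: transition_def)
  qed
  moreover have dT: "?T differentiable (at z)"
    by (rule atlas_transition(4)[OF cotangent_smooth_atlas _ _ z]) (use i j in simp_all)
  have "fd (\<lambda>y. Fc j (?T y)) z = (\<lambda>h. fd (Fc j) (?T z) (fd ?T z h))"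
    by (rule fd_eqI[OF has_derivative_compose[OF fd_works[OF dT] fd_works[OF smooth_on_differentiable[OF smooth_F[OF j] Tz]]]])
  ultimately show ?thesis by (simp only:)
qed

lemma kernel_natural:
  assumes i: "i \<in> charts E" and j: "j \<in> charts E" and z: "z \<in> overlap M i j"
  shows "fd (transition M i j) z ` K i z = K j (transition M i j z)"
proof (intro equalityI subsetI)
  fix v assume "v \<in> fd (transition M i j) z ` K i z"
  then show "v \<in> K j (transition M i j z)" using forms_natural[OF i j z] by auto
next
  let ?T = "transition M i j"
  fix v assume v: "v \<in> K j (?T z)"
  have Tz: "?T z \<in> overlap M j i" and inv: "transition M j i (?T z) = z"
    using atlas_transition(1,2)[OF cotangent_smooth_atlas _ _ z] i j by auto
  define w where "w = fd (transition M j i) (?T z) v"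
  have "fd ?T z w = v"
    using atlas_transition(3)[OF cotangent_smooth_atlas _ _ Tz] i j inv unfolding w_def by simp
  moreover have "w \<in> K i z" using forms_natural[OF i j z, of _ w] v \<open>fd ?T z w = v\<close> by auto
  ultimately show "v \<in> fd ?T z ` K i z" by blast
qed

text \<open>Bundling the forms into one \<open>'v\<close>-valued form gives the shape required by
  \<open>kernel_section\<close> and \<open>frobenius_kernel\<close>. One enumeration
  \<open>e\<close> of the basis serves all charts.\<close>

lemma forms_frame:
  obtains e :: "nat \<Rightarrow> 'v" where
    "\<And>i z. i \<in> charts E \<Longrightarrow> z \<in> chart_img M i \<Longrightarrow> surj (\<lambda>v. \<Sum>k\<le>n. \<alpha> k i z v *\<^sub>R e k)"
    "\<And>i z v. i \<in> charts E \<Longrightarrow> z \<in> chart_img M i \<Longrightarrow> (\<Sum>k\<le>n. \<alpha> k i z v *\<^sub>R e k) = 0 \<longleftrightarrow> v \<in> K i z"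
    "\<And>i. i \<in> charts E \<Longrightarrow> smooth_form_on (chart_img M i) (\<lambda>z v. \<Sum>k\<le>n. \<alpha> k i z v *\<^sub>R e k)"
proof -
  obtain e where e: "bij_betw e {..n} (Basis :: 'v set)"
    using finite_same_card_bij[of "{..n}" "Basis :: 'v set"] n by auto
  have *: "linear (\<lambda>v. \<Sum>k\<le>n. \<alpha> k i z v *\<^sub>R e k)" "surj (\<lambda>v. \<Sum>k\<le>n. \<alpha> k i z v *\<^sub>R e k)"
    "(\<Sum>k\<le>n. \<alpha> k i z v *\<^sub>R e k) = 0 \<longleftrightarrow> v \<in> K i z"
    if i: "i \<in> charts E" and z: "z \<in> chart_img M i" for i z v
    using independent_forms_surj[where \<alpha> = "\<lambda>k v. \<alpha> k i z v", OF smooth_form_onD(1)[OF smooth_forms[OF i] z] e independent[OF i z]]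
    by auto
  have "smooth_form_on (chart_img M i) (\<lambda>z v. \<Sum>k\<le>n. \<alpha> k i z v *\<^sub>R e k)" if i: "i \<in> charts E" for i
    unfolding smooth_form_on_def using *(1)[OF i]
    by (auto intro!: smooth_on_sum smooth_on_scaleR smooth_on_const open_chart_img(2)[OF i] smooth_form_onD(2)[OF smooth_forms[OF i]])
  then show ?thesis using that * by blast
qed

section \<open>The two implications\<close>

lemma integrable_imp_closed:
  assumes int: "frobenius_integrable TYPE('k::euclidean_space) M (annihilator n (iterated_forms M (complete_lift R) F))"
    and i: "i \<in> charts E" and z: "z \<in> chart_img M i" and uv: "u \<in> K i z" "v \<in> K i z"
  shows "ed (\<lambda>z v. \<alpha> m i z v) z u v = 0"
proof -
  let ?m = "param M i z"
  have m: "?m \<in> chart_dom M i" "coord M i ?m = z"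
    using atlas_param(2,3)[OF cotangent_smooth_atlas _ z] i by auto
  have "?m \<in> points M"
    using m(1) i points by auto
  then obtain B :: "'k set" and \<sigma> where B: "?m \<in> \<sigma> ` B"
    "integral_manifold M (annihilator n (iterated_forms M (complete_lift R) F)) B \<sigma>"
    using int unfolding frobenius_integrable_def by blast
  then obtain b where b: "b \<in> B" "\<sigma> b = ?m" by auto
  define B' where "B' = B \<inter> \<sigma> -` chart_dom M i"
  define s where "s = coord M i \<circ> \<sigma>"
  have B': "open B'" "smooth_on B' s"
    and range: "\<And>b. b \<in> B' \<Longrightarrow> range (fd s b) = annihilator n (iterated_forms M (complete_lift R) F) i (s b)"
    using B(2) i unfolding integral_manifold_def B'_def s_def by auto
  have s_img: "s ` B' \<subseteq> chart_img M i" unfolding B'_def s_def chart_img_def by auto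
  have rK: "range (fd s b) = K i (s b)" if "b \<in> B'" for b
  proof -
    have "s b \<in> chart_img M i" using s_img that by blast
    then show ?thesis unfolding range[OF that] by (rule annihilator_eq[OF i])
  qed
  have bB: "b \<in> B'" "s b = z" using b m unfolding B'_def s_def by auto
  \<comment> \<open>The tangent space is the whole kernel, so both given vectors come from the
    parameter space.\<close>
  have "u \<in> range (fd s b)" "v \<in> range (fd s b)" unfolding rK[OF bB(1)] bB(2) by (fact uv)+
  then obtain u' v' where uv': "u = fd s b u'" "v = fd s b v'" by blast
  have "ed (\<lambda>_ _. 0) b u' v' = ed (\<lambda>z v. \<alpha> m i z v) (s b) (fd s b u') (fd s b v')"
  proof (rule ed_pullback[OF B'(1) open_chart_img(2)[OF i] s_img B'(2) smooth_forms[OF i] bB(1)])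
    fix y w assume y: "y \<in> B'"
    have "fd s y w \<in> K i (s y)" unfolding rK[OF y, symmetric] by (rule rangeI)
    moreover have "s y \<in> chart_img M i" using s_img y by blast
    ultimately show "0 = \<alpha> m i (s y) (fd s y w)" by (intro kernel_all[OF i, symmetric])
  qed
  then show ?thesis unfolding uv' bB(2)[symmetric] by (simp add: ed_def)
qed

lemma cotangent_points: "points M = (\<Union>i\<in>charts E. chart_dom M i)"
  using points by auto

text \<open>The hypothesis speaks of local sections, the conclusion of single vectors;
  \<open>kernel_section\<close> extends two vectors to sections over a common open set.\<close>

lemma vanishing_imp_closed:
  assumes van: "vanishes_on M (annihilator n (iterated_forms M (complete_lift R) F))
      (ext_deriv (tensor_on_form (complete_lift R) (differential M F)))"
    and i: "i \<in> charts E" and z: "z \<in> chart_img M i" and uv: "u \<in> K i z" "v \<in> K i z"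
  shows "ed (\<lambda>z v. \<alpha> 1 i z v) z u v = 0"
proof (rule forms_frame)
  fix e :: "nat \<Rightarrow> 'v"
  assume surj: "\<And>i z. i \<in> charts E \<Longrightarrow> z \<in> chart_img M i \<Longrightarrow> surj (\<lambda>v. \<Sum>k\<le>n. \<alpha> k i z v *\<^sub>R e k)"
    and ker: "\<And>i z v. i \<in> charts E \<Longrightarrow> z \<in> chart_img M i \<Longrightarrow> (\<Sum>k\<le>n. \<alpha> k i z v *\<^sub>R e k) = 0 \<longleftrightarrow> v \<in> K i z"
    and smooth: "\<And>i. i \<in> charts E \<Longrightarrow> smooth_form_on (chart_img M i) (\<lambda>z v. \<Sum>k\<le>n. \<alpha> k i z v *\<^sub>R e k)"
  let ?\<Lambda> = "\<lambda>z v. \<Sum>k\<le>n. \<alpha> k i z v *\<^sub>R e k"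
  have dims: "DIM('v \<times> 'v) = DIM('v) + DIM('v)" by simp
  obtain W where W: "open W" "z \<in> W" "W \<subseteq> chart_img M i"
    "\<And>v. ?\<Lambda> z v = 0 \<Longrightarrow> \<exists>X. smooth_on W X \<and> X z = v \<and> (\<forall>z\<in>W. ?\<Lambda> z (X z) = 0)"
    using kernel_section[OF open_chart_img(2)[OF i] z smooth_form_onD(1)[OF smooth[OF i]]
        smooth_form_onD(2)[OF smooth[OF i]] surj[OF i z] dims] by blast
  have "\<exists>X. section_on M (annihilator n (iterated_forms M (complete_lift R) F)) i W X \<and> X z = v" if "v \<in> K i z" for v
  proof -
    have "?\<Lambda> z v = 0" using ker[OF i z] that by blast
    then obtain X where X: "smooth_on W X" "X z = v" "\<And>z. z \<in> W \<Longrightarrow> ?\<Lambda> z (X z) = 0" using W(4) by blast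
    have "X y \<in> annihilator n (iterated_forms M (complete_lift R) F) i y" if "y \<in> W" for y
    proof -
      have y: "y \<in> chart_img M i" using that W(3) by blast
      show ?thesis unfolding annihilator_eq[OF i y] using ker[OF i y] X(3)[OF that] by blast
    qed
    then have "section_on M (annihilator n (iterated_forms M (complete_lift R) F)) i W X"
      unfolding section_on_def using W(1,3) X(1) by (intro conjI ballI)
    then show ?thesis using X(2) by blast
  qed
  note sections = this[OF uv(1)] this[OF uv(2)]
  obtain X Y where X: "section_on M (annihilator n (iterated_forms M (complete_lift R) F)) i W X" "X z = u"
    and Y: "section_on M (annihilator n (iterated_forms M (complete_lift R) F)) i W Y" "Y z = v"
    using sections by blast
  have "ext_deriv (tensor_on_form (complete_lift R) (differential M F)) i z (X z) (Y z) = 0"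
    using van X(1) Y(1) i W(2) unfolding vanishes_on_def by simp
  then show ?thesis unfolding ext_deriv_lift[OF i z] X(2) Y(2) .
qed

text \<open>\<open>frobenius_kernel\<close> yields the submanifold in one chart around the point. An
  integral manifold is tested in every chart, so smoothness and tangent spaces are carried over by
  the coordinate changes.\<close>

lemma closed_imp_integrable:
  assumes van: "vanishes_on M (annihilator n (iterated_forms M (complete_lift R) F))
      (ext_deriv (tensor_on_form (complete_lift R) (differential M F)))"
  shows "frobenius_integrable TYPE('v) M (annihilator n (iterated_forms M (complete_lift R) F))"
  unfolding frobenius_integrable_def
proof (rule ballI, rule forms_frame)
  fix m and e :: "nat \<Rightarrow> 'v"
  assume m: "m \<in> points M"
    and surj: "\<And>i z. i \<in> charts E \<Longrightarrow> z \<in> chart_img M i \<Longrightarrow> surj (\<lambda>v. \<Sum>k\<le>n. \<alpha> k i z v *\<^sub>R e k)"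
    and ker: "\<And>i z v. i \<in> charts E \<Longrightarrow> z \<in> chart_img M i \<Longrightarrow> (\<Sum>k\<le>n. \<alpha> k i z v *\<^sub>R e k) = 0 \<longleftrightarrow> v \<in> K i z"
    and smooth: "\<And>i. i \<in> charts E \<Longrightarrow> smooth_form_on (chart_img M i) (\<lambda>z v. \<Sum>k\<le>n. \<alpha> k i z v *\<^sub>R e k)"
  obtain i where i: "i \<in> charts E" "m \<in> chart_dom M i" using m cotangent_points by blast
  have iM: "i \<in> charts M" using i by simp
  define z0 where "z0 = coord M i m"
  have z0: "z0 \<in> chart_img M i" using i(2) unfolding z0_def chart_img_def by blast
  let ?\<Lambda> = "\<lambda>z v. \<Sum>k\<le>n. \<alpha> k i z v *\<^sub>R e k"
  have dims: "DIM('v \<times> 'v) = DIM('v) + DIM('v)" by simp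
  interpret C: torsion_free_chart "chart_img E i" "R i" by (rule chart[OF i(1)])
  have img: "chart_img E i \<times> UNIV = chart_img M i" using chart_img_cotangent[OF i(1)] by simp
  have closed: "ed (\<lambda>z v. \<alpha> k i z v) z u v = 0" if z: "z \<in> chart_img M i" and uv: "u \<in> K i z" "v \<in> K i z" for k z u v
  proof (rule C.iterates_closed_on_kernel[unfolded img, OF smooth_F[OF i(1)] n _ _ z])
    show "\<forall>k\<le>n. c k = 0" if "z \<in> chart_img M i" "\<And>v. (\<Sum>k\<le>n. c k * \<alpha> k i z v) = 0" for z and c :: "nat \<Rightarrow> real"
      by (rule independent[OF i(1) that])
    show "ed (\<lambda>z v. fd (Fc i) z (L i z v)) z u v = 0"
      if "z \<in> chart_img M i" "\<And>k. k \<le> n \<Longrightarrow> \<alpha> k i z u = 0" "\<And>k. k \<le> n \<Longrightarrow> \<alpha> k i z v = 0" for z u v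
      using vanishing_imp_closed[OF van i(1) that(1), of u v] that(2,3) by simp
  qed (use uv in auto)
  \<comment> \<open>Componentwise, this condition of \<open>frobenius_kernel\<close> says that the
    exterior derivatives of the forms vanish on the kernel.\<close>
  have invol: "fd (\<lambda>y. ?\<Lambda> y w) z v = fd (\<lambda>y. ?\<Lambda> y v) z w"
    if z: "z \<in> chart_img M i" and "?\<Lambda> z v = 0" "?\<Lambda> z w = 0" for z v w
  proof -
    have vw: "v \<in> K i z" "w \<in> K i z" using that ker[OF i(1) z] by blast+
    have d: "fd (\<lambda>y. ?\<Lambda> y w) z = (\<lambda>h. \<Sum>k\<le>n. fd (\<lambda>y. \<alpha> k i y w) z h *\<^sub>R e k)" for w
      by (intro fd_eqI has_derivative_sum has_derivative_scaleR_left fd_works smooth_form_onD(3)[OF smooth_forms[OF i(1)] z])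
    show ?thesis
      unfolding d using closed[OF z vw] by (intro sum.cong refl) (simp add: ed_def)
  qed
  obtain r and s :: "'v \<Rightarrow> 'v \<times> 'v" where r: "r > 0" "s 0 = z0" and s: "smooth_on (ball 0 r) s" "inj_on s (ball 0 r)"
    "s ` ball 0 r \<subseteq> chart_img M i"
    "\<And>x. x \<in> ball 0 r \<Longrightarrow> inj (fd s x) \<and> range (fd s x) = {v. ?\<Lambda> (s x) v = 0}"
    using frobenius_kernel[OF open_chart_img(2)[OF i(1)] z0 smooth_form_onD(1)[OF smooth[OF i(1)]]
        smooth_form_onD(2)[OF smooth[OF i(1)]] surj[OF i(1) z0] dims invol] by blast
  define B where "B = ball (0 :: 'v) r"
  note s = s[folded B_def]
  define \<sigma> where "\<sigma> = param M i \<circ> s"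
  note param = atlas_param[OF cotangent_smooth_atlas iM]
  have sB: "s b \<in> chart_img M i" if "b \<in> B" for b using s(3) that by blast
  have range_s: "range (fd s b) = K i (s b)" if "b \<in> B" for b
    using s(4)[OF that] ker[OF i(1) sB[OF that]] by blast
  have "integral_manifold M (annihilator n (iterated_forms M (complete_lift R) F)) B \<sigma>"
    unfolding integral_manifold_def
  proof (intro conjI ballI)
    show "open B" by (simp add: B_def)
    have "inj_on (param M i) (chart_img M i)" using param(3) by (rule inj_on_inverseI)
    then show "inj_on \<sigma> B" unfolding \<sigma>_def using s(2,3) by (intro comp_inj_on) (auto intro: inj_on_subset)
    show "\<sigma> ` B \<subseteq> points M"
      unfolding cotangent_points \<sigma>_def comp_def using param(2)[OF sB] i(1) by blast
  next
    fix j assume "j \<in> charts M"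
    then have j: "j \<in> charts E" by simp
    let ?T = "transition M i j"
    let ?B = "B \<inter> \<sigma> -` chart_dom M j"
    have o: "open (overlap M i j)" and smooth_T: "smooth_on (overlap M i j) ?T"
      using cotangent_smooth_atlas iM \<open>j \<in> charts M\<close> unfolding smooth_atlas_def by auto
    \<comment> \<open>As a preimage under the continuous map \<open>s\<close> the set is visibly
      open.\<close>
    have B_eq: "?B = B \<inter> s -` overlap M i j"
    proof (intro set_eqI)
      show "b \<in> ?B \<longleftrightarrow> b \<in> B \<inter> s -` overlap M i j" for b
        using atlas_overlap_iff[OF cotangent_smooth_atlas iM sB, of b j] unfolding \<sigma>_def comp_def by blast
    qed
    show open_B: "open ?B"
      unfolding B_eq
      by (rule continuous_open_preimage[OF smooth_on_continuous_on[OF s(1)] _ o]) (simp add: B_def)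
    have comp: "coord M j \<circ> \<sigma> = (\<lambda>b. ?T (s b))" by (simp add: \<sigma>_def transition_def fun_eq_iff)
    have s_img: "s ` ?B \<subseteq> overlap M i j" unfolding B_eq by blast
    show "smooth_on ?B (coord M j \<circ> \<sigma>)"
      unfolding comp by (rule smooth_on_compose[OF open_B o s_img smooth_on_subset[OF s(1)] smooth_T]) blast
    fix b assume b: "b \<in> ?B"
    then have bB: "b \<in> B" and sb: "s b \<in> overlap M i j" using s_img by auto
    have d: "fd (coord M j \<circ> \<sigma>) b = (\<lambda>h. fd ?T (s b) (fd s b h))"
      unfolding comp
      by (rule fd_eqI[OF has_derivative_compose[OF fd_works[OF smooth_on_differentiable[OF s(1) bB]]
              fd_works[OF smooth_on_differentiable[OF smooth_T sb]]]])
    have "inj (fd ?T (s b))"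
      using atlas_transition(3)[OF cotangent_smooth_atlas iM \<open>j \<in> charts M\<close> sb] by (rule inj_on_inverseI)
    then show "inj (fd (coord M j \<circ> \<sigma>) b)"
      unfolding d using s(4)[OF bB] inj_compose[of "fd ?T (s b)" "fd s b"] by (simp only: comp_def)
    have "?T (s b) \<in> chart_img M j"
      using atlas_transition(1)[OF cotangent_smooth_atlas iM \<open>j \<in> charts M\<close> sb] overlap_subset[of M j i] by blast
    then have "annihilator n (iterated_forms M (complete_lift R) F) j (?T (s b)) = K j (?T (s b))"
      by (rule annihilator_eq[OF j])
    also have "\<dots> = fd ?T (s b) ` K i (s b)" by (rule kernel_natural[OF i(1) j sb, symmetric])
    also have "\<dots> = fd ?T (s b) ` range (fd s b)" by (simp only: range_s[OF bB])
    also have "\<dots> = range (fd (coord M j \<circ> \<sigma>) b)" unfolding d by (simp only: image_image)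
    finally show "range (fd (coord M j \<circ> \<sigma>) b) = annihilator n (iterated_forms M (complete_lift R) F) j (coord M j (\<sigma> b))"
      using fun_cong[OF comp, of b] by simp
  qed
  moreover have "m \<in> \<sigma> ` B"
    using r param(1)[OF i(2)] unfolding \<sigma>_def B_def by (intro image_eqI[of _ _ 0]) (auto simp: z0_def)
  ultimately show "\<exists>(B :: 'v set) \<sigma>. m \<in> \<sigma> ` B \<and>
      integral_manifold M (annihilator n (iterated_forms M (complete_lift R) F)) B \<sigma>" by blast
qed

end

theorem theorem4:
  fixes E :: "('i, 'a, 'v::euclidean_space) manifold"
    and Q :: "('j, 'b, 'w::euclidean_space) manifold"
    and \<tau> :: "'a \<Rightarrow> real"
    and R :: "('i, 'v) tensor11"
    and F :: "'a \<times> ('i \<Rightarrow> 'v) \<Rightarrow> real"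
    and n :: nat
  assumes "fibre_bundle E real_line Q \<tau>"
    and "DIM('v) = n + 1"
    and "tensor_field11 E R"
    and "\<forall>i\<in>charts E. \<forall>x\<in>chart_img E i. \<forall>v. tensor_on_form R (differential E \<tau>) i x v = 0"
    and "diagonalizable_distinct E R"
    and "vanishing_torsion E R"
    and "smooth_function (cotangent_bundle E) F"
    and "independent_forms (cotangent_bundle E) n
           (iterated_forms (cotangent_bundle E) (complete_lift R) F)"
  shows "frobenius_integrable TYPE('v) (cotangent_bundle E)
           (annihilator n (iterated_forms (cotangent_bundle E) (complete_lift R) F)) \<longleftrightarrow>
         vanishes_on (cotangent_bundle E)
           (annihilator n (iterated_forms (cotangent_bundle E) (complete_lift R) F))
           (ext_deriv (tensor_on_form (complete_lift R) (differential (cotangent_bundle E) F)))"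
proof -
  have "smooth_manifold E" using assms(1) by (simp add: fibre_bundle_def)
  then interpret cotangent_lift E R F n
    using assms by unfold_locales (auto simp: smooth_manifold_def smooth_atlas_def)
  show ?thesis
  proof
    assume int: "frobenius_integrable TYPE('v) M (annihilator n (iterated_forms M (complete_lift R) F))"
    show "vanishes_on M (annihilator n (iterated_forms M (complete_lift R) F))
           (ext_deriv (tensor_on_form (complete_lift R) (differential M F)))"
      unfolding vanishes_on_def
    proof (intro ballI allI impI)
      fix i W X Y z
      assume "i \<in> charts M"
        and X: "section_on M (annihilator n (iterated_forms M (complete_lift R) F)) i W X"
        and Y: "section_on M (annihilator n (iterated_forms M (complete_lift R) F)) i W Y" and "z \<in> W"
      then have i: "i \<in> charts E" and z: "z \<in> chart_img M i" unfolding section_on_def by auto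
      have "X z \<in> K i z" "Y z \<in> K i z"
        using X Y \<open>z \<in> W\<close> unfolding section_on_def annihilator_eq[OF i z, symmetric] by auto
      \<comment> \<open>\<open>integrable_imp_closed\<close> is used here for the form of index
        1.\<close>
      then show "ext_deriv (tensor_on_form (complete_lift R) (differential M F)) i z (X z) (Y z) = 0"
        unfolding ext_deriv_lift[OF i z] by (rule integrable_imp_closed[OF int i z])
    qed
  qed (rule closed_imp_integrable)
qed

end
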